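(* Suppose that for all compact $J\subset I$, $K\subset X$ there exist $C,r>0$ such that $$\Big|\log\frac{d_s(x,y)}{d_{s'}(x,y)}\Big|\le C|s-s'|\quad\text{for } s,s'\in J,\ x,y\in K \text{ (distinct) with } \inf_{s\in J}d_s(x,y)<r,$$ and that for all compact $J\subset I$, $K\subset X$ there exists $C'>0$ such that $$|h(s,x)-h(s',x)|\le C'|s-s'|,\quad s,s'\in J,\ x\in K.$$ Then the generalized Lorentzian product $hI\times_{\mathcal F}X$ satisfies the push-up property: for $x,y,z\in I\times X$, one has $x\ll z$ whenever $x\le y$ and $y\ll z$, or $x\ll y$ and $y\le z$.
   Context: Setting. $X$ is a locally compact topological space, $I\subset\mathbb R$ an open interval, $h:I\times X\to(0,\infty)$ continuous, and $\mathcal F=\{d_s\}_{s\in I}$ a family of metrics on $X$ whose induced length metrics generate the topology of $X$. Under the log-Lipschitz condition in the claim, absolute continuity of a curve $\beta:[a,b]\to X$ does not depend on the chosen metric in $\mathcal F$. For an absolutely continuous $\beta:[a,b]\to X$ let $|\beta_t'|_{d_s}$ be its metric speed with respect to $d_s$, and define the generalized metric speed $v_\beta(s,t)=\limsup_{\delta\to0}\frac1\delta\int_t^{t+\delta}|\beta_u'|_{d_s}\,\mathrm du$. An absolutely continuous curve $\gamma=(\alpha,\beta):[a,b]\to I\times X$ is future (past) directed if $\alpha'>0$ ($\alpha'<0$) a.e.; a future or past directed curve is causal if $v_\beta(\alpha_t,t)^2\le h(\gamma_t)^2\alpha'(t)^2$ a.e. and timelike if $v_\beta(\alpha_t,t)^2<h(\gamma_t)^2\alpha'(t)^2$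 a.e. Write $p\le q$ (resp. $p\ll q$) if there is a future directed causal (resp. timelike) curve from $p$ to $q$ ($\le$ is a preorder, so $p\le p$ always). $hI\times_{\mathcal F}X$ denotes $I\times X$ with these relations (and the associated time separation function). *)

theory Defs
  imports "HOL-Analysis.Analysis"
begin

definition curve_length :: "('a \<Rightarrow> 'a \<Rightarrow> real) \<Rightarrow> real \<Rightarrow> real \<Rightarrow> (real \<Rightarrow> 'a) \<Rightarrow> ennreal" where
  "curve_length d a b c =
     (SUP ts \<in> {ts. sorted ts \<and> set ts \<subseteq> {a..b}}.
        \<Sum>i<length ts - 1. ennreal (d (c (ts ! i)) (c (ts ! Suc i))))"

text \<open>The length metric takes the value \<open>\<infinity>\<close> at pairs of points that are not joined by a
  rectifiable curve.\<close>

definition length_metric :: "'a set \<Rightarrow> ('a \<Rightarrow> 'a \<Rightarrow> real) \<Rightarrow> 'a \<Rightarrow> 'a \<Rightarrow> ennreal" where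
  "length_metric M d x y =
     (INF c \<in> {c. pathin (Metric_space.mtopology M d) c \<and> c 0 = x \<and> c 1 = y}.
        curve_length d 0 1 c)"

definition generates_topology :: "('a \<Rightarrow> 'a \<Rightarrow> ennreal) \<Rightarrow> 'a topology \<Rightarrow> bool" where
  "generates_topology \<rho> X \<longleftrightarrow>
     (\<forall>U. openin X U \<longleftrightarrow>
        U \<subseteq> topspace X \<and> (\<forall>x\<in>U. \<exists>\<epsilon>>0. \<forall>y\<in>topspace X. \<rho> x y < \<epsilon> \<longrightarrow> y \<in> U))"

definition abs_continuous_curve ::
  "('a \<Rightarrow> 'a \<Rightarrow> real) \<Rightarrow> real \<Rightarrow> real \<Rightarrow> (real \<Rightarrow> 'a) \<Rightarrow> bool" where
  "abs_continuous_curve d a b c \<longleftrightarrow>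
     (\<forall>\<epsilon>>0. \<exists>\<delta>>0. \<forall>(n::nat) l r.
        (\<forall>i<n. a \<le> l i \<and> l i \<le> r i \<and> r i \<le> b) \<and>
        disjoint_family_on (\<lambda>i. {l i<..<r i}) {..<n} \<and>
        (\<Sum>i<n. r i - l i) < \<delta>
        \<longrightarrow> (\<Sum>i<n. d (c (l i)) (c (r i))) < \<epsilon>)"

text \<open>For an absolutely continuous curve the limit exists for almost every \<open>t\<close>; the value at
  the remaining points is unspecified and irrelevant below.\<close>

definition metric_speed ::
  "('a \<Rightarrow> 'a \<Rightarrow> real) \<Rightarrow> real \<Rightarrow> real \<Rightarrow> (real \<Rightarrow> 'a) \<Rightarrow> real \<Rightarrow> real" where
  "metric_speed d a b c t = Lim (at t within {a..b}) (\<lambda>u. d (c u) (c t) / \<bar>u - t\<bar>)"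

text \<open>The integral is oriented and \<open>\<delta>\<close> tends to \<open>0\<close> from both sides. It is taken over the
  completed measure, so the unspecified values of \<^const>\<open>metric_speed\<close> on a null set cannot
  destroy measurability.\<close>

definition gen_metric_speed ::
  "(real \<Rightarrow> 'a \<Rightarrow> 'a \<Rightarrow> real) \<Rightarrow> real \<Rightarrow> real \<Rightarrow> (real \<Rightarrow> 'a) \<Rightarrow> real \<Rightarrow> real \<Rightarrow> ereal" where
  "gen_metric_speed d a b \<beta> s t =
     Limsup (at 0) (\<lambda>\<delta>::real.
       ereal (1 / \<delta> * (LINT u=ereal t..ereal (t + \<delta>)|lebesgue. metric_speed (d s) a b \<beta> u)))"

definition abs_continuous_in_product ::
  "real set \<Rightarrow> 'a topology \<Rightarrow> (real \<Rightarrow> 'a \<Rightarrow> 'a \<Rightarrow> real) \<Rightarrow>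
    real \<Rightarrow> real \<Rightarrow> (real \<Rightarrow> real) \<Rightarrow> (real \<Rightarrow> 'a) \<Rightarrow> bool" where
  "abs_continuous_in_product I X d a b \<alpha> \<beta> \<longleftrightarrow>
     \<alpha> ` {a..b} \<subseteq> I \<and> \<beta> ` {a..b} \<subseteq> topspace X \<and>
     abs_continuous_curve dist a b \<alpha> \<and> (\<forall>s\<in>I. abs_continuous_curve (d s) a b \<beta>)"

definition future_directed ::
  "real set \<Rightarrow> 'a topology \<Rightarrow> (real \<Rightarrow> 'a \<Rightarrow> 'a \<Rightarrow> real) \<Rightarrow>
    real \<Rightarrow> real \<Rightarrow> (real \<Rightarrow> real) \<Rightarrow> (real \<Rightarrow> 'a) \<Rightarrow> bool" where
  "future_directed I X d a b \<alpha> \<beta> \<longleftrightarrow>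
     abs_continuous_in_product I X d a b \<alpha> \<beta> \<and>
     (AE t\<in>{a..b} in lebesgue. \<alpha> differentiable (at t) \<and> deriv \<alpha> t > 0)"

definition past_directed ::
  "real set \<Rightarrow> 'a topology \<Rightarrow> (real \<Rightarrow> 'a \<Rightarrow> 'a \<Rightarrow> real) \<Rightarrow>
    real \<Rightarrow> real \<Rightarrow> (real \<Rightarrow> real) \<Rightarrow> (real \<Rightarrow> 'a) \<Rightarrow> bool" where
  "past_directed I X d a b \<alpha> \<beta> \<longleftrightarrow>
     abs_continuous_in_product I X d a b \<alpha> \<beta> \<and>
     (AE t\<in>{a..b} in lebesgue. \<alpha> differentiable (at t) \<and> deriv \<alpha> t < 0)"

definition causal_curve ::
  "(real \<Rightarrow> 'a \<Rightarrow> real) \<Rightarrow> real set \<Rightarrow> 'a topology \<Rightarrow> (real \<Rightarrow> 'a \<Rightarrow> 'a \<Rightarrow> real) \<Rightarrow>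
    real \<Rightarrow> real \<Rightarrow> (real \<Rightarrow> real) \<Rightarrow> (real \<Rightarrow> 'a) \<Rightarrow> bool" where
  "causal_curve h I X d a b \<alpha> \<beta> \<longleftrightarrow>
     (future_directed I X d a b \<alpha> \<beta> \<or> past_directed I X d a b \<alpha> \<beta>) \<and>
     (AE t\<in>{a..b} in lebesgue.
        (gen_metric_speed d a b \<beta> (\<alpha> t) t)\<^sup>2 \<le> ereal ((h (\<alpha> t) (\<beta> t))\<^sup>2 * (deriv \<alpha> t)\<^sup>2))"

definition timelike_curve ::
  "(real \<Rightarrow> 'a \<Rightarrow> real) \<Rightarrow> real set \<Rightarrow> 'a topology \<Rightarrow> (real \<Rightarrow> 'a \<Rightarrow> 'a \<Rightarrow> real) \<Rightarrow>
    real \<Rightarrow> real \<Rightarrow> (real \<Rightarrow> real) \<Rightarrow> (real \<Rightarrow> 'a) \<Rightarrow> bool" where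
  "timelike_curve h I X d a b \<alpha> \<beta> \<longleftrightarrow>
     (future_directed I X d a b \<alpha> \<beta> \<or> past_directed I X d a b \<alpha> \<beta>) \<and>
     (AE t\<in>{a..b} in lebesgue.
        (gen_metric_speed d a b \<beta> (\<alpha> t) t)\<^sup>2 < ereal ((h (\<alpha> t) (\<beta> t))\<^sup>2 * (deriv \<alpha> t)\<^sup>2))"

text \<open>Curves are defined on nondegenerate intervals: with \<open>a = b\<close> allowed, every point would
  be chronologically related to itself. Reflexivity of the causal relation is imposed by hand.\<close>

definition causal_rel ::
  "(real \<Rightarrow> 'a \<Rightarrow> real) \<Rightarrow> real set \<Rightarrow> 'a topology \<Rightarrow> (real \<Rightarrow> 'a \<Rightarrow> 'a \<Rightarrow> real) \<Rightarrow>
    real \<times> 'a \<Rightarrow> real \<times> 'a \<Rightarrow> bool" where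
  "causal_rel h I X d p q \<longleftrightarrow>
     p = q \<or>
     (\<exists>a b \<alpha> \<beta>. a < b \<and> future_directed I X d a b \<alpha> \<beta> \<and> causal_curve h I X d a b \<alpha> \<beta> \<and>
        (\<alpha> a, \<beta> a) = p \<and> (\<alpha> b, \<beta> b) = q)"

definition chronological_rel ::
  "(real \<Rightarrow> 'a \<Rightarrow> real) \<Rightarrow> real set \<Rightarrow> 'a topology \<Rightarrow> (real \<Rightarrow> 'a \<Rightarrow> 'a \<Rightarrow> real) \<Rightarrow>
    real \<times> 'a \<Rightarrow> real \<times> 'a \<Rightarrow> bool" where
  "chronological_rel h I X d p q \<longleftrightarrow>
     (\<exists>a b \<alpha> \<beta>. a < b \<and> future_directed I X d a b \<alpha> \<beta> \<and> timelike_curve h I X d a b \<alpha> \<beta> \<and>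
        (\<alpha> a, \<beta> a) = p \<and> (\<alpha> b, \<beta> b) = q)"

definition push_up ::
  "(real \<Rightarrow> 'a \<Rightarrow> real) \<Rightarrow> real set \<Rightarrow> 'a topology \<Rightarrow> (real \<Rightarrow> 'a \<Rightarrow> 'a \<Rightarrow> real) \<Rightarrow> bool" where
  "push_up h I X d \<longleftrightarrow>
     (\<forall>x \<in> I \<times> topspace X. \<forall>y \<in> I \<times> topspace X. \<forall>z \<in> I \<times> topspace X.
        (causal_rel h I X d x y \<and> chronological_rel h I X d y z) \<or>
        (chronological_rel h I X d x y \<and> causal_rel h I X d y z)
        \<longrightarrow> chronological_rel h I X d x z)"

end

theory Submission
  imports Defs
begin

text \<open>
  The idea is to leave the space component \<open>\<beta>\<close> of a curve alone and to bend its time component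
  \<open>\<alpha>\<close>. Concatenate the causal and the timelike curve to a single causal curve on \<open>[a, b]\<close> that is
  timelike on some subinterval. If \<open>v s t\<close> is the speed of \<open>\<beta>\<close> at \<open>t\<close> for the metric \<open>d s\<close>, the two
  Lipschitz conditions say that
  \<open>v s' t / h s' (\<beta> t) \<le> (1 + L * \<bar>s - s'\<bar>) * v s t / h s (\<beta> t)\<close>
  for \<open>s'\<close> close to \<open>s\<close>. Hence replacing \<open>\<alpha>\<close> by \<open>\<alpha> + \<epsilon> * \<phi>\<close> gives a timelike curve as soon as
  \<open>\<phi>' > L * \<bar>\<phi>\<bar> * \<alpha>'\<close>, and on a set where the original curve is timelike with a uniform margin
  this inequality may even be violated by a constant of size comparable to that margin. Since \<open>\<phi>\<close> has to vanish at \<open>a\<close> and at \<open>b\<close>, it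
  must decrease somewhere, and this is done on such a set \<open>K\<close>: take
  \<open>\<phi> t = G (\<alpha> t) - G (\<alpha> a) - \<kappa> * \<mu> (K \<inter> [a, t])\<close> with \<open>\<mu>\<close> the Lebesgue measure, \<open>G\<close> a steep
  hyperbolic tangent centred at the value of \<open>\<alpha>\<close> near \<open>K\<close>, and \<open>\<kappa>\<close> fixed by \<open>\<phi> b = 0\<close>. Before \<open>K\<close>
  the function \<open>\<phi>\<close> grows from \<open>0\<close>, after \<open>K\<close> it grows from a negative value back to \<open>0\<close>
  (\<open>bending_function\<close>). It is irrelevant whether the causal or the timelike part comes first, so both
  halves of the push-up property are treated at once (\<open>timelike_perturbation\<close>).

  What makes this rigorous is a pointwise description of the generalized speed. A real
  absolutely continuous function is the integral of its derivative
  (\<open>abs_continuous_real_integral\<close>): its variation is absolutely continuous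
  (\<open>monotone_dominating\<close>), and a monotone absolutely continuous function defines a measure with a
  density. Consequently an absolutely continuous curve in a metric space has a metric speed almost
  everywhere (\<open>metric_derivative_exists\<close>), and outside one null set, independent of \<open>s\<close>, the
  generalized speed is the limit of the difference quotients of \<open>d s\<close> along \<open>\<beta>\<close>
  (\<open>gen_metric_speed_is_limit\<close>). Timelike and causal curves are thereby characterized by
  conditions on germs at almost every parameter value, which makes shifting, concatenating
  and perturbing them elementary, and the margin set \<open>K\<close> is found as a set where a sequence of
  continuous difference quotients is bounded below (\<open>compact_set_with_slack\<close>).
\<close>

section \<open>Absolutely continuous curves and their variation\<close>

definition thin_family :: "real \<Rightarrow> real \<Rightarrow> real \<Rightarrow> nat \<Rightarrow> (nat \<Rightarrow> real) \<Rightarrow> (nat \<Rightarrow> real) \<Rightarrow> bool" where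
  "thin_family a b \<delta> n l r \<longleftrightarrow>
     (\<forall>i<n. a \<le> l i \<and> l i \<le> r i \<and> r i \<le> b) \<and>
     disjoint_family_on (\<lambda>i. {l i<..<r i}) {..<n} \<and> (\<Sum>i<n. r i - l i) < \<delta>"

lemma abs_continuous_curve_iff:
  "abs_continuous_curve d a b c \<longleftrightarrow>
     (\<forall>\<epsilon>>0. \<exists>\<delta>>0. \<forall>n l r. thin_family a b \<delta> n l r \<longrightarrow> (\<Sum>i<n. d (c (l i)) (c (r i))) < \<epsilon>)"
  by (simp only: abs_continuous_curve_def thin_family_def)

lemma thin_familyI:
  assumes "\<And>i. i < n \<Longrightarrow> a \<le> l i \<and> l i \<le> r i \<and> r i \<le> b"
    and "\<And>i j. i < n \<Longrightarrow> j < n \<Longrightarrow> i \<noteq> j \<Longrightarrow> {l i<..<r i} \<inter> {l j<..<r j} = {}"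
    and "(\<Sum>i<n. r i - l i) < \<delta>"
  shows "thin_family a b \<delta> n l r"
  using assms by (auto simp: thin_family_def disjoint_family_on_def)

lemma thin_familyD:
  assumes "thin_family a b \<delta> n l r"
  shows "\<And>i. i < n \<Longrightarrow> a \<le> l i \<and> l i \<le> r i \<and> r i \<le> b"
    and "\<And>i j. i < n \<Longrightarrow> j < n \<Longrightarrow> i \<noteq> j \<Longrightarrow> {l i<..<r i} \<inter> {l j<..<r j} = {}"
    and "(\<Sum>i<n. r i - l i) < \<delta>"
  using assms by (auto simp: thin_family_def disjoint_family_on_def)

text \<open>Comparing increments over subintervals and cutting intervals at a point both rest on this.\<close>

lemma thin_family_shrink:
  assumes "thin_family A B \<delta> n l r" "\<delta> \<le> \<delta>'"
    and "\<And>i. i < n \<Longrightarrow> a \<le> l' i \<and> l' i \<le> r' i \<and> r' i \<le> b \<and>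
           {l' i<..<r' i} \<subseteq> {l i<..<r i} \<and> r' i - l' i \<le> r i - l i"
  shows "thin_family a b \<delta>' n l' r'"
proof (rule thin_familyI)
  fix i j assume "i < n" "j < n" "i \<noteq> j"
  then show "{l' i<..<r' i} \<inter> {l' j<..<r' j} = {}"
    using thin_familyD(2)[OF assms(1)] assms(3) by blast
next
  have "(\<Sum>i<n. r' i - l' i) \<le> (\<Sum>i<n. r i - l i)" using assms(3) by (intro sum_mono) simp
  then show "(\<Sum>i<n. r' i - l' i) < \<delta>'" using thin_familyD(3)[OF assms(1)] assms(2) by simp
qed (use assms(3) in simp)

text \<open>Finite sets of pairs are used besides indexed families, because unions of families are
  then just unions of sets.\<close>

definition nonoverlapping :: "real \<Rightarrow> real \<Rightarrow> (real \<times> real) set \<Rightarrow> bool" where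
  "nonoverlapping a b P \<longleftrightarrow>
     finite P \<and> (\<forall>p\<in>P. a \<le> fst p \<and> fst p < snd p \<and> snd p \<le> b) \<and>
     disjoint_family_on (\<lambda>p. {fst p<..<snd p}) P"

definition variation :: "(real \<Rightarrow> real \<Rightarrow> real) \<Rightarrow> real \<Rightarrow> real \<Rightarrow> real" where
  "variation D a b = (SUP P \<in> {P. nonoverlapping a b P}. \<Sum>p\<in>P. D (fst p) (snd p))"

lemma abs_continuous_curve_nonoverlapping:
  assumes "abs_continuous_curve D a b (\<lambda>t. t)" "\<epsilon> > 0"
  obtains \<delta> where "\<delta> > 0"
    "\<And>P. nonoverlapping a b P \<Longrightarrow> (\<Sum>p\<in>P. snd p - fst p) < \<delta> \<Longrightarrow>
       (\<Sum>p\<in>P. D (fst p) (snd p)) < \<epsilon>"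
proof -
  obtain \<delta> where "\<delta> > 0" and \<delta>:
    "\<forall>n l r. thin_family a b \<delta> n l r \<longrightarrow> (\<Sum>i<n. D (l i) (r i)) < \<epsilon>"
    using assms unfolding abs_continuous_curve_iff by blast
  have "(\<Sum>p\<in>P. D (fst p) (snd p)) < \<epsilon>"
    if P: "nonoverlapping a b P" and len: "(\<Sum>p\<in>P. snd p - fst p) < \<delta>" for P
  proof -
    have "finite P" using P by (simp add: nonoverlapping_def)
    then obtain f where f: "bij_betw f {..<card P} P"
      using ex_bij_betw_nat_finite by (auto simp: atLeast0LessThan)
    have *: "(\<Sum>i<card P. g (f i)) = (\<Sum>p\<in>P. g p)" for g :: "real \<times> real \<Rightarrow> real"
      using sum.reindex_bij_betw[OF f] .
    have fP: "f i \<in> P" if "i < card P" for i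
      using f that by (auto simp: bij_betw_def)
    have "(\<Sum>i<card P. D (fst (f i)) (snd (f i))) < \<epsilon>"
    proof (rule \<delta>[rule_format, OF thin_familyI])
      show "a \<le> fst (f i) \<and> fst (f i) \<le> snd (f i) \<and> snd (f i) \<le> b" if "i < card P" for i
        using P fP[OF that] by (auto simp: nonoverlapping_def less_imp_le)
      show "{fst (f i)<..<snd (f i)} \<inter> {fst (f j)<..<snd (f j)} = {}"
        if "i < card P" "j < card P" "i \<noteq> j" for i j
        using P f fP that unfolding nonoverlapping_def disjoint_family_on_def bij_betw_def
        by (meson inj_onD lessThan_iff)
      show "(\<Sum>i<card P. snd (f i) - fst (f i)) < \<delta>"
        using len by (subst *[where g="\<lambda>p. snd p - fst p"])
    qed
    then show ?thesis by (subst (asm) *[where g="\<lambda>p. D (fst p) (snd p)"])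
  qed
  with \<open>\<delta> > 0\<close> show thesis by (rule that)
qed

lemma nonoverlapping_empty [simp]: "nonoverlapping a b {}"
  by (simp add: nonoverlapping_def disjoint_family_on_def)

lemma nonoverlapping_singleton: "a \<le> l \<Longrightarrow> l < r \<Longrightarrow> r \<le> b \<Longrightarrow> nonoverlapping a b {(l, r)}"
  by (simp add: nonoverlapping_def disjoint_family_on_def)

lemma nonoverlapping_mono:
  "nonoverlapping a b P \<Longrightarrow> a' \<le> a \<Longrightarrow> b \<le> b' \<Longrightarrow> nonoverlapping a' b' P"
  by (force simp: nonoverlapping_def)

text \<open>The intervals are nonempty, so families that refine different intervals are also disjoint as
  sets of pairs, and sums over their union split.\<close>

lemma nonoverlapping_UN:
  assumes "finite A" and P: "\<And>i. i \<in> A \<Longrightarrow> nonoverlapping (l i) (r i) (P i)"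
    and bd: "\<And>i. i \<in> A \<Longrightarrow> a \<le> l i \<and> r i \<le> b"
    and disj: "disjoint_family_on (\<lambda>i. {l i<..<r i}) A"
  shows "nonoverlapping a b (\<Union>i\<in>A. P i)" and "disjoint_family_on P A"
proof -
  have sub: "{fst p<..<snd p} \<subseteq> {l i<..<r i}" "fst p < snd p" if "i \<in> A" "p \<in> P i" for i p
    using P[OF \<open>i \<in> A\<close>] that by (auto simp: nonoverlapping_def)
  have ne: "{fst p<..<snd p} \<noteq> {}" if "i \<in> A" "p \<in> P i" for i p
    using sub(2)[OF that] by simp
  have cross: "{fst p<..<snd p} \<inter> {fst q<..<snd q} = {}"
    if "i \<in> A" "j \<in> A" "i \<noteq> j" "p \<in> P i" "q \<in> P j" for i j p q
    using disj sub(1)[of i p] sub(1)[of j q] that unfolding disjoint_family_on_def by blast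
  show "disjoint_family_on P A"
    using cross ne unfolding disjoint_family_on_def by (metis disjoint_iff inf.idem)
  show "nonoverlapping a b (\<Union>i\<in>A. P i)"
    unfolding nonoverlapping_def
  proof (intro conjI ballI)
    show "finite (\<Union>i\<in>A. P i)" using assms by (auto simp: nonoverlapping_def)
    fix p assume "p \<in> (\<Union>i\<in>A. P i)"
    then obtain i where i: "i \<in> A" "p \<in> P i" by auto
    then show "a \<le> fst p" "fst p < snd p" "snd p \<le> b"
      using P[OF i(1)] bd[OF i(1)] by (auto simp: nonoverlapping_def)
  next
    show "disjoint_family_on (\<lambda>p. {fst p<..<snd p}) (\<Union>i\<in>A. P i)"
      unfolding disjoint_family_on_def
    proof (intro ballI impI)
      fix p q assume "p \<in> (\<Union>i\<in>A. P i)" "q \<in> (\<Union>i\<in>A. P i)" "p \<noteq> q"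
      then obtain i j where i: "i \<in> A" "p \<in> P i" and j: "j \<in> A" "q \<in> P j" by auto
      show "{fst p<..<snd p} \<inter> {fst q<..<snd q} = {}"
      proof (cases "i = j")
        case True
        then show ?thesis
          using P[OF i(1)] i j \<open>p \<noteq> q\<close> by (auto simp: nonoverlapping_def disjoint_family_on_def)
      next
        case False
        then show ?thesis using cross i j by blast
      qed
    qed
  qed
qed

lemma nonoverlapping_Un:
  assumes "nonoverlapping s t P" "nonoverlapping t u Q" "s \<le> t" "t \<le> u"
  shows "nonoverlapping s u (P \<union> Q)" and "P \<inter> Q = {}"
proof -
  let ?P = "\<lambda>i::bool. if i then P else Q"
  let ?l = "\<lambda>i. if i then s else t" and ?r = "\<lambda>i. if i then t else u"
  have 1: "nonoverlapping (?l i) (?r i) (?P i)" for i using assms by auto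
  have 2: "disjoint_family_on (\<lambda>i. {?l i<..<?r i}) {True, False}"
    by (auto simp: disjoint_family_on_def)
  have "nonoverlapping s u (\<Union>i\<in>{True, False}. ?P i)" "disjoint_family_on ?P {True, False}"
    using nonoverlapping_UN[OF _ 1 _ 2, of s u] assms by auto
  then show "nonoverlapping s u (P \<union> Q)" "P \<inter> Q = {}"
    by (auto simp: disjoint_family_on_def Un_commute)
qed

lemma nonoverlapping_length:
  assumes P: "nonoverlapping a b P" and U: "(\<Union>p\<in>P. {fst p<..<snd p}) \<subseteq> U" "U \<in> fmeasurable lborel"
  shows "(\<Sum>p\<in>P. snd p - fst p) \<le> measure lborel U"
proof -
  have "(\<Sum>p\<in>P. snd p - fst p) = (\<Sum>p\<in>P. measure lborel {fst p<..<snd p})"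
    using P by (intro sum.cong) (auto simp: nonoverlapping_def less_imp_le)
  also have "\<dots> = measure lborel (\<Union>p\<in>P. {fst p<..<snd p})"
    using P by (intro measure_finite_Union[symmetric]) (auto simp: nonoverlapping_def less_imp_le)
  also have "\<dots> \<le> measure lborel U"
    using P U by (intro measure_mono_fmeasurable) (auto simp: nonoverlapping_def)
  finally show ?thesis .
qed

lemma nonoverlapping_length_Icc:
  assumes "nonoverlapping a b P" "a \<le> b"
  shows "(\<Sum>p\<in>P. snd p - fst p) \<le> b - a"
proof -
  have "(\<Union>p\<in>P. {fst p<..<snd p}) \<subseteq> {a..b}" using assms(1) by (force simp: nonoverlapping_def)
  then have "(\<Sum>p\<in>P. snd p - fst p) \<le> measure lborel {a..b}"
    by (rule nonoverlapping_length[OF assms(1)]) (use assms(2) in \<open>auto intro!: fmeasurableI\<close>)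
  then show ?thesis using assms(2) by simp
qed

lemma nonoverlapping_image:
  assumes P: "nonoverlapping a b P" and "L \<subseteq> P"
    and f: "\<And>p. p \<in> L \<Longrightarrow> a' \<le> fst (f p) \<and> fst (f p) < snd (f p) \<and> snd (f p) \<le> b' \<and>
          fst p \<le> fst (f p) \<and> snd (f p) \<le> snd p"
  shows "nonoverlapping a' b' (f ` L)" and "inj_on f L"
proof -
  have dis: "{fst (f p)<..<snd (f p)} \<inter> {fst (f q)<..<snd (f q)} = {}" if "p \<in> L" "q \<in> L" "p \<noteq> q" for p q
  proof -
    have "{fst p<..<snd p} \<inter> {fst q<..<snd q} = {}"
      using P \<open>L \<subseteq> P\<close> that by (auto simp: nonoverlapping_def disjoint_family_on_def)
    moreover have "{fst (f r)<..<snd (f r)} \<subseteq> {fst r<..<snd r}" if "r \<in> L" for r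
      using f[OF that] by auto
    ultimately show ?thesis using that by blast
  qed
  show "inj_on f L"
  proof (rule inj_onI, rule ccontr)
    fix p q assume pq: "p \<in> L" "q \<in> L" "f p = f q" "p \<noteq> q"
    then have "{fst (f p)<..<snd (f p)} = {}" using dis[OF pq(1,2,4)] by simp
    then show False using f[OF pq(1)] by simp
  qed
  have "finite L" using P \<open>L \<subseteq> P\<close> finite_subset by (auto simp: nonoverlapping_def)
  moreover have "disjoint_family_on (\<lambda>p. {fst p<..<snd p}) (f ` L)"
    unfolding disjoint_family_on_def using dis by blast
  ultimately show "nonoverlapping a' b' (f ` L)" using f by (auto simp: nonoverlapping_def)
qed

text \<open>Cut every interval at \<open>t\<close>; by the triangle inequality this can only increase the sum.\<close>

lemma nonoverlapping_split:
  fixes D :: "real \<Rightarrow> real \<Rightarrow> real"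
  assumes P: "nonoverlapping s u P" and t: "s \<le> t" "t \<le> u"
    and tri: "\<And>x y z. s \<le> x \<Longrightarrow> x \<le> y \<Longrightarrow> y \<le> z \<Longrightarrow> z \<le> u \<Longrightarrow> D x z \<le> D x y + D y z"
  obtains P1 P2 where "nonoverlapping s t P1" "nonoverlapping t u P2"
    "(\<Sum>p\<in>P. D (fst p) (snd p)) \<le> (\<Sum>p\<in>P1. D (fst p) (snd p)) + (\<Sum>p\<in>P2. D (fst p) (snd p))"
proof -
  define L where "L = {p\<in>P. fst p < t}"
  define R where "R = {p\<in>P. t < snd p}"
  define f where "f p = (fst p, min (snd p) t)" for p :: "real \<times> real"
  define g where "g p = (max (fst p) t, snd p)" for p :: "real \<times> real"
  have fin: "finite P" using P by (simp add: nonoverlapping_def)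
  have bd: "s \<le> fst p" "fst p < snd p" "snd p \<le> u" if "p \<in> P" for p
    using P that by (auto simp: nonoverlapping_def)
  have sub: "L \<subseteq> P" "R \<subseteq> P" by (auto simp: L_def R_def)
  have fL: "s \<le> fst (f p) \<and> fst (f p) < snd (f p) \<and> snd (f p) \<le> t \<and> fst p \<le> fst (f p) \<and> snd (f p) \<le> snd p"
    if "p \<in> L" for p using that bd[of p] by (auto simp: f_def L_def)
  have gR: "t \<le> fst (g p) \<and> fst (g p) < snd (g p) \<and> snd (g p) \<le> u \<and> fst p \<le> fst (g p) \<and> snd (g p) \<le> snd p"
    if "p \<in> R" for p using that bd[of p] by (auto simp: g_def R_def)
  note 1 = nonoverlapping_image(1)[OF P sub(1) fL] and 2 = nonoverlapping_image(1)[OF P sub(2) gR]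
  note injf = nonoverlapping_image(2)[OF P sub(1) fL] and injg = nonoverlapping_image(2)[OF P sub(2) gR]
  have "(\<Sum>p\<in>P. D (fst p) (snd p)) \<le>
      (\<Sum>p\<in>P. (if p \<in> L then D (fst (f p)) (snd (f p)) else 0) +
             (if p \<in> R then D (fst (g p)) (snd (g p)) else 0))"
  proof (rule sum_mono)
    fix p assume p: "p \<in> P"
    show "D (fst p) (snd p) \<le> (if p \<in> L then D (fst (f p)) (snd (f p)) else 0) +
        (if p \<in> R then D (fst (g p)) (snd (g p)) else 0)"
      using p bd[OF p] tri[of "fst p" t "snd p"]
      by (cases "fst p < t"; cases "t < snd p") (auto simp: L_def R_def f_def g_def max_def min_def)
  qed
  also have "\<dots> = (\<Sum>p\<in>L. D (fst (f p)) (snd (f p))) + (\<Sum>p\<in>R. D (fst (g p)) (snd (g p)))"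
  proof -
    have "P \<inter> L = L" "P \<inter> R = R" by (auto simp: L_def R_def)
    then show ?thesis using fin by (simp add: sum.distrib sum.inter_restrict[symmetric])
  qed
  also have "\<dots> = (\<Sum>p\<in>f ` L. D (fst p) (snd p)) + (\<Sum>p\<in>g ` R. D (fst p) (snd p))"
    by (simp add: sum.reindex injf injg)
  finally show thesis using that 1 2 by blast
qed

text \<open>Over an interval shorter than the \<open>\<delta>\<close> that belongs to \<open>\<epsilon> = 1\<close> all sums are at most \<open>1\<close>, and
  finitely many such intervals cover \<open>[a, b]\<close>.\<close>

lemma variation_bounded:
  assumes ac: "abs_continuous_curve D a b (\<lambda>t. t)" and "a \<le> b"
    and tri: "\<And>x y z. a \<le> x \<Longrightarrow> x \<le> y \<Longrightarrow> y \<le> z \<Longrightarrow> z \<le> b \<Longrightarrow> D x z \<le> D x y + D y z"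
  shows "\<exists>B. \<forall>P. nonoverlapping a b P \<longrightarrow> (\<Sum>p\<in>P. D (fst p) (snd p)) \<le> B"
proof -
  obtain \<delta> where "\<delta> > 0" and \<delta>:
    "\<And>P. nonoverlapping a b P \<Longrightarrow> (\<Sum>p\<in>P. snd p - fst p) < \<delta> \<Longrightarrow> (\<Sum>p\<in>P. D (fst p) (snd p)) < 1"
    using abs_continuous_curve_nonoverlapping[OF ac, of 1] by auto
  have bounded: "\<exists>B. \<forall>P. nonoverlapping a (min b (a + real n * (\<delta> / 2))) P \<longrightarrow> (\<Sum>p\<in>P. D (fst p) (snd p)) \<le> B" for n
  proof (induction n)
    case 0
    have "(\<Sum>p\<in>P. D (fst p) (snd p)) \<le> 0" if "nonoverlapping a (min b (a + real 0 * (\<delta> / 2))) P" for P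
    proof -
      have "P = {}" using that \<open>a \<le> b\<close> unfolding nonoverlapping_def by force
      then show ?thesis by simp
    qed
    then show ?case by blast
  next
    case (Suc n)
    let ?t = "min b (a + real n * (\<delta> / 2))" and ?u = "min b (a + real (Suc n) * (\<delta> / 2))"
    have tu: "a \<le> ?t" "?t \<le> ?u" "?u \<le> b" "?u - ?t < \<delta>"
    proof -
      have "real (Suc n) * (\<delta> / 2) = real n * (\<delta> / 2) + \<delta> / 2" by (simp add: field_simps)
      moreover have "0 \<le> real n * (\<delta> / 2)" using \<open>\<delta> > 0\<close> by simp
      ultimately show "a \<le> ?t" "?t \<le> ?u" "?u \<le> b" "?u - ?t < \<delta>"
        using \<open>\<delta> > 0\<close> \<open>a \<le> b\<close> by linarith+
    qed
    obtain B where B: "\<And>P. nonoverlapping a ?t P \<Longrightarrow> (\<Sum>p\<in>P. D (fst p) (snd p)) \<le> B"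
      using Suc by blast
    have "(\<Sum>p\<in>P. D (fst p) (snd p)) \<le> B + 1" if P: "nonoverlapping a ?u P" for P
    proof -
      obtain P1 P2 where P12: "nonoverlapping a ?t P1" "nonoverlapping ?t ?u P2"
        "(\<Sum>p\<in>P. D (fst p) (snd p)) \<le> (\<Sum>p\<in>P1. D (fst p) (snd p)) + (\<Sum>p\<in>P2. D (fst p) (snd p))"
      proof (rule nonoverlapping_split[OF P tu(1,2), of D])
        show "D x z \<le> D x y + D y z" if "a \<le> x" "x \<le> y" "y \<le> z" "z \<le> ?u" for x y z
          using that tu(3) by (intro tri) linarith+
      qed
      have "(\<Sum>p\<in>P2. D (fst p) (snd p)) < 1"
        using nonoverlapping_mono[OF P12(2) tu(1) tu(3)] nonoverlapping_length_Icc[OF P12(2) tu(2)] tu(4)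
        by (intro \<delta>) auto
      then show ?thesis using P12(3) B[OF P12(1)] by linarith
    qed
    then show ?case by blast
  qed
  obtain n :: nat where "real n * (\<delta> / 2) > b - a"
    using \<open>\<delta> > 0\<close> reals_Archimedean3[of "\<delta>/2"] by (meson half_gt_zero)
  then have "min b (a + real n * (\<delta> / 2)) = b" by linarith
  with bounded[of n] show ?thesis by simp
qed

text \<open>The variation is the smallest monotone function whose increments dominate \<open>D\<close>; its absolute
  continuity comes from refining each interval of a family by a family that nearly attains the
  variation, which does not increase the total length.\<close>

lemma monotone_dominating:
  assumes ac: "abs_continuous_curve D a b (\<lambda>t. t)" and "a \<le> b"
    and nonneg: "\<And>x y. x \<in> {a..b} \<Longrightarrow> y \<in> {a..b} \<Longrightarrow> 0 \<le> D x y" and refl: "\<And>x. x \<in> {a..b} \<Longrightarrow> D x x = 0"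
    and tri: "\<And>x y z. a \<le> x \<Longrightarrow> x \<le> y \<Longrightarrow> y \<le> z \<Longrightarrow> z \<le> b \<Longrightarrow> D x z \<le> D x y + D y z"
  obtains V where "\<And>s t. a \<le> s \<Longrightarrow> s \<le> t \<Longrightarrow> t \<le> b \<Longrightarrow> D s t \<le> V t - V s"
    "abs_continuous_curve dist a b V"
proof -
  let ?S = "\<lambda>P. \<Sum>p\<in>P. D (fst p) (snd p)"
  have "\<exists>B. \<forall>P. nonoverlapping a b P \<longrightarrow> ?S P \<le> B"
    by (intro variation_bounded[OF ac \<open>a \<le> b\<close>] tri)
  then obtain B where B: "\<And>P. nonoverlapping a b P \<Longrightarrow> ?S P \<le> B" by blast
  have bdd: "bdd_above (?S ` {P. nonoverlapping s t P})" if "a \<le> s" "t \<le> b" for s t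
    using B nonoverlapping_mono that by (intro bdd_aboveI[of _ B]) auto
  have up: "?S P \<le> variation D s t" if "a \<le> s" "t \<le> b" "nonoverlapping s t P" for s t P
    unfolding variation_def using that bdd by (intro cSUP_upper) auto
  have lub: "variation D s t \<le> c" if "\<And>P. nonoverlapping s t P \<Longrightarrow> ?S P \<le> c" for s t c
    unfolding variation_def using that nonoverlapping_empty by (intro cSUP_least) blast+
  have near: "\<exists>P. nonoverlapping s t P \<and> variation D s t - e < ?S P" if "a \<le> s" "t \<le> b" "e > 0" for s t e
  proof (rule ccontr)
    assume "\<not> ?thesis"
    then have "variation D s t \<le> variation D s t - e" by (intro lub) (meson not_less)
    with \<open>e > 0\<close> show False by simp
  qed
  have sub: "variation D a t \<le> variation D a s + variation D s t" if st: "a \<le> s" "s \<le> t" "t \<le> b" for s t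
  proof (rule lub)
    fix P assume P: "nonoverlapping a t P"
    obtain P1 P2 where "nonoverlapping a s P1" "nonoverlapping s t P2" "?S P \<le> ?S P1 + ?S P2"
    proof (rule nonoverlapping_split[OF P st(1,2), of D])
      show "D x z \<le> D x y + D y z" if "a \<le> x" "x \<le> y" "y \<le> z" "z \<le> t" for x y z
        using that st by (intro tri) linarith+
    qed
    then show "?S P \<le> variation D a s + variation D s t"
      using up[of a s P1] up[of s t P2] st by linarith
  qed
  define V where "V = variation D a"
  have dom: "D s t \<le> V t - V s" if st: "a \<le> s" "s \<le> t" "t \<le> b" for s t
  proof (cases "s = t")
    case True
    then show ?thesis using refl st by auto
  next
    case False
    then have "s < t" using st by simp
    have "V s \<le> V t - D s t" unfolding V_def
    proof (rule lub)
      fix P assume P: "nonoverlapping a s P"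
      have Q: "nonoverlapping s t {(s, t)}" using \<open>s < t\<close> by (intro nonoverlapping_singleton) auto
      note U = nonoverlapping_Un[OF P Q st(1,2)]
      have "finite P" using P by (simp add: nonoverlapping_def)
      then have "?S (P \<union> {(s, t)}) = ?S P + D s t"
        using U(2) by (subst sum.union_disjoint) auto
      then show "?S P \<le> variation D a t - D s t" using up[OF _ _ U(1)] st by simp
    qed
    then show ?thesis by simp
  qed
  have "abs_continuous_curve dist a b V"
    unfolding abs_continuous_curve_iff
  proof (intro allI impI)
    fix \<epsilon> :: real assume "\<epsilon> > 0"
    then have "\<epsilon> / 2 > 0" by simp
    obtain \<delta> where "\<delta> > 0" and \<delta>: "\<And>P. nonoverlapping a b P \<Longrightarrow> (\<Sum>p\<in>P. snd p - fst p) < \<delta> \<Longrightarrow> ?S P < \<epsilon> / 2"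
      by (rule abs_continuous_curve_nonoverlapping[OF ac \<open>\<epsilon> / 2 > 0\<close>]) blast
    have "(\<Sum>i<n. dist (V (l i)) (V (r i))) < \<epsilon>" if thin: "thin_family a b \<delta> n l r" for n l r
    proof -
      have lr: "\<forall>i<n. a \<le> l i \<and> l i \<le> r i \<and> r i \<le> b"
        and disj: "disjoint_family_on (\<lambda>i. {l i<..<r i}) {..<n}" and len: "(\<Sum>i<n. r i - l i) < \<delta>"
        using thin by (auto simp: thin_family_def)
      define e where "e = \<epsilon> / (4 * (real n + 1))"
      have "e > 0" using \<open>\<epsilon> > 0\<close> by (simp add: e_def)
      have "\<forall>i\<in>{..<n}. \<exists>P. nonoverlapping (l i) (r i) P \<and> variation D (l i) (r i) - e < ?S P"
        using near lr \<open>e > 0\<close> by simp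
      then obtain P where P: "\<And>i. i \<in> {..<n} \<Longrightarrow> nonoverlapping (l i) (r i) (P i)"
        and Pe: "\<And>i. i < n \<Longrightarrow> variation D (l i) (r i) - e < ?S (P i)"
        by (metis lessThan_iff)
      have finP: "finite (P i)" if "i < n" for i using P that by (simp add: nonoverlapping_def)
      have U: "nonoverlapping a b (\<Union>i<n. P i)" "disjoint_family_on P {..<n}"
        using nonoverlapping_UN[OF _ P _ disj, of a b] lr by auto
      have sumU: "(\<Sum>p\<in>(\<Union>i<n. P i). g p) = (\<Sum>i<n. \<Sum>p\<in>P i. g p)" for g :: "real \<times> real \<Rightarrow> real"
        using U(2) finP by (intro sum.UNION_disjoint) (auto simp: disjoint_family_on_def)
      have "(\<Sum>p\<in>(\<Union>i<n. P i). snd p - fst p) \<le> (\<Sum>i<n. r i - l i)"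
        unfolding sumU using P lr by (intro sum_mono nonoverlapping_length_Icc) auto
      then have "?S (\<Union>i<n. P i) < \<epsilon> / 2" using len by (intro \<delta> U) simp
      then have half: "(\<Sum>i<n. ?S (P i)) < \<epsilon> / 2" by (subst (asm) sumU)
      have "(\<Sum>i<n. dist (V (l i)) (V (r i))) \<le> (\<Sum>i<n. ?S (P i) + e)"
      proof (rule sum_mono)
        fix i assume "i \<in> {..<n}"
        then have i: "i < n" "a \<le> l i" "l i \<le> r i" "r i \<le> b" using lr by auto
        have "0 \<le> V (r i) - V (l i)"
          using dom[OF i(2-4)] nonneg[of "l i" "r i"] i by auto
        moreover have "V (r i) - V (l i) \<le> variation D (l i) (r i)"
          using sub[OF i(2-4)] by (simp add: V_def)
        ultimately show "dist (V (l i)) (V (r i)) \<le> ?S (P i) + e"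
          using Pe[OF i(1)] by (simp add: dist_real_def)
      qed
      also have "\<dots> < \<epsilon> / 2 + real n * e" using half by (simp add: sum.distrib)
      also have "real n * e \<le> \<epsilon> / 4"
        using \<open>\<epsilon> > 0\<close> by (simp add: e_def field_simps)
      finally show ?thesis using \<open>\<epsilon> > 0\<close> by simp
    qed
    with \<open>\<delta> > 0\<close> show "\<exists>\<delta>>0. \<forall>n l r. thin_family a b \<delta> n l r \<longrightarrow>
        (\<Sum>i<n. dist (V (l i)) (V (r i))) < \<epsilon>" by blast
  qed
  with dom show thesis by (rule that)
qed

section \<open>Uniform continuity, comparison and concatenation\<close>

lemma abs_continuous_curve_uniform:
  assumes "abs_continuous_curve D a b c" "\<epsilon> > 0"
  shows "\<exists>\<delta>>0. \<forall>s t. a \<le> s \<and> s \<le> t \<and> t \<le> b \<and> t - s < \<delta> \<longrightarrow> D (c s) (c t) < \<epsilon>"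
proof -
  obtain \<delta> where "\<delta> > 0" and \<delta>:
    "\<forall>n l r. thin_family a b \<delta> n l r \<longrightarrow> (\<Sum>i<n. D (c (l i)) (c (r i))) < \<epsilon>"
    using assms unfolding abs_continuous_curve_iff by blast
  have "D (c s) (c t) < \<epsilon>" if "a \<le> s" "s \<le> t" "t \<le> b" "t - s < \<delta>" for s t
    using \<delta>[rule_format, of 1 "\<lambda>_. s" "\<lambda>_. t"] that
    by (simp add: thin_family_def disjoint_family_on_def)
  with \<open>\<delta> > 0\<close> show ?thesis by blast
qed

lemma abs_continuous_curve_continuous:
  assumes "abs_continuous_curve dist a b f"
  shows "continuous_on {a..b} f"
  unfolding continuous_on_iff
proof (intro ballI allI impI)
  fix x and e :: real assume "x \<in> {a..b}" "e > 0"
  obtain \<delta> where "\<delta> > 0" and \<delta>: "\<forall>s t. a \<le> s \<and> s \<le> t \<and> t \<le> b \<and> t - s < \<delta> \<longrightarrow> dist (f s) (f t) < e"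
    using abs_continuous_curve_uniform[OF assms \<open>e > 0\<close>] by blast
  show "\<exists>d>0. \<forall>x'\<in>{a..b}. dist x' x < d \<longrightarrow> dist (f x') (f x) < e"
  proof (intro exI[of _ \<delta>] conjI ballI impI)
    fix y assume "y \<in> {a..b}" "dist y x < \<delta>"
    then show "dist (f y) (f x) < e"
      using \<delta>[rule_format, of x y] \<delta>[rule_format, of y x] \<open>x \<in> {a..b}\<close>
      by (cases "x \<le> y") (auto simp: dist_real_def dist_commute[of "f y"])
  qed (fact \<open>\<delta> > 0\<close>)
qed

text \<open>A curve inherits absolute continuity from another one if each of its increments is controlled
  by an increment of the other over a subinterval, up to a Lipschitz error. Subintervals
  rather than the same interval are allowed so that a curve may be frozen outside \<open>[a, b]\<close>.\<close>

lemma abs_continuous_curve_transfer: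
  assumes ac: "abs_continuous_curve D a b c"
    and le: "\<And>s t. A \<le> s \<Longrightarrow> s \<le> t \<Longrightarrow> t \<le> B \<Longrightarrow>
          \<exists>s' t'. D' (c' s) (c' t) \<le> M * D (c s') (c t') + M * (t - s) \<and>
            {s'<..<t'} \<subseteq> {s<..<t} \<and> a \<le> s' \<and> s' \<le> t' \<and> t' \<le> b \<and> t' - s' \<le> t - s"
    and "M \<ge> 0"
  shows "abs_continuous_curve D' A B c'"
  unfolding abs_continuous_curve_iff
proof (intro allI impI)
  fix \<epsilon> :: real assume "\<epsilon> > 0"
  define e where "e = \<epsilon> / (2 * (M + 1))"
  have "e > 0" using \<open>\<epsilon> > 0\<close> \<open>M \<ge> 0\<close> by (simp add: e_def)
  then obtain \<delta> where "\<delta> > 0" and \<delta>: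
    "\<forall>n l r. thin_family a b \<delta> n l r \<longrightarrow> (\<Sum>i<n. D (c (l i)) (c (r i))) < e"
    using ac unfolding abs_continuous_curve_iff by blast
  have "(\<Sum>i<n. D' (c' (l i)) (c' (r i))) < \<epsilon>" if thin: "thin_family A B (min \<delta> e) n l r" for n l r
  proof -
    have "\<forall>i\<in>{..<n}. \<exists>s' t'. D' (c' (l i)) (c' (r i)) \<le> M * D (c s') (c t') + M * (r i - l i) \<and>
            {s'<..<t'} \<subseteq> {l i<..<r i} \<and> a \<le> s' \<and> s' \<le> t' \<and> t' \<le> b \<and> t' - s' \<le> r i - l i"
      using thin_familyD(1)[OF thin] le by auto
    then obtain l' where "\<forall>i\<in>{..<n}. \<exists>t'. D' (c' (l i)) (c' (r i)) \<le> M * D (c (l' i)) (c t') + M * (r i - l i) \<and>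
            {l' i<..<t'} \<subseteq> {l i<..<r i} \<and> a \<le> l' i \<and> l' i \<le> t' \<and> t' \<le> b \<and> t' - l' i \<le> r i - l i"
      unfolding bchoice_iff by (rule exE)
    then obtain r' where *: "\<forall>i\<in>{..<n}. D' (c' (l i)) (c' (r i)) \<le> M * D (c (l' i)) (c (r' i)) + M * (r i - l i) \<and>
            {l' i<..<r' i} \<subseteq> {l i<..<r i} \<and> a \<le> l' i \<and> l' i \<le> r' i \<and> r' i \<le> b \<and> r' i - l' i \<le> r i - l i"
      unfolding bchoice_iff by (rule exE)
    have "thin_family a b \<delta> n l' r'" using * by (intro thin_family_shrink[OF thin]) auto
    then have "M * (\<Sum>i<n. D (c (l' i)) (c (r' i))) \<le> M * e"
      using \<delta> \<open>M \<ge> 0\<close> by (intro mult_left_mono) (simp_all add: less_imp_le)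
    moreover have "M * (\<Sum>i<n. r i - l i) \<le> M * e"
      using \<open>M \<ge> 0\<close> thin_familyD(3)[OF thin] by (intro mult_left_mono) simp_all
    moreover have "(\<Sum>i<n. D' (c' (l i)) (c' (r i))) \<le>
        (\<Sum>i<n. M * D (c (l' i)) (c (r' i)) + M * (r i - l i))"
      using * by (intro sum_mono) simp
    moreover have "(\<Sum>i<n. M * D (c (l' i)) (c (r' i)) + M * (r i - l i)) =
        M * (\<Sum>i<n. D (c (l' i)) (c (r' i))) + M * (\<Sum>i<n. r i - l i)"
      by (simp add: sum.distrib sum_distrib_left)
    moreover have "2 * (M * e) < \<epsilon>"
    proof -
      have "2 * (M * e) = (M / (M + 1)) * \<epsilon>"
        using \<open>M \<ge> 0\<close> by (simp add: e_def field_simps)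
      also have "\<dots> < 1 * \<epsilon>" using \<open>M \<ge> 0\<close> \<open>\<epsilon> > 0\<close> by (intro mult_strict_right_mono) auto
      finally show ?thesis by simp
    qed
    ultimately show ?thesis by linarith
  qed
  with \<open>\<delta> > 0\<close> \<open>e > 0\<close> show "\<exists>\<delta>>0. \<forall>n l r. thin_family A B \<delta> n l r \<longrightarrow>
      (\<Sum>i<n. D' (c' (l i)) (c' (r i))) < \<epsilon>"
    by (intro exI[of _ "min \<delta> e"]) simp
qed

lemma abs_continuous_curve_le:
  assumes "abs_continuous_curve D a b c" "M \<ge> 0"
    and "\<And>s t. a \<le> s \<Longrightarrow> s \<le> t \<Longrightarrow> t \<le> b \<Longrightarrow> D' (c' s) (c' t) \<le> M * D (c s) (c t) + M * (t - s)"
  shows "abs_continuous_curve D' a b c'"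
proof (rule abs_continuous_curve_transfer[OF assms(1) _ assms(2)])
  fix s t assume "a \<le> s" "s \<le> t" "t \<le> b"
  then show "\<exists>s' t'. D' (c' s) (c' t) \<le> M * D (c s') (c t') + M * (t - s) \<and>
      {s'<..<t'} \<subseteq> {s<..<t} \<and> a \<le> s' \<and> s' \<le> t' \<and> t' \<le> b \<and> t' - s' \<le> t - s"
    using assms(3)[of s t] by (intro exI[of _ s] exI[of _ t]) simp
qed

lemma abs_continuous_curve_shift:
  assumes "abs_continuous_curve \<rho> a b c"
  shows "abs_continuous_curve \<rho> (a + k) (b + k) (\<lambda>t. c (t - k))"
  unfolding abs_continuous_curve_iff
proof (intro allI impI)
  fix \<epsilon> :: real assume "\<epsilon> > 0"
  then obtain \<delta> where "\<delta> > 0" and \<delta>: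
    "\<forall>n l r. thin_family a b \<delta> n l r \<longrightarrow> (\<Sum>i<n. \<rho> (c (l i)) (c (r i))) < \<epsilon>"
    using assms unfolding abs_continuous_curve_iff by blast
  have "thin_family a b \<delta> n (\<lambda>i. l i - k) (\<lambda>i. r i - k)" if thin: "thin_family (a + k) (b + k) \<delta> n l r" for n l r
  proof (rule thin_familyI)
    show "a \<le> l i - k \<and> l i - k \<le> r i - k \<and> r i - k \<le> b" if "i < n" for i
      using thin_familyD(1)[OF thin that] by auto
    show "{l i - k<..<r i - k} \<inter> {l j - k<..<r j - k} = {}" if "i < n" "j < n" "i \<noteq> j" for i j
      using thin_familyD(2)[OF thin that] by auto
    show "(\<Sum>i<n. r i - k - (l i - k)) < \<delta>" using thin_familyD(3)[OF thin] by simp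
  qed
  with \<delta> \<open>\<delta> > 0\<close> show "\<exists>\<delta>>0. \<forall>n l r. thin_family (a + k) (b + k) \<delta> n l r \<longrightarrow>
      (\<Sum>i<n. \<rho> (c (l i - k)) (c (r i - k))) < \<epsilon>"
    by blast
qed

lemma abs_continuous_curve_cong:
  assumes "abs_continuous_curve \<rho> a b c" "\<And>t. t \<in> {a..b} \<Longrightarrow> c' t = c t"
  shows "abs_continuous_curve \<rho> a b c'"
proof (rule abs_continuous_curve_transfer[OF assms(1), of _ _ \<rho> c' 1])
  fix s t assume "a \<le> s" "s \<le> t" "t \<le> b"
  then show "\<exists>s' t'. \<rho> (c' s) (c' t) \<le> 1 * \<rho> (c s') (c t') + 1 * (t - s) \<and>
      {s'<..<t'} \<subseteq> {s<..<t} \<and> a \<le> s' \<and> s' \<le> t' \<and> t' \<le> b \<and> t' - s' \<le> t - s"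
    using assms(2) by (intro exI[of _ s] exI[of _ t]) simp
qed simp

text \<open>Cut the intervals of a thin family at the junction \<open>b\<close> and treat the two sides separately.\<close>

lemma abs_continuous_curve_join:
  assumes "Metric_space M \<rho>" and c: "c ` {a..e} \<subseteq> M" and ab: "a \<le> b" "b \<le> e"
    and ac1: "abs_continuous_curve \<rho> a b c" and ac2: "abs_continuous_curve \<rho> b e c"
  shows "abs_continuous_curve \<rho> a e c"
  unfolding abs_continuous_curve_iff
proof (intro allI impI)
  interpret Metric_space M \<rho> by fact
  fix \<epsilon> :: real assume "\<epsilon> > 0"
  then have "\<epsilon> / 2 > 0" by simp
  obtain \<delta>1 where "\<delta>1 > 0" and \<delta>1:
    "\<forall>n l r. thin_family a b \<delta>1 n l r \<longrightarrow> (\<Sum>i<n. \<rho> (c (l i)) (c (r i))) < \<epsilon> / 2"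
    using ac1 \<open>\<epsilon> / 2 > 0\<close> unfolding abs_continuous_curve_iff by blast
  obtain \<delta>2 where "\<delta>2 > 0" and \<delta>2:
    "\<forall>n l r. thin_family b e \<delta>2 n l r \<longrightarrow> (\<Sum>i<n. \<rho> (c (l i)) (c (r i))) < \<epsilon> / 2"
    using ac2 \<open>\<epsilon> / 2 > 0\<close> unfolding abs_continuous_curve_iff by blast
  have "(\<Sum>i<n. \<rho> (c (l i)) (c (r i))) < \<epsilon>" if thin: "thin_family a e (min \<delta>1 \<delta>2) n l r" for n l r
  proof -
    have "thin_family a b \<delta>1 n (\<lambda>i. min (l i) b) (\<lambda>i. min (r i) b)"
    proof (rule thin_family_shrink[OF thin])
      fix i assume "i < n"
      then have "a \<le> l i" "l i \<le> r i" "r i \<le> e" using thin_familyD(1)[OF thin] by auto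
      then show "a \<le> min (l i) b \<and> min (l i) b \<le> min (r i) b \<and> min (r i) b \<le> b \<and>
          {min (l i) b<..<min (r i) b} \<subseteq> {l i<..<r i} \<and> min (r i) b - min (l i) b \<le> r i - l i"
        using ab by auto
    qed simp
    then have "(\<Sum>i<n. \<rho> (c (min (l i) b)) (c (min (r i) b))) < \<epsilon> / 2" using \<delta>1 by blast
    moreover have "thin_family b e \<delta>2 n (\<lambda>i. max (l i) b) (\<lambda>i. max (r i) b)"
    proof (rule thin_family_shrink[OF thin])
      fix i assume "i < n"
      then have "a \<le> l i" "l i \<le> r i" "r i \<le> e" using thin_familyD(1)[OF thin] by auto
      then show "b \<le> max (l i) b \<and> max (l i) b \<le> max (r i) b \<and> max (r i) b \<le> e \<and>
          {max (l i) b<..<max (r i) b} \<subseteq> {l i<..<r i} \<and> max (r i) b - max (l i) b \<le> r i - l i"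
        using ab by auto
    qed simp
    then have "(\<Sum>i<n. \<rho> (c (max (l i) b)) (c (max (r i) b))) < \<epsilon> / 2" using \<delta>2 by blast
    moreover have "(\<Sum>i<n. \<rho> (c (l i)) (c (r i))) \<le>
        (\<Sum>i<n. \<rho> (c (min (l i) b)) (c (min (r i) b)) + \<rho> (c (max (l i) b)) (c (max (r i) b)))"
    proof (rule sum_mono)
      fix i assume "i \<in> {..<n}"
      then have i: "a \<le> l i" "l i \<le> r i" "r i \<le> e" using thin_familyD(1)[OF thin] by auto
      then have "c (l i) \<in> M" "c (r i) \<in> M" "c b \<in> M" using c ab by (auto simp: image_subset_iff)
      then show "\<rho> (c (l i)) (c (r i)) \<le>
          \<rho> (c (min (l i) b)) (c (min (r i) b)) + \<rho> (c (max (l i) b)) (c (max (r i) b))"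
        using triangle[of "c (l i)" "c b" "c (r i)"] i
        by (auto simp: min_def max_def)
    qed
    ultimately show ?thesis by (simp add: sum.distrib)
  qed
  with \<open>\<delta>1 > 0\<close> \<open>\<delta>2 > 0\<close> show "\<exists>\<delta>>0. \<forall>n l r. thin_family a e \<delta> n l r \<longrightarrow>
      (\<Sum>i<n. \<rho> (c (l i)) (c (r i))) < \<epsilon>"
    by (intro exI[of _ "min \<delta>1 \<delta>2"]) simp
qed

section \<open>Integral representation of absolutely continuous functions\<close>

definition has_density_on :: "(real \<Rightarrow> real) \<Rightarrow> (real \<Rightarrow> real) \<Rightarrow> real \<Rightarrow> real \<Rightarrow> bool" where
  "has_density_on f g a b \<longleftrightarrow>
     (\<forall>s t. a \<le> s \<and> s \<le> t \<and> t \<le> b \<longrightarrow> (g has_integral (f t - f s)) {s..t})"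

lemma has_density_onD:
  "has_density_on f g a b \<Longrightarrow> a \<le> s \<Longrightarrow> s \<le> t \<Longrightarrow> t \<le> b \<Longrightarrow> (g has_integral (f t - f s)) {s..t}"
  by (simp add: has_density_on_def)

text \<open>A null set is covered by countably many nonoverlapping intervals of small total length, the
  cells of a dyadic decomposition that lie inside an open superset of small measure. Absolute
  continuity bounds the increments of \<open>F\<close> over finitely many of them at a time, and this
  passes to the countable union.\<close>

lemma interval_measure_absolutely_continuous:
  assumes mono: "\<And>x y. x \<le> y \<Longrightarrow> F x \<le> F y" and cont: "continuous_on UNIV F"
    and ac: "\<And>a b. abs_continuous_curve dist a b F"
  shows "absolutely_continuous (lborel :: real measure) (interval_measure F)"
  unfolding absolutely_continuous_def
proof
  fix N :: "real set" assume N: "N \<in> null_sets lborel"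
  let ?\<mu> = "emeasure (interval_measure F)"
  have Nb: "N \<in> sets borel" using N by auto
  have "?\<mu> (N \<inter> {- real k..real k}) = 0" for k
  proof (cases "k = 0")
    case True
    have "?\<mu> {0..0} = F 0 - F 0" using mono cont by (intro emeasure_interval_measure_Icc) auto
    then show ?thesis
      using True emeasure_mono[of "N \<inter> {- real k..real k}" "{0..0}" "interval_measure F"] by simp
  next
    case False
    let ?S = "N \<inter> {- real k..real k}"
    have "?\<mu> ?S \<le> 0 + ennreal \<epsilon>" if "\<epsilon> > 0" for \<epsilon> :: real
    proof -
      have ac': "abs_continuous_curve (\<lambda>s t. dist (F s) (F t)) (- real k) (real k) (\<lambda>t. t)"
        using ac[of "- real k" "real k"] by (simp only: abs_continuous_curve_def)
      obtain \<delta> where "\<delta> > 0" and \<delta>: "\<And>P. nonoverlapping (- real k) (real k) P \<Longrightarrow>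
          (\<Sum>p\<in>P. snd p - fst p) < \<delta> \<Longrightarrow> (\<Sum>p\<in>P. dist (F (fst p)) (F (snd p))) < \<epsilon>"
        by (rule abs_continuous_curve_nonoverlapping[OF ac' \<open>\<epsilon> > 0\<close>]) blast
      obtain U where U: "open U" "N \<subseteq> U" "emeasure lborel (U - N) < ennreal \<delta>"
        using outer_regular_lborel[OF Nb, of \<delta>] \<open>\<delta> > 0\<close> by auto
      have "emeasure lborel U = emeasure lborel ((U - N) \<union> N)"
        using U(2) by (intro arg_cong[of _ _ "emeasure lborel"]) blast
      also have "\<dots> = emeasure lborel (U - N)"
        using N U(1) by (intro emeasure_Un_null_set) auto
      finally have Ud: "emeasure lborel U < ennreal \<delta>" using U(3) by simp
      have "\<exists>e>0. ball x e \<subseteq> U" if "x \<in> U" for x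
        using U(1) that open_contains_ball by blast
      then obtain \<rho> where \<rho>: "\<And>x. x \<in> U \<Longrightarrow> \<rho> x > 0 \<and> ball x (\<rho> x) \<subseteq> U" by metis
      define g where "g x = (if x \<in> U then ball x (\<rho> x) else UNIV)" for x
      have "gauge g" using \<rho> by (auto simp: gauge_def g_def)
      have S_sub: "?S \<subseteq> cbox (- real k) (real k)" "box (- real k) (real k) \<noteq> {}"
        using False by auto
      obtain \<D> where \<D>: "countable \<D>" "\<Union>\<D> \<subseteq> cbox (- real k) (real k)"
          "\<forall>K\<in>\<D>. interior K \<noteq> {} \<and> (\<exists>c d. K = cbox c d)"
          "pairwise (\<lambda>A B. interior A \<inter> interior B = {}) \<D>"
          "\<forall>K\<in>\<D>. \<exists>x \<in> ?S \<inter> K. K \<subseteq> g x"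
          "?S \<subseteq> \<Union>\<D>"
        by (rule covering_lemma[OF S_sub \<open>gauge g\<close>]) (metis that)
      have cell: "K = {Inf K..Sup K}" "Inf K < Sup K" if KD: "K \<in> \<D>" for K
      proof -
        obtain c d where K: "K = {c..d}" using \<D>(3) KD by auto
        moreover have "c < d" using \<D>(3) KD K by (auto simp: interior_atLeastAtMost_real)
        ultimately show "K = {Inf K..Sup K}" "Inf K < Sup K" by auto
      qed
      have KU: "K \<subseteq> U" if KD: "K \<in> \<D>" for K
      proof -
        obtain x where "x \<in> ?S" "K \<subseteq> g x" using bspec[OF \<D>(5) KD] by blast
        moreover from this have "x \<in> U" using U(2) by blast
        ultimately show ?thesis using \<rho>[of x] by (simp add: g_def) blast
      qed
      have meas: "K \<in> sets borel" if "K \<in> \<D>" for K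
        by (subst cell(1)[OF that]) simp
      have int: "interior K = {Inf K<..<Sup K}" if "K \<in> \<D>" for K
        using arg_cong[OF cell(1)[OF that], of interior] by (simp add: interior_atLeastAtMost_real)
      have fin: "?\<mu> (\<Union>E) \<le> ennreal \<epsilon>" if E: "finite E" "E \<subseteq> \<D>" for E
      proof -
        define f where "f K = (Inf K, Sup K)" for K :: "real set"
        have inj: "inj_on f E"
          using cell(1) E(2) by (intro inj_onI) (metis f_def prod.inject subsetD)
        have no: "nonoverlapping (- real k) (real k) (f ` E)"
          unfolding nonoverlapping_def
        proof (intro conjI)
          show "\<forall>p\<in>f ` E. - real k \<le> fst p \<and> fst p < snd p \<and> snd p \<le> real k"
          proof
            fix p assume "p \<in> f ` E"
            then obtain K where K: "K \<in> E" "p = f K" by blast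
            then have "K \<in> \<D>" using E by blast
            have "{Inf K..Sup K} \<subseteq> {- real k..real k}"
              using \<D>(2) \<open>K \<in> \<D>\<close> cell(1)[OF \<open>K \<in> \<D>\<close>] by auto
            then show "- real k \<le> fst p \<and> fst p < snd p \<and> snd p \<le> real k"
              using cell(2)[OF \<open>K \<in> \<D>\<close>] K by (auto simp: f_def)
          qed
          show "disjoint_family_on (\<lambda>p. {fst p<..<snd p}) (f ` E)"
            unfolding disjoint_family_on_def
          proof (intro ballI impI)
            fix p q assume "p \<in> f ` E" "q \<in> f ` E" "p \<noteq> q"
            then obtain K L where KL: "K \<in> E" "L \<in> E" "K \<noteq> L" "p = f K" "q = f L" by blast
            have D: "K \<in> \<D>" "L \<in> \<D>" using KL E by auto
            then have "interior K \<inter> interior L = {}"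
              using \<D>(4) KL(3) by (auto simp: pairwise_def)
            moreover have "interior K = {fst p<..<snd p}" "interior L = {fst q<..<snd q}"
              using KL(4,5) int[OF D(1)] int[OF D(2)] by (simp_all add: f_def)
            ultimately show "{fst p<..<snd p} \<inter> {fst q<..<snd q} = {}" by metis
          qed
        qed (use E in auto)
        have "(\<Sum>p\<in>f ` E. snd p - fst p) \<le> measure lborel U"
        proof (rule nonoverlapping_length[OF no])
          show "(\<Union>p\<in>f ` E. {fst p<..<snd p}) \<subseteq> U"
          proof
            fix x assume "x \<in> (\<Union>p\<in>f ` E. {fst p<..<snd p})"
            then obtain K where K: "K \<in> E" "x \<in> {Inf K<..<Sup K}" by (auto simp: f_def)
            then have "x \<in> {Inf K..Sup K}" by simp
            then show "x \<in> U" using KU[of K] cell(1)[of K] K E by blast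
          qed
          show "U \<in> fmeasurable lborel"
            using U(1) Ud by (intro fmeasurableI) (auto intro: less_le_trans[OF _ top_greatest])
        qed
        also have "\<dots> < \<delta>"
        proof -
          have "emeasure lborel U = ennreal (measure lborel U)"
            using Ud by (intro emeasure_eq_ennreal_measure) auto
          then show ?thesis using Ud by (simp add: ennreal_less_iff)
        qed
        finally have "(\<Sum>p\<in>f ` E. dist (F (fst p)) (F (snd p))) < \<epsilon>" by (intro \<delta> no)
        then have *: "(\<Sum>K\<in>E. F (Sup K) - F (Inf K)) < \<epsilon>"
        proof -
          assume "(\<Sum>p\<in>f ` E. dist (F (fst p)) (F (snd p))) < \<epsilon>"
          moreover have "(\<Sum>p\<in>f ` E. dist (F (fst p)) (F (snd p))) = (\<Sum>K\<in>E. F (Sup K) - F (Inf K))"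
            unfolding sum.reindex[OF inj] o_def
          proof (rule sum.cong)
            fix K assume "K \<in> E"
            then have "F (Inf K) \<le> F (Sup K)" using cell(2)[of K] E by (intro mono) auto
            then show "dist (F (fst (f K))) (F (snd (f K))) = F (Sup K) - F (Inf K)"
              by (simp add: f_def dist_real_def)
          qed simp
          ultimately show ?thesis by simp
        qed
        have "?\<mu> (\<Union>E) \<le> (\<Sum>K\<in>E. ?\<mu> K)"
          using emeasure_subadditive_finite[of E "\<lambda>K. K" "interval_measure F"] E meas
          by (simp add: image_subset_iff subset_iff)
        also have "\<dots> = (\<Sum>K\<in>E. ennreal (F (Sup K) - F (Inf K)))"
        proof (rule sum.cong)
          fix K assume "K \<in> E"
          then have K: "K = {Inf K..Sup K}" "Inf K \<le> Sup K"
            using cell[of K] E by (auto simp: less_imp_le)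
          have "?\<mu> {Inf K..Sup K} = F (Sup K) - F (Inf K)"
            using mono cont K(2) by (intro emeasure_interval_measure_Icc) auto
          then show "?\<mu> K = ennreal (F (Sup K) - F (Inf K))" using K(1) by simp
        qed simp
        also have "\<dots> = ennreal (\<Sum>K\<in>E. F (Sup K) - F (Inf K))"
          using cell(2) E mono by (intro sum_ennreal) (simp add: less_imp_le subset_iff)
        also have "\<dots> \<le> ennreal \<epsilon>" using * by (intro ennreal_leI) simp
        finally show ?thesis .
      qed
      have "?\<mu> (\<Union>\<D>) \<le> ennreal \<epsilon>"
      proof (cases "\<D> = {}")
        case False
        define e where "e = from_nat_into \<D>"
        have e: "range e = \<D>" using False \<D>(1) by (simp add: e_def range_from_nat_into)
        have "?\<mu> (\<Union>n. \<Union>i\<le>n. e i) = (SUP n. ?\<mu> (\<Union>i\<le>n. e i))"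
        proof (rule SUP_emeasure_incseq[symmetric])
          show "range (\<lambda>n. \<Union>i\<le>n. e i) \<subseteq> sets (interval_measure F)"
            using meas e by auto
          show "incseq (\<lambda>n. \<Union>i\<le>n. e i)" by (force simp: incseq_def)
        qed
        also have "\<dots> \<le> ennreal \<epsilon>"
        proof (rule SUP_least)
          fix n show "?\<mu> (\<Union>i\<le>n. e i) \<le> ennreal \<epsilon>"
            using fin[of "e ` {..n}"] e by auto
        qed
        also have "(\<Union>n. \<Union>i\<le>n. e i) = \<Union>\<D>" using e by auto
        finally show ?thesis .
      qed simp
      moreover have "?\<mu> ?S \<le> ?\<mu> (\<Union>\<D>)"
        using \<D>(1,6) meas by (intro emeasure_mono) (auto intro: sets.countable_Union)
      ultimately show ?thesis by simp
    qed
    then show ?thesis using ennreal_le_epsilon[of 0 "?\<mu> ?S"] by (simp add: le_zero_eq)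
  qed
  then have "(\<Union>k. N \<inter> {- real k..real k}) \<in> null_sets (interval_measure F)"
    using Nb by (intro null_sets_UN) (auto simp: null_sets_def)
  moreover have "(\<Union>k. N \<inter> {- real k..real k}) = N"
  proof -
    have "\<exists>k. \<bar>x\<bar> \<le> real k" for x using real_arch_simple by blast
    then show ?thesis by (force simp: abs_le_iff)
  qed
  ultimately show "N \<in> null_sets (interval_measure F)" by simp
qed

text \<open>The integrand is the Radon-Nikodym density of the measure that \<open>V\<close>, continued by constants
  outside \<open>[a, b]\<close>, defines.\<close>

lemma monotone_abs_continuous_integral:
  fixes V :: "real \<Rightarrow> real"
  assumes "a < b" and mono: "\<And>s t. a \<le> s \<Longrightarrow> s \<le> t \<Longrightarrow> t \<le> b \<Longrightarrow> V s \<le> V t"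
    and ac: "abs_continuous_curve dist a b V"
  shows "\<exists>g. (\<forall>x. 0 \<le> g x) \<and> has_density_on V g a b"
proof -
  \<comment> \<open>the retraction of the line onto \<open>[a, b]\<close>\<close>
  define cl where "cl x = max a (min b x)" for x
  define F where "F x = V (cl x)" for x
  have cl: "a \<le> cl x" "cl x \<le> b" for x using \<open>a < b\<close> by (auto simp: cl_def)
  have clmono: "cl x \<le> cl y" if "x \<le> y" for x y using that by (auto simp: cl_def)
  have clid: "cl x = x" if "a \<le> x" "x \<le> b" for x using that by (auto simp: cl_def)
  have monoF: "F x \<le> F y" if "x \<le> y" for x y
    unfolding F_def using cl clmono[OF that] by (intro mono) auto
  have contF: "continuous_on UNIV F"
  proof -
    have "continuous_on UNIV cl" unfolding cl_def by (intro continuous_intros)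
    then have "continuous_on UNIV (V \<circ> cl)"
      using abs_continuous_curve_continuous[OF ac] cl
      by (intro continuous_on_compose) (auto elim: continuous_on_subset)
    then show ?thesis by (simp add: F_def[abs_def] o_def)
  qed
  have acF: "abs_continuous_curve dist A B F" for A B
  proof (rule abs_continuous_curve_transfer[OF ac, of _ _ dist F 1])
    fix s t assume "A \<le> s" "s \<le> t" "t \<le> B"
    have "{cl s<..<cl t} \<subseteq> {s<..<t}" "cl t - cl s \<le> t - s" using \<open>a < b\<close> \<open>s \<le> t\<close>
      by (auto simp: cl_def max_def min_def split: if_splits)
    then show "\<exists>s' t'. dist (F s) (F t) \<le> 1 * dist (V s') (V t') + 1 * (t - s) \<and>
        {s'<..<t'} \<subseteq> {s<..<t} \<and> a \<le> s' \<and> s' \<le> t' \<and> t' \<le> b \<and> t' - s' \<le> t - s"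
      using cl clmono[OF \<open>s \<le> t\<close>] \<open>s \<le> t\<close> unfolding F_def
      by (intro exI[of _ "cl s"] exI[of _ "cl t"]) simp
  qed simp
  have "absolutely_continuous lborel (interval_measure F)"
    by (intro interval_measure_absolutely_continuous monoF contF acF)
  then have "\<exists>f\<in>borel_measurable lborel. density lborel f = interval_measure F"
    by (intro sigma_finite_measure.Radon_Nikodym sigma_finite_lborel) auto
  then obtain f where f: "f \<in> borel_measurable borel" "density lborel f = interval_measure F" by auto
  have em: "(\<integral>\<^sup>+x. f x * indicator {s..t} x \<partial>lborel) = ennreal (V t - V s)"
    if st: "a \<le> s" "s \<le> t" "t \<le> b" for s t
  proof -
    have "(\<integral>\<^sup>+x. f x * indicator {s..t} x \<partial>lborel) = emeasure (density lborel f) {s..t}"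
      using f(1) by (intro emeasure_density[symmetric]) auto
    also have "\<dots> = ennreal (F t - F s)"
      unfolding f(2) using monoF contF st by (intro emeasure_interval_measure_Icc) auto
    also have "F t - F s = V t - V s" using st by (simp add: F_def clid)
    finally show ?thesis .
  qed
  define g where "g x = enn2real (f x)" for x
  have g_borel: "g \<in> borel_measurable borel" unfolding g_def using f(1) by measurable
  have g0: "0 \<le> g x" for x by (simp add: g_def)
  have fin: "AE x in lborel. f x * indicator {a..b} x \<noteq> \<infinity>"
  proof (rule nn_integral_PInf_AE)
    show "(\<integral>\<^sup>+x. f x * indicator {a..b} x \<partial>lborel) \<noteq> \<infinity>" using em[of a b] \<open>a < b\<close> by simp
  qed (use f(1) in measurable)
  have "(g has_integral (V t - V s)) {s..t}" if st: "a \<le> s" "s \<le> t" "t \<le> b" for s t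
  proof -
    have "(\<integral>\<^sup>+x. ennreal (g x * indicator {s..t} x) \<partial>lborel) = (\<integral>\<^sup>+x. f x * indicator {s..t} x \<partial>lborel)"
    proof (rule nn_integral_cong_AE)
      show "AE x in lborel. ennreal (g x * indicator {s..t} x) = f x * indicator {s..t} x"
        using fin
      proof eventually_elim
        case (elim x)
        show ?case
        proof (cases "x \<in> {s..t}")
          case True
          then have "f x \<noteq> \<infinity>" using elim st by auto
          then show ?thesis using True by (simp add: g_def less_top)
        qed simp
      qed
    qed
    then have "((\<lambda>x. g x * indicator {s..t} x) has_integral (V t - V s)) UNIV"
      using em[OF st] mono[OF st] g_borel
      by (intro nn_integral_has_integral borel_measurable_times borel_measurable_indicator) (simp_all add: g0)
    then have "((\<lambda>x. if x \<in> {s..t} then g x else 0) has_integral (V t - V s)) UNIV"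
      by (rule has_integral_eq[rotated]) auto
    then show ?thesis by (simp only: has_integral_restrict_UNIV)
  qed
  then show ?thesis using g0 by (auto simp: has_density_on_def)
qed

lemma integral_subinterval_diff:
  fixes g :: "real \<Rightarrow> real"
  assumes "g integrable_on {a..b}" "a \<le> x" "x \<le> y" "y \<le> b"
  shows "integral {a..y} g - integral {a..x} g = integral {x..y} g"
proof -
  have "integral {a..x} g + integral {x..y} g = integral {a..y} g"
    using assms by (intro Henstock_Kurzweil_Integration.integral_combine integrable_on_subinterval[OF assms(1)]) auto
  then show ?thesis by simp
qed

lemma eventually_at_in_Icc: "a < t \<Longrightarrow> t < b \<Longrightarrow> \<forall>\<^sub>F u in at t. u \<in> {a..b::real}"
  using eventually_at_in_open'[of "{a<..<b}" t] by (auto elim: eventually_mono)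

text \<open>The one-sided theorem \<open>integrable_ccontinuous_explicit\<close> gives the right derivative; applied to
  the reflected function \<open>\<lambda>x. f (- x)\<close> it gives the left one.\<close>

theorem lebesgue_differentiation:
  fixes g :: "real \<Rightarrow> real"
  assumes g: "g integrable_on {a..b}"
  shows "negligible {t\<in>{a..b}. \<not> ((\<lambda>x. integral {a..x} g) has_real_derivative g t) (at t)}"
proof -
  define f where "f x = (if x \<in> {a..b} then g x else 0)" for x
  have "f integrable_on UNIV"
    unfolding f_def using g by (simp only: integrable_restrict_UNIV)
  then have f: "f integrable_on cbox c d" for c d by (rule integrable_on_subcbox) auto
  have f': "(\<lambda>x. f (- x)) integrable_on cbox c d" for c d :: real
    using f[of "- d" "- c"] Henstock_Kurzweil_Integration.integrable_reflect_real[where f=f and a="- d" and b="- c"] by simp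
  obtain N1 where N1: "negligible N1" and
    r: "\<forall>x e. x \<notin> N1 \<and> 0 < e \<longrightarrow> (\<exists>d>0. \<forall>h. 0 < h \<and> h < d \<longrightarrow>
          norm (integral (cbox x (x + h *\<^sub>R One)) f /\<^sub>R h ^ DIM(real) - f x) < e)"
    by (rule integrable_ccontinuous_explicit[OF f]) (metis that)
  obtain N2 where N2: "negligible N2" and
    l: "\<forall>x e. x \<notin> N2 \<and> 0 < e \<longrightarrow> (\<exists>d>0. \<forall>h. 0 < h \<and> h < d \<longrightarrow>
          norm (integral (cbox x (x + h *\<^sub>R One)) (\<lambda>x. f (- x)) /\<^sub>R h ^ DIM(real) - f (- x)) < e)"
    by (rule integrable_ccontinuous_explicit[OF f']) (metis that)
  define N where "N = N1 \<union> uminus ` N2 \<union> {a, b}"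
  have "negligible (uminus ` N2)"
    using N2 by (intro negligible_differentiable_image_negligible) (auto intro!: derivative_intros)
  then have "negligible N" using N1 by (auto simp: N_def)
  moreover have "{t\<in>{a..b}. \<not> ((\<lambda>x. integral {a..x} g) has_real_derivative g t) (at t)} \<subseteq> N"
  proof (rule subsetI, rule ccontr)
    fix t assume t: "t \<in> {t\<in>{a..b}. \<not> ((\<lambda>x. integral {a..x} g) has_real_derivative g t) (at t)}" and "t \<notin> N"
    then have tab: "a < t" "t < b" and tN: "t \<notin> N1" "- t \<notin> N2"
      by (auto simp: N_def) (metis image_eqI minus_minus)
    have sub: "integral {a..v} g - integral {a..u} g = integral {u..v} f" if "a \<le> u" "u \<le> v" "v \<le> b" for u v
    proof -
      have "integral {a..v} g - integral {a..u} g = integral {u..v} g"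
        using g that by (rule integral_subinterval_diff)
      moreover have "integral {u..v} g = integral {u..v} f"
        using that by (intro integral_cong) (auto simp: f_def)
      ultimately show ?thesis by simp
    qed
    have "((\<lambda>h. (integral {a..t + h} g - integral {a..t} g) / h) \<longlongrightarrow> g t) (at 0)"
      unfolding LIM_eq
    proof (intro allI impI)
      fix e :: real assume "e > 0"
      obtain d1 where d1: "d1 > 0" "\<forall>h. 0 < h \<and> h < d1 \<longrightarrow> norm (integral {t..t + h} f / h - f t) < e"
        using r[rule_format, of t e] tN \<open>e > 0\<close> by (auto simp: divide_inverse_commute)
      obtain d2 where d2: "d2 > 0" "\<forall>h. 0 < h \<and> h < d2 \<longrightarrow>
          norm (integral {- t..- t + h} (\<lambda>x. f (- x)) / h - f t) < e"
        using l[rule_format, of "- t" e] tN \<open>e > 0\<close> by (auto simp: divide_inverse_commute)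
      define d where "d = min (min d1 d2) (min (t - a) (b - t))"
      have ft: "f t = g t" using tab by (simp add: f_def)
      show "\<exists>s>0. \<forall>h. h \<noteq> 0 \<and> norm (h - 0) < s \<longrightarrow>
          norm ((integral {a..t + h} g - integral {a..t} g) / h - g t) < e"
      proof (intro exI[of _ d] conjI allI impI)
        show "d > 0" using d1(1) d2(1) tab by (simp add: d_def)
        fix h :: real assume h: "h \<noteq> 0 \<and> norm (h - 0) < d"
        show "norm ((integral {a..t + h} g - integral {a..t} g) / h - g t) < e"
        proof (cases "h > 0")
          case True
          then show ?thesis using d1(2) h sub[of t "t + h"] tab ft by (simp add: d_def)
        next
          case False
          define k where "k = - h"
          have k: "0 < k" "k < d" using False h by (auto simp: k_def)
          have "integral {- t..- t + k} (\<lambda>x. f (- x)) = integral {t - k..t} f"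
            using Henstock_Kurzweil_Integration.integral_reflect_real[where f=f and a="t - k" and b=t] by simp
          moreover have "integral {a..t} g - integral {a..t - k} g = integral {t - k..t} f"
            using k tab by (intro sub) (auto simp: d_def)
          ultimately have "integral {- t..- t + k} (\<lambda>x. f (- x)) / k =
              (integral {a..t + h} g - integral {a..t} g) / h"
            using k(1) by (simp add: k_def field_simps)
          then show ?thesis using d2(2)[rule_format, of k] k ft by (simp add: d_def)
        qed
      qed
    qed
    then have "((\<lambda>x. integral {a..x} g) has_real_derivative g t) (at t)" by (simp add: DERIV_def)
    with t show False by simp
  qed
  ultimately show ?thesis by (rule negligible_subset)
qed

text \<open>Let \<open>V\<close> be the variation of \<open>f\<close>. Then \<open>V\<close> and \<open>V - f\<close> are monotone and absolutely continuous,
  and \<open>f\<close> is their difference.\<close>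

lemma abs_continuous_real_integral:
  fixes f :: "real \<Rightarrow> real"
  assumes "a < b" and ac: "abs_continuous_curve dist a b f"
  shows "\<exists>g. g absolutely_integrable_on {a..b} \<and> has_density_on f g a b"
proof -
  have ac': "abs_continuous_curve (\<lambda>s t. dist (f s) (f t)) a b (\<lambda>t. t)"
    using ac by (simp only: abs_continuous_curve_def)
  obtain V where V: "\<And>s t. a \<le> s \<Longrightarrow> s \<le> t \<Longrightarrow> t \<le> b \<Longrightarrow> dist (f s) (f t) \<le> V t - V s"
    and acV: "abs_continuous_curve dist a b V"
    by (rule monotone_dominating[OF ac']) (use \<open>a < b\<close> in \<open>auto intro: dist_triangle\<close>)
  have mV: "V s \<le> V t" if "a \<le> s" "s \<le> t" "t \<le> b" for s t
    using V[OF that] zero_le_dist[of "f s" "f t"] by linarith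
  obtain g1 where g1: "\<forall>x. 0 \<le> g1 x" "has_density_on V g1 a b"
    using monotone_abs_continuous_integral[OF \<open>a < b\<close> mV acV] by blast
  define W where "W t = V t - f t" for t
  have mW: "W s \<le> W t" if "a \<le> s" "s \<le> t" "t \<le> b" for s t
    using V[OF that] by (simp add: W_def dist_real_def)
  have acW: "abs_continuous_curve dist a b W"
  proof (rule abs_continuous_curve_le[OF acV, of 2])
    fix s t assume st: "a \<le> s" "s \<le> t" "t \<le> b"
    have "\<bar>f s - f t\<bar> \<le> V t - V s" "V s \<le> V t" using V[OF st] mV[OF st] by (auto simp: dist_real_def)
    then show "dist (W s) (W t) \<le> 2 * dist (V s) (V t) + 2 * (t - s)"
      using st by (simp add: W_def dist_real_def)
  qed simp
  obtain g2 where g2: "\<forall>x. 0 \<le> g2 x" "has_density_on W g2 a b"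
    using monotone_abs_continuous_integral[OF \<open>a < b\<close> mW acW] by blast
  have int: "g1 integrable_on {a..b}" "g2 integrable_on {a..b}"
    using has_density_onD[OF g1(2), of a b] has_density_onD[OF g2(2), of a b] \<open>a < b\<close>
    by (auto simp: integrable_on_def)
  show ?thesis
  proof (intro exI[of _ "\<lambda>x. g1 x - g2 x"] conjI)
    show "(\<lambda>x. g1 x - g2 x) absolutely_integrable_on {a..b}"
      using int g1(1) g2(1) by (intro set_integral_diff nonnegative_absolutely_integrable_1) auto
    show "has_density_on f (\<lambda>x. g1 x - g2 x) a b"
      unfolding has_density_on_def
    proof (intro allI impI, elim conjE)
      fix s t assume st: "a \<le> s" "s \<le> t" "t \<le> b"
      show "((\<lambda>x. g1 x - g2 x) has_integral (f t - f s)) {s..t}"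
        using has_integral_diff[OF has_density_onD[OF g1(2) st] has_density_onD[OF g2(2) st]] by (simp add: W_def)
    qed
  qed
qed

lemma integral_representation_derivative:
  fixes f :: "real \<Rightarrow> real"
  assumes "a < b" and f: "has_density_on f g a b"
  shows "negligible {t\<in>{a..b}. \<not> (f has_real_derivative g t) (at t)}"
proof -
  have "g integrable_on {a..b}" using has_density_onD[OF f, of a b] \<open>a < b\<close> by auto
  then have "negligible ({t\<in>{a..b}. \<not> ((\<lambda>x. integral {a..x} g) has_real_derivative g t) (at t)} \<union> {a, b})"
    using lebesgue_differentiation by (simp add: negligible_Un_eq)
  moreover have "{t\<in>{a..b}. \<not> (f has_real_derivative g t) (at t)} \<subseteq>
      {t\<in>{a..b}. \<not> ((\<lambda>x. integral {a..x} g) has_real_derivative g t) (at t)} \<union> {a, b}"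
  proof (rule subsetI, rule ccontr)
    fix t assume t: "t \<in> {t\<in>{a..b}. \<not> (f has_real_derivative g t) (at t)}"
      and nt: "t \<notin> {t\<in>{a..b}. \<not> ((\<lambda>x. integral {a..x} g) has_real_derivative g t) (at t)} \<union> {a, b}"
    then have "((\<lambda>x. f a + integral {a..x} g) has_real_derivative g t) (at t)"
      by (auto intro!: derivative_eq_intros)
    then have "(f has_real_derivative g t) (at t)"
    proof (rule has_field_derivative_transform_within_open)
      show "open {a<..<b}" "t \<in> {a<..<b}" using t nt by auto
      show "f a + integral {a..x} g = f x" if "x \<in> {a<..<b}" for x
        using has_density_onD[OF f, of a x] that by (simp add: integral_unique)
    qed
    with t show False by simp
  qed
  ultimately show ?thesis by (rule negligible_subset)
qed

lemma abs_continuous_deriv_pos_mono: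
  fixes f :: "real \<Rightarrow> real"
  assumes "a < b" and ac: "abs_continuous_curve dist a b f"
    and pos: "negligible {t\<in>{a..b}. \<not> (\<exists>D>0. (f has_real_derivative D) (at t))}"
    and st: "a \<le> s" "s \<le> t" "t \<le> b"
  shows "f s \<le> f t"
proof -
  obtain g where g: "has_density_on f g a b"
    using abs_continuous_real_integral[OF assms(1,2)] by blast
  let ?N = "{t\<in>{a..b}. \<not> (f has_real_derivative g t) (at t)} \<union>
    {t\<in>{a..b}. \<not> (\<exists>D>0. (f has_real_derivative D) (at t))}"
  have N: "negligible ?N" using integral_representation_derivative[OF \<open>a < b\<close> g] pos by (simp add: negligible_Un_eq)
  have gpos: "0 < g x" if "x \<in> {s..t} - ?N" for x
  proof -
    have "x \<in> {a..b}" using that st by simp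
    then have "(f has_real_derivative g x) (at x)" "\<exists>D>0. (f has_real_derivative D) (at x)"
      using that by blast+
    then show ?thesis using DERIV_unique by metis
  qed
  have "max 0 (g x) = g x" if "x \<in> {s..t} - ?N" for x using gpos[OF that] by simp
  then have "((\<lambda>x. max 0 (g x)) has_integral (f t - f s)) {s..t}"
    by (rule has_integral_spike[OF N _ has_density_onD[OF g st]])
  then have "0 \<le> f t - f s" by (rule has_integral_nonneg) simp
  then show ?thesis by simp
qed

section \<open>Existence of the metric derivative\<close>

lemma deriv_abs_quotient:
  fixes f :: "real \<Rightarrow> real"
  assumes "(f has_real_derivative D) (at t)"
  shows "((\<lambda>u. \<bar>f u - f t\<bar> / \<bar>u - t\<bar>) \<longlongrightarrow> \<bar>D\<bar>) (at t)"
proof -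
  have "((\<lambda>u. \<bar>(f u - f t) / (u - t)\<bar>) \<longlongrightarrow> \<bar>D\<bar>) (at t)"
    using assms by (intro tendsto_rabs) (simp add: has_field_derivative_iff)
  then show ?thesis by (simp add: abs_divide)
qed

text \<open>Here \<open>D x y\<close> stands for the distance of the points of a curve at the parameters \<open>x\<close> and \<open>y\<close>.
  The functions \<open>D q\<close> with rational \<open>q\<close> are absolutely continuous with derivatives \<open>g q\<close>, and the
  metric speed is \<open>m = (SUP q. \<bar>g q\<bar>)\<close>. It is a lower bound for the difference quotients because
  each \<open>D q\<close> is Lipschitz with constant \<open>1\<close> for \<open>D\<close>; it is an upper bound because
  \<open>D s t\<close> is the supremum of the increments \<open>D q t - D q s\<close>, so that \<open>D s t \<le> integral {s..t} m\<close>.\<close>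

theorem metric_derivative_exists:
  fixes D :: "real \<Rightarrow> real \<Rightarrow> real"
  assumes "a < b" and ac: "abs_continuous_curve D a b (\<lambda>t. t)"
    and nonneg: "\<And>x y. x \<in> {a..b} \<Longrightarrow> y \<in> {a..b} \<Longrightarrow> 0 \<le> D x y"
    and refl: "\<And>x. x \<in> {a..b} \<Longrightarrow> D x x = 0"
    and sym: "\<And>x y. x \<in> {a..b} \<Longrightarrow> y \<in> {a..b} \<Longrightarrow> D x y = D y x"
    and tri: "\<And>x y z. x \<in> {a..b} \<Longrightarrow> y \<in> {a..b} \<Longrightarrow> z \<in> {a..b} \<Longrightarrow> D x z \<le> D x y + D y z"
  shows "\<exists>m. m absolutely_integrable_on {a..b} \<and>
    negligible {t\<in>{a..b}. \<not> ((\<lambda>u. D u t / \<bar>u - t\<bar>) \<longlongrightarrow> m t) (at t)}"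
proof -
  have lip: "\<bar>D q s - D q t\<bar> \<le> D s t" if "q \<in> {a..b}" "s \<in> {a..b}" "t \<in> {a..b}" for q s t
    using tri[OF that(1,2,3)] tri[OF that(1,3,2)] sym[OF that(2,3)] by linarith
  obtain V where V: "\<And>s t. a \<le> s \<Longrightarrow> s \<le> t \<Longrightarrow> t \<le> b \<Longrightarrow> D s t \<le> V t - V s"
    and acV: "abs_continuous_curve dist a b V"
    by (rule monotone_dominating[OF ac]) (use \<open>a < b\<close> nonneg refl tri in auto)
  have V': "D s t \<le> \<bar>V s - V t\<bar>" if "s \<in> {a..b}" "t \<in> {a..b}" for s t
    using V[of s t] V[of t s] sym[OF that] that by (cases "s \<le> t") auto
  obtain w where w: "w absolutely_integrable_on {a..b} \<and> has_density_on V w a b"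
    using abs_continuous_real_integral[OF \<open>a < b\<close> acV] by (rule exE)
  define Q where "Q = \<rat> \<inter> {a..b}"
  have Q: "countable Q" "Q \<subseteq> {a..b}" unfolding Q_def by (auto intro: countable_subset[OF _ countable_rat])
  have "Q \<noteq> {}" using Rats_dense_in_real[OF \<open>a < b\<close>] by (force simp: Q_def)
  have acq: "abs_continuous_curve dist a b (D q)" if "q \<in> Q" for q
  proof (rule abs_continuous_curve_le[OF ac, of 1])
    fix s t assume "a \<le> s" "s \<le> t" "t \<le> b"
    then show "dist (D q s) (D q t) \<le> 1 * D s t + 1 * (t - s)"
      using lip[of q s t] Q that by (auto simp: dist_real_def)
  qed simp
  have "\<forall>q\<in>Q. \<exists>g. g absolutely_integrable_on {a..b} \<and> has_density_on (D q) g a b"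
    using abs_continuous_real_integral[OF \<open>a < b\<close> acq] by blast
  then obtain g where g: "\<forall>q\<in>Q. g q absolutely_integrable_on {a..b} \<and> has_density_on (D q) (g q) a b"
    unfolding bchoice_iff by (rule exE)
  \<comment> \<open>Truncation by the speed \<open>w\<close> of the variation makes the supremum finite everywhere; almost
    everywhere it changes nothing, by \<open>g_le_w\<close>.\<close>
  define m where "m t = (SUP q\<in>Q. min \<bar>g q t\<bar> \<bar>w t\<bar>)" for t
  have bdd: "bdd_above ((\<lambda>q. min \<bar>g q t\<bar> \<bar>w t\<bar>) ` Q)" for t
    by (intro bdd_aboveI[of _ "\<bar>w t\<bar>"]) auto
  have m_upper: "min \<bar>g q t\<bar> \<bar>w t\<bar> \<le> m t" if "q \<in> Q" for q t
    unfolding m_def using that bdd by (intro cSUP_upper)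
  have m_le: "m t \<le> \<bar>w t\<bar>" for t
    unfolding m_def using \<open>Q \<noteq> {}\<close> by (intro cSUP_least) auto
  have m_nonneg: "0 \<le> m t" for t
  proof -
    obtain q where "q \<in> Q" using \<open>Q \<noteq> {}\<close> by blast
    then show ?thesis using m_upper[of q t] by linarith
  qed
  have w_int: "w integrable_on {a..b}" "(\<lambda>t. \<bar>w t\<bar>) integrable_on {a..b}"
    using w by (auto simp: absolutely_integrable_on_def)
  have m_abs: "m absolutely_integrable_on {a..b}"
  proof (rule measurable_bounded_by_integrable_imp_absolutely_integrable[OF _ _ w_int(2)])
    have [measurable]: "w \<in> borel_measurable (lebesgue_on {a..b})"
      using w_int by (intro integrable_imp_measurable)
    have [measurable]: "g q \<in> borel_measurable (lebesgue_on {a..b})" if "q \<in> Q" for q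
      using g that by (intro integrable_imp_measurable) (auto simp: absolutely_integrable_on_def)
    show "m \<in> borel_measurable (lebesgue_on {a..b})"
      unfolding m_def[abs_def] using Q(1) bdd by (intro borel_measurable_cSUP) simp_all
    show "norm (m t) \<le> \<bar>w t\<bar>" if "t \<in> {a..b}" for t using m_le[of t] m_nonneg[of t] by simp
  qed simp
  then have m_int: "m integrable_on {a..b}" by (simp add: absolutely_integrable_on_def)
  define N where "N = {t\<in>{a..b}. \<not> (V has_real_derivative w t) (at t)} \<union>
    (\<Union>q\<in>Q. {t\<in>{a..b}. \<not> (D q has_real_derivative g q t) (at t)}) \<union>
    {t\<in>{a..b}. \<not> ((\<lambda>x. integral {a..x} m) has_real_derivative m t) (at t)} \<union> {a, b}"
  have "negligible (\<Union>q\<in>Q. {t\<in>{a..b}. \<not> (D q has_real_derivative g q t) (at t)})"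
  proof (rule negligible_countable_Union)
    fix S assume "S \<in> (\<lambda>q. {t\<in>{a..b}. \<not> (D q has_real_derivative g q t) (at t)}) ` Q"
    then obtain q where q: "q \<in> Q" "S = {t\<in>{a..b}. \<not> (D q has_real_derivative g q t) (at t)}" by blast
    show "negligible S"
      unfolding q(2) by (rule integral_representation_derivative[OF \<open>a < b\<close>]) (use g q(1) in simp)
  qed (use Q(1) in simp)
  then have N: "negligible N"
    using integral_representation_derivative[OF \<open>a < b\<close>, of V w] w lebesgue_differentiation[OF m_int]
    unfolding N_def by (simp add: negligible_Un_eq)
  have near: "\<forall>\<^sub>F u in at t. u \<in> {a..b}" if "t \<in> {a..b} - N" for t
  proof -
    have "a < t" "t < b" using that by (auto simp: N_def)
    then show ?thesis by (rule eventually_at_in_Icc)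
  qed
  have g_le_w: "\<bar>g q t\<bar> \<le> \<bar>w t\<bar>" if "q \<in> Q" "t \<in> {a..b} - N" for q t
  proof (rule tendsto_le[OF trivial_limit_at])
    show "((\<lambda>u. \<bar>D q u - D q t\<bar> / \<bar>u - t\<bar>) \<longlongrightarrow> \<bar>g q t\<bar>) (at t)"
      "((\<lambda>u. \<bar>V u - V t\<bar> / \<bar>u - t\<bar>) \<longlongrightarrow> \<bar>w t\<bar>) (at t)"
      using that by (auto intro!: deriv_abs_quotient simp: N_def)
    show "\<forall>\<^sub>F u in at t. \<bar>D q u - D q t\<bar> / \<bar>u - t\<bar> \<le> \<bar>V u - V t\<bar> / \<bar>u - t\<bar>"
      using near[OF that(2)]
    proof eventually_elim
      case (elim u)
      then show ?case using lip[of q u t] V'[of u t] that Q(2)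
        by (intro divide_right_mono) auto
    qed
  qed
  have g_le_m: "\<bar>g q t\<bar> \<le> m t" if "q \<in> Q" "t \<in> {a..b} - N" for q t
    using g_le_w[OF that] m_upper[OF that(1), of t] by simp
  have D_le: "D s t \<le> integral {s..t} m" if st: "a \<le> s" "s \<le> t" "t \<le> b" for s t
  proof (cases "s = t")
    case True
    then show ?thesis using refl st by simp
  next
    case False
    then have "s < t" using st by simp
    have mst: "(m has_integral integral {s..t} m) {s..t}"
      using m_int st by (intro integrable_integral integrable_on_subinterval[OF m_int]) auto
    have Dq: "D q t - D q s \<le> integral {s..t} m" if "q \<in> Q" for q
    proof (rule has_integral_le[OF _ mst])
      show "((\<lambda>x. if x \<in> N then m x else g q x) has_integral (D q t - D q s)) {s..t}"
        using g that by (intro has_integral_spike[OF N _ has_density_onD[of "D q" "g q" a b s t]] st) auto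
      show "(if x \<in> N then m x else g q x) \<le> m x" if "x \<in> {s..t}" for x
        using g_le_m[OF \<open>q \<in> Q\<close>, of x] that st by auto
    qed
    have "D s t \<le> integral {s..t} m + e" if "e > 0" for e
    proof -
      have "e / 2 > 0" using that by simp
      then obtain \<delta> where "\<delta> > 0" and \<delta>: "\<forall>x y. a \<le> x \<and> x \<le> y \<and> y \<le> b \<and> y - x < \<delta> \<longrightarrow> D x y < e / 2"
        using abs_continuous_curve_uniform[OF ac] by blast
      obtain q where q: "q \<in> \<rat>" "s < q" "q < min t (s + \<delta>)"
        using Rats_dense_in_real[of s "min t (s + \<delta>)"] \<open>s < t\<close> \<open>\<delta> > 0\<close> by auto
      then have "q \<in> Q" using st by (auto simp: Q_def)
      moreover have "D s q < e / 2" using \<delta> q st by auto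
      ultimately show ?thesis using Dq[of q] tri[of s q t] sym[of s q] st q by auto
    qed
    then show ?thesis by (rule field_le_epsilon)
  qed
  have "((\<lambda>u. D u t / \<bar>u - t\<bar>) \<longlongrightarrow> m t) (at t)" if t: "t \<in> {a..b} - N" for t
  proof (rule order_tendstoI)
    fix y assume "y < m t"
    then obtain q where "q \<in> Q" "y < min \<bar>g q t\<bar> \<bar>w t\<bar>"
      unfolding m_def using less_cSUP_iff[OF \<open>Q \<noteq> {}\<close> bdd] by auto
    then have "y < \<bar>g q t\<bar>" by simp
    moreover have "((\<lambda>u. \<bar>D q u - D q t\<bar> / \<bar>u - t\<bar>) \<longlongrightarrow> \<bar>g q t\<bar>) (at t)"
      using t \<open>q \<in> Q\<close> by (auto intro!: deriv_abs_quotient simp: N_def)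
    ultimately have "\<forall>\<^sub>F u in at t. y < \<bar>D q u - D q t\<bar> / \<bar>u - t\<bar>" by (simp add: order_tendsto_iff)
    then show "\<forall>\<^sub>F u in at t. y < D u t / \<bar>u - t\<bar>"
      using near[OF t]
    proof eventually_elim
      case (elim u)
      have "\<bar>D q u - D q t\<bar> / \<bar>u - t\<bar> \<le> D u t / \<bar>u - t\<bar>"
        using lip[of q u t] elim t \<open>q \<in> Q\<close> Q(2) by (intro divide_right_mono) auto
      then show ?case using elim by simp
    qed
  next
    fix y assume "m t < y"
    moreover have "((\<lambda>u. \<bar>integral {a..u} m - integral {a..t} m\<bar> / \<bar>u - t\<bar>) \<longlongrightarrow> \<bar>m t\<bar>) (at t)"
      using t by (auto intro!: deriv_abs_quotient simp: N_def)
    ultimately have "\<forall>\<^sub>F u in at t. \<bar>integral {a..u} m - integral {a..t} m\<bar> / \<bar>u - t\<bar> < y"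
      using m_nonneg[of t] by (simp add: order_tendsto_iff)
    then show "\<forall>\<^sub>F u in at t. D u t / \<bar>u - t\<bar> < y"
      using near[OF t]
    proof eventually_elim
      case (elim u)
      have "D u t \<le> \<bar>integral {a..u} m - integral {a..t} m\<bar>"
        using D_le[of u t] D_le[of t u] integral_subinterval_diff[OF m_int, of u t]
          integral_subinterval_diff[OF m_int, of t u] sym[of u t] elim t
        by (cases "u \<le> t") auto
      then have "D u t / \<bar>u - t\<bar> \<le> \<bar>integral {a..u} m - integral {a..t} m\<bar> / \<bar>u - t\<bar>"
        by (intro divide_right_mono) auto
      then show ?case using elim by simp
    qed
  qed
  then have "{t\<in>{a..b}. \<not> ((\<lambda>u. D u t / \<bar>u - t\<bar>) \<longlongrightarrow> m t) (at t)} \<subseteq> N" by blast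
  with m_abs N show ?thesis by (intro exI[of _ m] conjI) (auto intro: negligible_subset)
qed

section \<open>The generalized metric speed as a limit\<close>

lemma approximable_imp_common_limit:
  fixes f g :: "'b \<Rightarrow> real"
  assumes F: "F \<noteq> bot" and ap: "\<And>\<epsilon>. \<epsilon> > 0 \<Longrightarrow> \<exists>m. \<forall>\<^sub>F x in F. \<bar>f x - m\<bar> < \<epsilon> \<and> \<bar>g x - m\<bar> < \<epsilon>"
  shows "\<exists>v. (f \<longlongrightarrow> v) F \<and> (g \<longlongrightarrow> v) F"
proof -
  have "\<forall>n::nat. \<exists>m. \<forall>\<^sub>F x in F. \<bar>f x - m\<bar> < inverse (Suc n) \<and> \<bar>g x - m\<bar> < inverse (Suc n)"
    using ap by simp
  then obtain m where m: "\<And>n::nat. \<forall>\<^sub>F x in F. \<bar>f x - m n\<bar> < inverse (Suc n) \<and> \<bar>g x - m n\<bar> < inverse (Suc n)"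
    by metis
  have close: "\<bar>m i - m j\<bar> < inverse (Suc i) + inverse (Suc j)" for i j
  proof -
    have "\<forall>\<^sub>F x in F. \<bar>f x - m i\<bar> < inverse (Suc i) \<and> \<bar>f x - m j\<bar> < inverse (Suc j)"
      using m[of i] m[of j] by eventually_elim auto
    then obtain x where "\<bar>f x - m i\<bar> < inverse (Suc i)" "\<bar>f x - m j\<bar> < inverse (Suc j)"
      using eventually_happens[of _ F] F by auto
    then show ?thesis by linarith
  qed
  have inv0: "(\<lambda>n. inverse (real (Suc n))) \<longlonglongrightarrow> 0" by (rule LIMSEQ_inverse_real_of_nat)
  have "Cauchy m"
    unfolding Cauchy_def
  proof (intro allI impI)
    fix e :: real assume "e > 0"
    then obtain M where M: "inverse (real (Suc M)) < e / 2"
      using reals_Archimedean[of "e/2"] by auto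
    have "dist (m i) (m j) < e" if "i \<ge> M" "j \<ge> M" for i j
    proof -
      have "inverse (real (Suc i)) \<le> inverse (real (Suc M))" "inverse (real (Suc j)) \<le> inverse (real (Suc M))"
        using that by (auto intro!: le_imp_inverse_le)
      then show ?thesis using close[of i j] M unfolding dist_real_def by linarith
    qed
    then show "\<exists>M. \<forall>i\<ge>M. \<forall>j\<ge>M. dist (m i) (m j) < e" by blast
  qed
  then obtain v where v: "m \<longlonglongrightarrow> v" using Cauchy_convergent_iff convergent_def by blast
  have lim: "(k \<longlongrightarrow> v) F" if k: "\<And>n. \<forall>\<^sub>F x in F. \<bar>k x - m n\<bar> < inverse (Suc n)" for k :: "'b \<Rightarrow> real"
  proof (rule tendstoI)
    fix e :: real assume "e > 0"
    then have "\<forall>\<^sub>F n in sequentially. dist (m n) v < e / 2 \<and> inverse (real (Suc n)) < e / 2"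
      using tendstoD[OF v, of "e/2"] order_tendstoD(2)[OF inv0, of "e/2"] by (intro eventually_conj) auto
    then obtain n where n: "dist (m n) v < e / 2" "inverse (real (Suc n)) < e / 2"
      using eventually_happens[of _ sequentially] by auto
    show "\<forall>\<^sub>F x in F. dist (k x) v < e"
      using k[of n]
    proof eventually_elim
      case (elim x)
      then show ?case using n unfolding dist_real_def by linarith
    qed
  qed
  have "\<forall>\<^sub>F x in F. \<bar>f x - m n\<bar> < inverse (Suc n)" "\<forall>\<^sub>F x in F. \<bar>g x - m n\<bar> < inverse (Suc n)" for n
    using m[of n] by (auto elim: eventually_mono)
  then show ?thesis using lim by blast
qed

text \<open>Log-Lipschitz dependence on the parameter makes the values at \<open>s\<close> and at a nearby \<open>q \<in> Q\<close>
  uniformly close, so the limits at \<open>q\<close> approximate both \<open>f s\<close> and \<open>g s\<close>. The point is that \<open>Q\<close> may be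
  countable while \<open>s\<close> is arbitrary: exceptional null sets need to be collected only over \<open>Q\<close>.\<close>

lemma common_limit:
  fixes f g :: "real \<Rightarrow> 'b \<Rightarrow> real"
  assumes F: "F \<noteq> bot" and C: "C \<ge> 0" and s: "s \<in> J"
    and dense: "\<And>\<tau>. \<tau> > 0 \<Longrightarrow> \<exists>q\<in>Q. \<bar>s - q\<bar> < \<tau>" and QJ: "Q \<subseteq> J"
    and f: "\<And>s s'. s \<in> J \<Longrightarrow> s' \<in> J \<Longrightarrow> \<forall>\<^sub>F x in F. 0 \<le> f s x \<and> f s x \<le> exp (C * \<bar>s - s'\<bar>) * f s' x"
    and g: "\<And>s s'. s \<in> J \<Longrightarrow> s' \<in> J \<Longrightarrow> \<forall>\<^sub>F x in F. 0 \<le> g s x \<and> g s x \<le> exp (C * \<bar>s - s'\<bar>) * g s' x"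
    and lim: "\<And>q. q \<in> Q \<Longrightarrow> \<exists>m. (f q \<longlongrightarrow> m) F \<and> (g q \<longlongrightarrow> m) F"
  shows "\<exists>v. (f s \<longlongrightarrow> v) F \<and> (g s \<longlongrightarrow> v) F"
proof (rule approximable_imp_common_limit[OF F])
  fix \<epsilon> :: real assume "\<epsilon> > 0"
  obtain q0 where q0: "q0 \<in> Q" using dense[of 1] by auto
  obtain m0 where m0: "(f q0 \<longlongrightarrow> m0) F" "(g q0 \<longlongrightarrow> m0) F" using lim[OF q0] by blast
  define E where "E \<tau> = exp (C * \<tau>)" for \<tau>
  define M where "M = E \<bar>s - q0\<bar> * (\<bar>m0\<bar> + 1)"
  have "M > 0" by (simp add: M_def E_def add_nonneg_pos)
  have bound: "\<forall>\<^sub>F x in F. k s x \<le> M"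
    if k: "\<And>s s'. s \<in> J \<Longrightarrow> s' \<in> J \<Longrightarrow> \<forall>\<^sub>F x in F. 0 \<le> k s x \<and> k s x \<le> exp (C * \<bar>s - s'\<bar>) * k s' x"
      and l: "(k q0 \<longlongrightarrow> m0) F" for k
  proof -
    have "\<forall>\<^sub>F x in F. k q0 x < \<bar>m0\<bar> + 1" using l by (intro order_tendstoD) auto
    moreover have "\<forall>\<^sub>F x in F. 0 \<le> k s x \<and> k s x \<le> exp (C * \<bar>s - q0\<bar>) * k q0 x" using s q0 QJ by (intro k) auto
    ultimately show ?thesis
    proof eventually_elim
      case (elim x)
      have "exp (C * \<bar>s - q0\<bar>) * k q0 x \<le> M" unfolding M_def E_def using elim by (intro mult_left_mono) auto
      then show ?case using elim by simp
    qed
  qed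
  have "((\<lambda>\<tau>. (E \<tau> - 1) * (E \<tau> * M)) \<longlongrightarrow> (E 0 - 1) * (E 0 * M)) (at_right 0)"
    unfolding E_def by (intro tendsto_intros)
  then have "((\<lambda>\<tau>. (E \<tau> - 1) * (E \<tau> * M)) \<longlongrightarrow> 0) (at_right 0)" by (simp add: E_def)
  then have "\<forall>\<^sub>F \<tau> in at_right 0. (E \<tau> - 1) * (E \<tau> * M) < \<epsilon> / 2"
    using \<open>\<epsilon> > 0\<close> by (intro order_tendstoD) auto
  then obtain \<tau> where \<tau>: "\<tau> > 0" "(E \<tau> - 1) * (E \<tau> * M) < \<epsilon> / 2"
    using eventually_happens[of _ "at_right (0::real)"] eventually_conj[OF _ eventually_at_right_less[of 0]]
    by (metis (mono_tags, lifting) trivial_limit_at_right_real)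
  obtain q where q: "q \<in> Q" "\<bar>s - q\<bar> < \<tau>" using dense[OF \<tau>(1)] by blast
  obtain m where m: "(f q \<longlongrightarrow> m) F" "(g q \<longlongrightarrow> m) F" using lim[OF q(1)] by blast
  have near: "\<forall>\<^sub>F x in F. \<bar>k s x - m\<bar> < \<epsilon>"
    if k: "\<And>s s'. s \<in> J \<Longrightarrow> s' \<in> J \<Longrightarrow> \<forall>\<^sub>F x in F. 0 \<le> k s x \<and> k s x \<le> exp (C * \<bar>s - s'\<bar>) * k s' x"
      and l: "(k q0 \<longlongrightarrow> m0) F" and lq: "(k q \<longlongrightarrow> m) F" for k
  proof -
    have "\<forall>\<^sub>F x in F. dist (k q x) m < \<epsilon> / 2" using tendstoD[OF lq, of "\<epsilon>/2"] \<open>\<epsilon> > 0\<close> by simp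
    moreover have "\<forall>\<^sub>F x in F. 0 \<le> k s x \<and> k s x \<le> exp (C * \<bar>s - q\<bar>) * k q x" using s q QJ by (intro k) auto
    moreover have "\<forall>\<^sub>F x in F. 0 \<le> k q x \<and> k q x \<le> exp (C * \<bar>q - s\<bar>) * k s x" using s q QJ by (intro k) auto
    moreover have "\<forall>\<^sub>F x in F. k s x \<le> M" using k l by (rule bound)
    ultimately show ?thesis
    proof eventually_elim
      case (elim x)
      define e where "e = E \<bar>s - q\<bar>"
      have e: "1 \<le> e" "e \<le> E \<tau>" using C q(2) by (auto simp: e_def E_def intro: mult_left_mono)
      have 1: "k s x \<le> e * k q x" "k q x \<le> e * k s x" "0 \<le> k s x" "0 \<le> k q x" "k s x \<le> M"
        using elim by (auto simp: e_def E_def abs_minus_commute)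
      have "e * k s x \<le> E \<tau> * M" using 1 e by (intro mult_mono) auto
      then have 2: "k q x \<le> E \<tau> * M" using 1 by simp
      have "1 * M \<le> E \<tau> * M" using e \<open>M > 0\<close> by (intro mult_right_mono) auto
      then have 3: "k s x \<le> E \<tau> * M" using 1 by simp
      have "(e - 1) * k q x \<le> (E \<tau> - 1) * (E \<tau> * M)" using e 1 2 by (intro mult_mono) auto
      moreover have "(e - 1) * k s x \<le> (E \<tau> - 1) * (E \<tau> * M)" using e 1 3 by (intro mult_mono) auto
      moreover have "k s x - k q x \<le> (e - 1) * k q x" "k q x - k s x \<le> (e - 1) * k s x"
        using 1 by (simp_all add: algebra_simps)
      ultimately have "\<bar>k s x - k q x\<bar> < \<epsilon> / 2" using \<tau>(2) by linarith
      then show ?case using elim(1) unfolding dist_real_def by linarith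
    qed
  qed
  have "\<forall>\<^sub>F x in F. \<bar>f s x - m\<bar> < \<epsilon>" using f m0(1) m(1) by (rule near)
  moreover have "\<forall>\<^sub>F x in F. \<bar>g s x - m\<bar> < \<epsilon>" using g m0(2) m(2) by (rule near)
  ultimately show "\<exists>m. \<forall>\<^sub>F x in F. \<bar>f s x - m\<bar> < \<epsilon> \<and> \<bar>g s x - m\<bar> < \<epsilon>"
    by (intro exI[of _ m] eventually_conj)
qed

text \<open>At an interior point where the limit exists, the default value in the definition of
  \<^const>\<open>metric_speed\<close> does not occur.\<close>

lemma metric_speed_almost_everywhere:
  assumes "a < b" and M: "Metric_space M \<rho>" "\<beta> ` {a..b} \<subseteq> M" and ac: "abs_continuous_curve \<rho> a b \<beta>"
  shows "metric_speed \<rho> a b \<beta> absolutely_integrable_on {a..b}"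
    and "negligible {t\<in>{a..b}. \<not> ((\<lambda>u. \<rho> (\<beta> u) (\<beta> t) / \<bar>u - t\<bar>) \<longlongrightarrow> metric_speed \<rho> a b \<beta> t) (at t)}"
proof -
  interpret Metric_space M \<rho> by fact
  have ac': "abs_continuous_curve (\<lambda>s t. \<rho> (\<beta> s) (\<beta> t)) a b (\<lambda>t. t)"
    using ac by (simp only: abs_continuous_curve_def)
  have "\<exists>m. m absolutely_integrable_on {a..b} \<and>
    negligible {t\<in>{a..b}. \<not> ((\<lambda>u. \<rho> (\<beta> u) (\<beta> t) / \<bar>u - t\<bar>) \<longlongrightarrow> m t) (at t)}"
    using M(2) by (intro metric_derivative_exists[OF \<open>a < b\<close> ac']) (auto simp: image_subset_iff commute intro!: triangle)
  then obtain m where m: "m absolutely_integrable_on {a..b}"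
    and N: "negligible {t\<in>{a..b}. \<not> ((\<lambda>u. \<rho> (\<beta> u) (\<beta> t) / \<bar>u - t\<bar>) \<longlongrightarrow> m t) (at t)}"
    by blast
  let ?N = "{t\<in>{a..b}. \<not> ((\<lambda>u. \<rho> (\<beta> u) (\<beta> t) / \<bar>u - t\<bar>) \<longlongrightarrow> m t) (at t)} \<union> {a, b}"
  have N': "negligible ?N" using N by (simp add: negligible_Un_eq)
  have eq: "metric_speed \<rho> a b \<beta> t = m t" if "t \<in> {a..b} - ?N" for t
  proof -
    have "at t within {a..b} = at t" using that by (intro at_within_Icc_at) auto
    then show ?thesis using that unfolding metric_speed_def by (intro tendsto_Lim) auto
  qed
  show "metric_speed \<rho> a b \<beta> absolutely_integrable_on {a..b}"
    using m N' by (rule absolutely_integrable_spike) (use eq in blast)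
  have "{t\<in>{a..b}. \<not> ((\<lambda>u. \<rho> (\<beta> u) (\<beta> t) / \<bar>u - t\<bar>) \<longlongrightarrow> metric_speed \<rho> a b \<beta> t) (at t)} \<subseteq> ?N"
  proof (rule subsetI, rule ccontr)
    fix t assume t: "t \<in> {t\<in>{a..b}. \<not> ((\<lambda>u. \<rho> (\<beta> u) (\<beta> t) / \<bar>u - t\<bar>) \<longlongrightarrow> metric_speed \<rho> a b \<beta> t) (at t)}"
      and "t \<notin> ?N"
    then have "metric_speed \<rho> a b \<beta> t = m t" by (intro eq) simp
    with t \<open>t \<notin> ?N\<close> show False by simp
  qed
  with N' show "negligible {t\<in>{a..b}. \<not> ((\<lambda>u. \<rho> (\<beta> u) (\<beta> t) / \<bar>u - t\<bar>) \<longlongrightarrow> metric_speed \<rho> a b \<beta> t) (at t)}"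
    by (rule negligible_subset)
qed

lemma gen_metric_speed_eq:
  assumes ms: "metric_speed (d s) a b \<beta> absolutely_integrable_on {a..b}" and t: "a < t" "t < b"
    and lim: "((\<lambda>\<delta>. (integral {a..t + \<delta>} (metric_speed (d s) a b \<beta>) - integral {a..t} (metric_speed (d s) a b \<beta>)) / \<delta>) \<longlongrightarrow> v) (at 0)"
  shows "gen_metric_speed d a b \<beta> s t = ereal v"
proof -
  let ?m = "metric_speed (d s) a b \<beta>"
  have mi: "?m integrable_on {a..b}" using ms by (simp add: absolutely_integrable_on_def)
  note comb = integral_subinterval_diff[OF mi]
  have li: "(LINT u:{x<..<y}|lebesgue. ?m u) = integral {x..y} ?m" if "a \<le> x" "x \<le> y" "y \<le> b" for x y
  proof -
    have "?m absolutely_integrable_on {x<..<y}"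
      using that by (intro set_integrable_subset[OF ms]) auto
    then show ?thesis by (simp add: set_lebesgue_integral_eq_integral integral_open_interval_real)
  qed
  have "\<forall>\<^sub>F \<delta> in at 0. \<bar>\<delta>\<bar> < min (t - a) (b - t)"
    unfolding eventually_at using t by (intro exI[of _ "min (t - a) (b - t)"]) (auto simp: dist_real_def)
  then have "\<forall>\<^sub>F \<delta> in at 0. ereal (1 / \<delta> * (LINT u=ereal t..ereal (t + \<delta>)|lebesgue. ?m u)) =
      ereal ((integral {a..t + \<delta>} ?m - integral {a..t} ?m) / \<delta>)"
  proof eventually_elim
    case (elim \<delta>)
    show ?case
    proof (cases "\<delta> \<ge> 0")
      case True
      then have "(LINT u=ereal t..ereal (t + \<delta>)|lebesgue. ?m u) = integral {t..t + \<delta>} ?m"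
        using li[of t "t + \<delta>"] elim t by (simp add: interval_lebesgue_integral_def)
      then show ?thesis using comb[of t "t + \<delta>"] elim t True by simp
    next
      case False
      then have "(LINT u=ereal t..ereal (t + \<delta>)|lebesgue. ?m u) = - integral {t + \<delta>..t} ?m"
        using li[of "t + \<delta>" t] elim t by (simp add: interval_lebesgue_integral_def)
      also have "\<dots> = integral {a..t + \<delta>} ?m - integral {a..t} ?m"
        using comb[of "t + \<delta>" t] elim t False by simp
      finally show ?thesis by simp
    qed
  qed
  then have "gen_metric_speed d a b \<beta> s t =
      Limsup (at 0) (\<lambda>\<delta>. ereal ((integral {a..t + \<delta>} ?m - integral {a..t} ?m) / \<delta>))"
    unfolding gen_metric_speed_def by (rule Limsup_eq)
  also have "\<dots> = ereal v"
    using lim by (intro lim_imp_Limsup) simp_all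
  finally show ?thesis .
qed

lemma integral_mono_almost_everywhere:
  fixes f g :: "real \<Rightarrow> real"
  assumes "f integrable_on S" "g integrable_on S" "negligible N" "\<And>x. x \<in> S - N \<Longrightarrow> f x \<le> g x"
  shows "integral S f \<le> integral S g"
proof -
  let ?h = "\<lambda>x. if x \<in> N then g x else f x"
  have "?h integrable_on S" using assms(1,3) by (rule integrable_spike) simp
  moreover have "integral S ?h = integral S f" using assms(3) by (rule integral_spike[symmetric]) simp
  moreover have "integral S ?h \<le> integral S g"
    using \<open>?h integrable_on S\<close> assms(2,4) by (intro integral_le) auto
  ultimately show ?thesis by simp
qed

text \<open>This is the form in which the log-Lipschitz condition is used: multiplied out, so that
  coinciding points need no exception, and with closeness measured in the parameter of the curve
  instead of in the metrics.\<close>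

definition comparable_with ::
  "real \<Rightarrow> real \<Rightarrow> real set \<Rightarrow> (real \<Rightarrow> 'a \<Rightarrow> 'a \<Rightarrow> real) \<Rightarrow> real \<Rightarrow> real \<Rightarrow> (real \<Rightarrow> 'a) \<Rightarrow> bool" where
  "comparable_with C \<rho> J d a b \<beta> \<longleftrightarrow>
     (\<forall>s\<in>J. \<forall>s'\<in>J. \<forall>u\<in>{a..b}. \<forall>v\<in>{a..b}. \<bar>u - v\<bar> < \<rho> \<longrightarrow>
        d s (\<beta> u) (\<beta> v) \<le> exp (C * \<bar>s - s'\<bar>) * d s' (\<beta> u) (\<beta> v))"

lemma comparable_withD:
  "comparable_with C \<rho> J d a b \<beta> \<Longrightarrow> s \<in> J \<Longrightarrow> s' \<in> J \<Longrightarrow> u \<in> {a..b} \<Longrightarrow> v \<in> {a..b} \<Longrightarrow> \<bar>u - v\<bar> < \<rho> \<Longrightarrow>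
     d s (\<beta> u) (\<beta> v) \<le> exp (C * \<bar>s - s'\<bar>) * d s' (\<beta> u) (\<beta> v)"
  unfolding comparable_with_def by blast

definition comparable_along ::
  "real set \<Rightarrow> (real \<Rightarrow> 'a \<Rightarrow> 'a \<Rightarrow> real) \<Rightarrow> real \<Rightarrow> real \<Rightarrow> (real \<Rightarrow> 'a) \<Rightarrow> bool" where
  "comparable_along J d a b \<beta> \<longleftrightarrow>
     (\<exists>C\<ge>0. \<exists>\<rho>>0. comparable_with C \<rho> J d a b \<beta>)"

definition has_speed :: "(real \<Rightarrow> 'a \<Rightarrow> 'a \<Rightarrow> real) \<Rightarrow> (real \<Rightarrow> 'a) \<Rightarrow> real \<Rightarrow> real \<Rightarrow> real \<Rightarrow> bool" where
  "has_speed d \<beta> s t v \<longleftrightarrow> ((\<lambda>u. d s (\<beta> u) (\<beta> t) / \<bar>u - t\<bar>) \<longlongrightarrow> v) (at t)"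

lemma has_speed_le:
  assumes Cmp: "comparable_with C \<rho> J d a b \<beta>" and "\<rho> > 0"
    and s: "s \<in> J" "s' \<in> J" and t: "a < t" "t < b"
    and v: "has_speed d \<beta> s t v" "has_speed d \<beta> s' t v'"
  shows "v \<le> exp (C * \<bar>s - s'\<bar>) * v'"
proof (rule tendsto_le[OF trivial_limit_at])
  show "((\<lambda>u. d s (\<beta> u) (\<beta> t) / \<bar>u - t\<bar>) \<longlongrightarrow> v) (at t)" using v(1) by (simp add: has_speed_def)
  show "((\<lambda>u. exp (C * \<bar>s - s'\<bar>) * (d s' (\<beta> u) (\<beta> t) / \<bar>u - t\<bar>)) \<longlongrightarrow> exp (C * \<bar>s - s'\<bar>) * v') (at t)"
    using v(2) by (intro tendsto_mult_left) (simp add: has_speed_def)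
  have "\<forall>\<^sub>F u in at t. \<bar>u - t\<bar> < min \<rho> (min (t - a) (b - t))"
    unfolding eventually_at using \<open>\<rho> > 0\<close> t
    by (intro exI[of _ "min \<rho> (min (t - a) (b - t))"]) (auto simp: dist_real_def)
  then show "\<forall>\<^sub>F u in at t. d s (\<beta> u) (\<beta> t) / \<bar>u - t\<bar> \<le> exp (C * \<bar>s - s'\<bar>) * (d s' (\<beta> u) (\<beta> t) / \<bar>u - t\<bar>)"
  proof eventually_elim
    case (elim u)
    have "d s (\<beta> u) (\<beta> t) \<le> exp (C * \<bar>s - s'\<bar>) * d s' (\<beta> u) (\<beta> t)"
      by (rule comparable_withD[OF Cmp]) (use s t elim in auto)
    then show ?case by (simp add: divide_right_mono)
  qed
qed

text \<open>For a single \<open>s\<close> this is Lebesgue differentiation of the metric speed. Doing it for the rational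
  \<open>s\<close> in \<open>I\<close> costs one null set \<open>N\<close>. Outside \<open>N\<close> the remaining \<open>s\<close> are reached by \<open>common_limit\<close>, which
  is applied to the difference quotients \<open>f\<close> of the distance and to the averages \<open>A\<close> of the metric
  speed. The uniformity in \<open>s\<close> is indispensable since in the definition of timelike curves
  \<open>s = \<alpha> t\<close> varies with \<open>t\<close>.\<close>

theorem gen_metric_speed_is_limit:
  assumes "a < b" and I: "open I"
    and M: "\<And>s. s \<in> I \<Longrightarrow> Metric_space M (d s)" and \<beta>: "\<beta> ` {a..b} \<subseteq> M"
    and ac: "\<And>s. s \<in> I \<Longrightarrow> abs_continuous_curve (d s) a b \<beta>"
    and cmp: "\<And>J. compact J \<Longrightarrow> J \<subseteq> I \<Longrightarrow> comparable_along J d a b \<beta>"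
  shows "negligible {t\<in>{a..b}. \<not> (\<forall>s\<in>I. \<exists>v. has_speed d \<beta> s t v \<and> gen_metric_speed d a b \<beta> s t = ereal v)}"
proof -
  let ?m = "\<lambda>s. metric_speed (d s) a b \<beta>"
  define F where "F s x = integral {a..x} (?m s)" for s x
  define B where "B s = {t\<in>{a..b}. \<not> ((\<lambda>u. d s (\<beta> u) (\<beta> t) / \<bar>u - t\<bar>) \<longlongrightarrow> ?m s t) (at t)} \<union> {a, b}" for s
  define L where "L s = {t\<in>{a..b}. \<not> (F s has_real_derivative ?m s t) (at t)}" for s
  have abs_int: "?m s absolutely_integrable_on {a..b}" if "s \<in> I" for s
    using metric_speed_almost_everywhere(1)[OF \<open>a < b\<close> M \<beta> ac, OF that that] .
  then have int: "?m s integrable_on {a..b}" if "s \<in> I" for s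
    using that by (simp add: absolutely_integrable_on_def)
  have B: "negligible (B s)" if "s \<in> I" for s
    using metric_speed_almost_everywhere(2)[OF \<open>a < b\<close> M \<beta> ac, OF that that]
    by (simp add: B_def negligible_Un_eq)
  have L: "negligible (L s)" if "s \<in> I" for s
    using lebesgue_differentiation[OF int[OF that]] by (simp add: L_def F_def[abs_def])
  define Q where "Q = \<rat> \<inter> I"
  define N where "N = (\<Union>q\<in>Q. B q \<union> L q) \<union> {a, b}"
  have "countable Q" unfolding Q_def by (rule countable_subset[OF _ countable_rat]) simp
  have "negligible (\<Union>q\<in>Q. B q \<union> L q)"
  proof (rule negligible_countable_Union)
    fix S assume "S \<in> (\<lambda>q. B q \<union> L q) ` Q"
    then show "negligible S" using B L by (auto simp: Q_def)
  qed (use \<open>countable Q\<close> in simp)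
  then have N: "negligible N" by (simp add: N_def)
  have lim: "((\<lambda>u. d s (\<beta> u) (\<beta> t) / \<bar>u - t\<bar>) \<longlongrightarrow> ?m s t) (at t)" if "t \<in> {a..b} - B s" for s t
    using that by (simp add: B_def)
  have dnn: "0 \<le> d s x y" if "s \<in> I" for s x y using Metric_space.nonneg[OF M[OF that]] .
  have m_nonneg: "0 \<le> ?m s t" if "s \<in> I" "t \<in> {a..b} - B s" for s t
    using lim[OF that(2)] dnn[OF that(1)] by (intro tendsto_lowerbound[OF lim[OF that(2)]]) auto
  have main: "\<exists>v. has_speed d \<beta> s t v \<and> gen_metric_speed d a b \<beta> s t = ereal v"
    if t: "t \<in> {a..b} - N" and s: "s \<in> I" for s t
  proof -
    have tab: "a < t" "t < b" using t by (auto simp: N_def)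
    obtain \<tau>0 where \<tau>0: "\<tau>0 > 0" "cball s \<tau>0 \<subseteq> I" using I s open_contains_cball by blast
    define J where "J = cball s \<tau>0"
    have J: "compact J" "J \<subseteq> I" "s \<in> J" using \<tau>0 by (auto simp: J_def)
    obtain C \<rho> where C: "C \<ge> 0" and \<rho>: "\<rho> > 0" and Cmp:
      "comparable_with C \<rho> J d a b \<beta>"
      using cmp[OF J(1,2)] unfolding comparable_along_def by blast
    have m_le: "?m s u \<le> exp (C * \<bar>s - s'\<bar>) * ?m s' u"
      if ss: "s \<in> J" "s' \<in> J" and u: "u \<in> {a..b} - (B s \<union> B s')" for s s' u
    proof (rule has_speed_le[where d=d and \<beta>=\<beta>, OF Cmp \<rho> ss])
      show "a < u" "u < b" using u by (auto simp: B_def)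
      show "has_speed d \<beta> s u (?m s u)" "has_speed d \<beta> s' u (?m s' u)"
        unfolding has_speed_def using u by (auto intro!: lim)
    qed
    have comb: "F s y - F s x = integral {x..y} (?m s)" if "s \<in> I" "a \<le> x" "x \<le> y" "y \<le> b" for s x y
      unfolding F_def using int[OF that(1)] that(2-4) by (rule integral_subinterval_diff)
    have F_le: "0 \<le> F s y - F s x" "F s y - F s x \<le> exp (C * \<bar>s - s'\<bar>) * (F s' y - F s' x)"
      if ss: "s \<in> J" "s' \<in> J" and xy: "a \<le> x" "x \<le> y" "y \<le> b" for s s' x y
    proof -
      have sI: "s \<in> I" "s' \<in> I" using ss J by auto
      have i: "?m s integrable_on {x..y}" "?m s' integrable_on {x..y}"
        using xy sI by (auto intro!: integrable_on_subinterval[OF int])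
      have N: "negligible (B s \<union> B s')" using B sI by auto
      have "integral {x..y} (\<lambda>_. 0) \<le> integral {x..y} (?m s)"
        using m_nonneg sI xy by (intro integral_mono_almost_everywhere[OF _ i(1) N]) auto
      then show "0 \<le> F s y - F s x" using comb[OF sI(1) xy] by simp
      have "integral {x..y} (?m s) \<le> integral {x..y} (\<lambda>u. exp (C * \<bar>s - s'\<bar>) * ?m s' u)"
        using m_le[OF ss] xy i by (intro integral_mono_almost_everywhere[OF i(1) _ N] integrable_on_cmult_left) auto
      then show "F s y - F s x \<le> exp (C * \<bar>s - s'\<bar>) * (F s' y - F s' x)"
        using comb[OF sI(1) xy] comb[OF sI(2) xy] by simp
    qed
    define f where "f s \<delta> = d s (\<beta> (t + \<delta>)) (\<beta> t) / \<bar>\<delta>\<bar>" for s \<delta>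
    define A where "A s \<delta> = (F s (t + \<delta>) - F s t) / \<delta>" for s \<delta>
    have small: "\<forall>\<^sub>F \<delta> in at 0. \<bar>\<delta>\<bar> < min \<rho> (min (t - a) (b - t)) \<and> \<delta> \<noteq> 0"
      unfolding eventually_at using tab \<rho>
      by (intro exI[of _ "min \<rho> (min (t - a) (b - t))"]) (auto simp: dist_real_def)
    have "\<exists>v. (f s \<longlongrightarrow> v) (at 0) \<and> (A s \<longlongrightarrow> v) (at 0)"
    proof (rule common_limit[where Q="Q \<inter> J", OF _ C J(3)])
      show "\<exists>q\<in>Q \<inter> J. \<bar>s - q\<bar> < \<tau>" if \<tau>: "\<tau> > 0" for \<tau>
      proof -
        obtain q where "q \<in> \<rat>" "s < q" "q < s + min \<tau> \<tau>0"
          using Rats_dense_in_real[of s "s + min \<tau> \<tau>0"] \<tau> \<tau>0 by auto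
        then have "q \<in> J" "\<bar>s - q\<bar> < \<tau>" by (auto simp: J_def dist_real_def)
        then show ?thesis using J(2) \<open>q \<in> \<rat>\<close> by (auto simp: Q_def)
      qed
      show "\<forall>\<^sub>F \<delta> in at 0. 0 \<le> f s \<delta> \<and> f s \<delta> \<le> exp (C * \<bar>s - s'\<bar>) * f s' \<delta>" if ss: "s \<in> J" "s' \<in> J" for s s'
        using small
      proof eventually_elim
        case (elim \<delta>)
        have "d s (\<beta> (t + \<delta>)) (\<beta> t) \<le> exp (C * \<bar>s - s'\<bar>) * d s' (\<beta> (t + \<delta>)) (\<beta> t)"
          by (rule comparable_withD[OF Cmp]) (use ss elim tab in auto)
        moreover have "0 \<le> d s (\<beta> (t + \<delta>)) (\<beta> t)" using dnn ss J by auto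
        ultimately show ?case by (simp add: f_def divide_right_mono)
      qed
      show "\<forall>\<^sub>F \<delta> in at 0. 0 \<le> A s \<delta> \<and> A s \<delta> \<le> exp (C * \<bar>s - s'\<bar>) * A s' \<delta>" if ss: "s \<in> J" "s' \<in> J" for s s'
        using small
      proof eventually_elim
        case (elim \<delta>)
        show ?case
        proof (cases "\<delta> > 0")
          case True
          then show ?thesis using F_le[OF ss, of t "t + \<delta>"] elim tab
            by (simp add: A_def divide_right_mono)
        next
          case False
          define k where "k = - \<delta>"
          have k: "k > 0" "k < t - a" "t + \<delta> = t - k" using False elim by (auto simp: k_def)
          have eq: "A s \<delta> = (F s t - F s (t - k)) / k" for s
            using k(1) unfolding A_def k(3) by (simp add: k_def field_simps)
          have "0 \<le> (F s t - F s (t - k)) / k"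
            "(F s t - F s (t - k)) / k \<le> (exp (C * \<bar>s - s'\<bar>) * (F s' t - F s' (t - k))) / k"
            using k tab by (auto intro!: divide_right_mono divide_nonneg_pos F_le[OF ss])
          then show ?thesis unfolding eq by simp
        qed
      qed
      show "\<exists>m. (f q \<longlongrightarrow> m) (at 0) \<and> (A q \<longlongrightarrow> m) (at 0)" if "q \<in> Q \<inter> J" for q
      proof (intro exI[of _ "?m q t"] conjI)
        have "((\<lambda>u. d q (\<beta> u) (\<beta> t) / \<bar>u - t\<bar>) \<longlongrightarrow> ?m q t) (at t)"
          using t that by (intro lim) (auto simp: N_def)
        then show "(f q \<longlongrightarrow> ?m q t) (at 0)"
          unfolding f_def[abs_def] using LIM_offset_zero by fastforce
        have "(F q has_real_derivative ?m q t) (at t)" using t that by (auto simp: N_def L_def)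
        then show "(A q \<longlongrightarrow> ?m q t) (at 0)" by (simp add: A_def[abs_def] DERIV_def)
      qed
    qed auto
    then obtain v where v: "(f s \<longlongrightarrow> v) (at 0)" "(A s \<longlongrightarrow> v) (at 0)" by blast
    have "((\<lambda>\<delta>. d s (\<beta> (t + \<delta>)) (\<beta> t) / \<bar>(t + \<delta>) - t\<bar>) \<longlongrightarrow> v) (at 0)"
      using v(1) by (simp add: f_def[abs_def])
    then have "has_speed d \<beta> s t v"
      unfolding has_speed_def by (rule LIM_offset_zero_cancel)
    moreover have "gen_metric_speed d a b \<beta> s t = ereal v"
      using v(2) by (intro gen_metric_speed_eq abs_int s tab) (simp add: A_def[abs_def] F_def)
    ultimately show ?thesis by blast
  qed
  show ?thesis by (rule negligible_subset[OF N]) (use main in blast)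
qed

section \<open>Continuity and comparability along absolutely continuous curves\<close>

text \<open>The length metric is bounded by the length of the piece of the curve itself, and absolute
  continuity bounds every polygonal approximation of that length.\<close>

lemma length_metric_abs_continuous:
  assumes "Metric_space M \<rho>" and \<beta>: "\<beta> ` {a..b} \<subseteq> M" and ac: "abs_continuous_curve \<rho> a b \<beta>" and "e > 0"
  shows "\<exists>\<delta>>0. \<forall>t\<in>{a..b}. \<forall>u\<in>{a..b}. \<bar>u - t\<bar> < \<delta> \<longrightarrow> length_metric M \<rho> (\<beta> t) (\<beta> u) \<le> ennreal e"
proof -
  interpret Metric_space M \<rho> by fact
  obtain \<delta> where "\<delta> > 0" and \<delta>:
    "\<forall>n l r. thin_family a b \<delta> n l r \<longrightarrow> (\<Sum>i<n. \<rho> (\<beta> (l i)) (\<beta> (r i))) < e"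
    using ac \<open>e > 0\<close> unfolding abs_continuous_curve_iff by blast
  have "length_metric M \<rho> (\<beta> t) (\<beta> u) \<le> ennreal e"
    if tu: "t \<in> {a..b}" "u \<in> {a..b}" "\<bar>u - t\<bar> < \<delta>" for t u
  proof -
    \<comment> \<open>the affine parametrization of the segment from \<open>t\<close> to \<open>u\<close>, decreasing if \<open>u < t\<close>\<close>
    define p where "p \<tau> = t + \<tau> * (u - t)" for \<tau>
    define c where "c \<tau> = \<beta> (p \<tau>)" for \<tau>
    have p_in: "p \<tau> \<in> {a..b}" if "\<tau> \<in> {0..1}" for \<tau>
    proof -
      have "p \<tau> = (1 - \<tau>) * t + \<tau> * u" by (simp add: p_def algebra_simps)
      then show ?thesis
        using convexD_alt[of "{a..b}" t u \<tau>] tu that by simp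
    qed
    have c_in: "c \<tau> \<in> M" if "\<tau> \<in> {0..1}" for \<tau> using \<beta> p_in[OF that] by (auto simp: c_def)
    have p_dist: "\<bar>p \<tau> - p \<sigma>\<bar> = \<bar>\<tau> - \<sigma>\<bar> * \<bar>u - t\<bar>" for \<tau> \<sigma>
      by (simp add: p_def abs_mult[symmetric] algebra_simps)
    have "pathin mtopology c"
      unfolding pathin_def continuous_map_to_metric
    proof (intro ballI allI impI)
      fix \<tau> \<epsilon> :: real assume \<tau>: "\<tau> \<in> topspace (top_of_set {0..1})" and "\<epsilon> > 0"
      obtain \<eta> where "\<eta> > 0" and \<eta>: "\<forall>x y. a \<le> x \<and> x \<le> y \<and> y \<le> b \<and> y - x < \<eta> \<longrightarrow> \<rho> (\<beta> x) (\<beta> y) < \<epsilon>"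
        using abs_continuous_curve_uniform[OF ac \<open>\<epsilon> > 0\<close>] by blast
      define U where "U = {0..1} \<inter> ball \<tau> (\<eta> / (\<bar>u - t\<bar> + 1))"
      have "c \<sigma> \<in> mball (c \<tau>) \<epsilon>" if "\<sigma> \<in> U" for \<sigma>
      proof -
        have \<sigma>: "\<sigma> \<in> {0..1}" "\<bar>\<tau> - \<sigma>\<bar> < \<eta> / (\<bar>u - t\<bar> + 1)" using that by (auto simp: U_def dist_real_def)
        have "\<bar>p \<tau> - p \<sigma>\<bar> \<le> \<bar>\<tau> - \<sigma>\<bar> * (\<bar>u - t\<bar> + 1)"
          unfolding p_dist by (intro mult_left_mono) auto
        also have "\<dots> < \<eta>" using \<sigma>(2) by (simp add: pos_less_divide_eq)
        finally have "\<rho> (c \<tau>) (c \<sigma>) < \<epsilon>"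
          using \<eta>[rule_format, of "p \<tau>" "p \<sigma>"] \<eta>[rule_format, of "p \<sigma>" "p \<tau>"] p_in[of \<tau>] p_in[of \<sigma>] \<tau> \<sigma>
            commute[of "c \<tau>" "c \<sigma>"]
          by (cases "p \<tau> \<le> p \<sigma>") (auto simp: c_def)
        then show ?thesis using c_in \<tau> \<sigma> by (simp add: in_mball)
      qed
      moreover have "openin (top_of_set {0..1}) U" unfolding U_def by (intro openin_open_Int) simp
      moreover have "\<tau> \<in> U" using \<tau> \<open>\<eta> > 0\<close> by (simp add: U_def add_nonneg_pos)
      ultimately show "\<exists>U. openin (top_of_set {0..1}) U \<and> \<tau> \<in> U \<and> (\<forall>y\<in>U. c y \<in> mball (c \<tau>) \<epsilon>)" by blast
    qed
    moreover have "c 0 = \<beta> t" "c 1 = \<beta> u" by (simp_all add: c_def p_def)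
    ultimately have "length_metric M \<rho> (\<beta> t) (\<beta> u) \<le> curve_length \<rho> 0 1 c"
      unfolding length_metric_def by (intro INF_lower) simp
    also have "\<dots> \<le> ennreal e"
      unfolding curve_length_def
    proof (rule SUP_least)
      fix ts assume "ts \<in> {ts. sorted ts \<and> set ts \<subseteq> {0..1::real}}"
      then have ts: "sorted ts" "set ts \<subseteq> {0..1}" by auto
      define n where "n = length ts - 1"
      define l where "l i = min (p (ts ! i)) (p (ts ! Suc i))" for i
      define r where "r i = max (p (ts ! i)) (p (ts ! Suc i))" for i
      have le: "ts ! i \<le> ts ! j" if "i \<le> j" "j \<le> n" "n > 0" for i j
        using that by (intro sorted_nth_mono[OF ts(1)]) (auto simp: n_def)
      have el: "ts ! i \<in> {0..1}" if "i \<le> n" "n > 0" for i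
      proof -
        have "ts ! i \<in> set ts" using that by (intro nth_mem) (auto simp: n_def)
        then show ?thesis using ts(2) by blast
      qed
      have pmono: "if t \<le> u then p x \<le> p y else p y \<le> p x" if "x \<le> y" for x y
        using mult_right_mono[OF that, of "u - t"] mult_right_mono_neg[OF that, of "u - t"]
        by (auto simp: p_def)
      have "(\<Sum>i<n. \<rho> (\<beta> (l i)) (\<beta> (r i))) < e"
      proof (rule \<delta>[rule_format, OF thin_familyI])
        show "a \<le> l i \<and> l i \<le> r i \<and> r i \<le> b" if "i < n" for i
        proof -
          have "p (ts ! i) \<in> {a..b}" "p (ts ! Suc i) \<in> {a..b}"
            using that by - (intro p_in el; simp)+
          then show "a \<le> l i \<and> l i \<le> r i \<and> r i \<le> b" by (auto simp: l_def r_def)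
        qed
        have dis: "{l i<..<r i} \<inter> {l j<..<r j} = {}" if "i < j" "j < n" for i j
        proof -
          have "ts ! i \<le> ts ! Suc i" "ts ! Suc i \<le> ts ! j" "ts ! j \<le> ts ! Suc j"
            using that by (auto intro!: le)
          then show ?thesis
            using pmono[of "ts ! i" "ts ! Suc i"] pmono[of "ts ! Suc i" "ts ! j"] pmono[of "ts ! j" "ts ! Suc j"]
            by (cases "t \<le> u") (auto simp: l_def r_def)
        qed
        show "{l i<..<r i} \<inter> {l j<..<r j} = {}" if "i < n" "j < n" "i \<noteq> j" for i j
          using dis[of i j] dis[of j i] that by (cases "i < j") (auto simp: Int_commute)
        have "(\<Sum>i<n. r i - l i) = (\<Sum>i<n. (ts ! Suc i - ts ! i) * \<bar>u - t\<bar>)"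
        proof (rule sum.cong)
          fix i assume "i \<in> {..<n}"
          then have "ts ! i \<le> ts ! Suc i" by (intro le) auto
          moreover have "r i - l i = \<bar>p (ts ! Suc i) - p (ts ! i)\<bar>" by (auto simp: l_def r_def)
          ultimately show "r i - l i = (ts ! Suc i - ts ! i) * \<bar>u - t\<bar>" by (simp add: p_dist)
        qed simp
        also have "\<dots> = (ts ! n - ts ! 0) * \<bar>u - t\<bar>"
          by (simp add: sum_distrib_right[symmetric] sum_lessThan_telescope)
        also have "\<dots> \<le> 1 * \<bar>u - t\<bar>"
        proof (rule mult_right_mono)
          show "ts ! n - ts ! 0 \<le> 1" using el[of 0] el[of n] by (cases "n = 0") auto
        qed simp
        finally show "(\<Sum>i<n. r i - l i) < \<delta>" using tu(3) by simp
      qed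
      moreover have "\<rho> (\<beta> (l i)) (\<beta> (r i)) = \<rho> (c (ts ! i)) (c (ts ! Suc i))" for i
        using commute by (auto simp: l_def r_def c_def min_def max_def)
      ultimately have "(\<Sum>i<n. \<rho> (c (ts ! i)) (c (ts ! Suc i))) < e" by simp
      then have "ennreal (\<Sum>i<n. \<rho> (c (ts ! i)) (c (ts ! Suc i))) \<le> ennreal e"
        by (intro ennreal_leI) simp
      then show "(\<Sum>i<length ts - 1. ennreal (\<rho> (c (ts ! i)) (c (ts ! Suc i)))) \<le> ennreal e"
        by (simp add: n_def)
    qed
    finally show ?thesis .
  qed
  with \<open>\<delta> > 0\<close> show ?thesis by blast
qed

text \<open>Absolute continuity refers to the metric \<open>\<rho>\<close>, whereas the topology of \<open>X\<close> comes from the length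
  metric, which is larger; for an absolutely continuous curve the difference disappears.\<close>

lemma abs_continuous_continuous_map:
  assumes M: "Metric_space (topspace X) \<rho>" and gen: "generates_topology (length_metric (topspace X) \<rho>) X"
    and \<beta>: "\<beta> ` {a..b} \<subseteq> topspace X" and ac: "abs_continuous_curve \<rho> a b \<beta>"
  shows "continuous_map (top_of_set {a..b}) X \<beta>"
  unfolding continuous_map_def
proof (intro conjI allI impI)
  fix U assume U: "openin X U"
  show "openin (top_of_set {a..b}) {t \<in> topspace (top_of_set {a..b}). \<beta> t \<in> U}"
    unfolding openin_euclidean_subtopology_iff
  proof (intro conjI ballI)
    fix t assume "t \<in> {t \<in> topspace (top_of_set {a..b}). \<beta> t \<in> U}"
    then have t: "t \<in> {a..b}" "\<beta> t \<in> U" by auto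
    then obtain \<epsilon> where "\<epsilon> > 0" and \<epsilon>: "\<forall>y\<in>topspace X. length_metric (topspace X) \<rho> (\<beta> t) y < \<epsilon> \<longrightarrow> y \<in> U"
      using U gen unfolding generates_topology_def by blast
    obtain e where e: "0 < ennreal e" "ennreal e < \<epsilon>"
      using \<open>\<epsilon> > 0\<close> dense[of 0 \<epsilon>] by (metis ennreal_cases infinity_ennreal_def not_less_iff_gr_or_eq order_less_trans ennreal_less_top top.not_eq_extremum)
    then have "e > 0" by (simp add: ennreal_less_zero_iff)
    obtain \<delta> where \<delta>: "\<delta> > 0" "\<forall>t\<in>{a..b}. \<forall>u\<in>{a..b}. \<bar>u - t\<bar> < \<delta> \<longrightarrow>
        length_metric (topspace X) \<rho> (\<beta> t) (\<beta> u) \<le> ennreal e"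
      using length_metric_abs_continuous[OF M \<beta> ac \<open>e > 0\<close>] by blast
    show "\<exists>e>0. \<forall>x'\<in>{a..b}. dist x' t < e \<longrightarrow> x' \<in> {t \<in> topspace (top_of_set {a..b}). \<beta> t \<in> U}"
    proof (intro exI[of _ \<delta>] conjI ballI impI)
      fix u assume u: "u \<in> {a..b}" "dist u t < \<delta>"
      then have "length_metric (topspace X) \<rho> (\<beta> t) (\<beta> u) \<le> ennreal e"
        using \<delta>(2) t(1) by (auto simp: dist_real_def)
      then have "length_metric (topspace X) \<rho> (\<beta> t) (\<beta> u) < \<epsilon>"
        using e(2) by (rule le_less_trans)
      then show "u \<in> {t \<in> topspace (top_of_set {a..b}). \<beta> t \<in> U}"
        using \<epsilon> u(1) \<beta> by (auto simp: image_subset_iff)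
    qed (fact \<delta>(1))
  qed auto
qed (use \<beta> in auto)

lemma log_lipschitz_comparable:
  assumes "J \<noteq> {}" and M: "\<And>s. s \<in> J \<Longrightarrow> Metric_space M (d s)" and \<beta>: "\<beta> ` {a..b} \<subseteq> M"
    and ac: "\<And>s. s \<in> J \<Longrightarrow> abs_continuous_curve (d s) a b \<beta>"
    and "C > 0" "r > 0" and ll: "\<forall>s\<in>J. \<forall>s'\<in>J. \<forall>x\<in>\<beta> ` {a..b}. \<forall>y\<in>\<beta> ` {a..b}.
      x \<noteq> y \<and> (INF \<sigma>\<in>J. d \<sigma> x y) < r \<longrightarrow> \<bar>ln (d s x y / d s' x y)\<bar> \<le> C * \<bar>s - s'\<bar>"
  shows "comparable_along J d a b \<beta>"
proof -
  obtain s0 where s0: "s0 \<in> J" using \<open>J \<noteq> {}\<close> by blast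
  obtain \<rho> where \<rho>: "\<rho> > 0" "\<forall>x y. a \<le> x \<and> x \<le> y \<and> y \<le> b \<and> y - x < \<rho> \<longrightarrow> d s0 (\<beta> x) (\<beta> y) < r"
    using abs_continuous_curve_uniform[OF ac[OF s0] \<open>r > 0\<close>] by blast
  have "d s (\<beta> u) (\<beta> v) \<le> exp (C * \<bar>s - s'\<bar>) * d s' (\<beta> u) (\<beta> v)"
    if ss: "s \<in> J" "s' \<in> J" and uv: "u \<in> {a..b}" "v \<in> {a..b}" "\<bar>u - v\<bar> < \<rho>" for s s' u v
  proof (cases "\<beta> u = \<beta> v")
    case True
    have "d \<sigma> (\<beta> v) (\<beta> v) = 0" if "\<sigma> \<in> J" for \<sigma>
      using Metric_space.zero[OF M[OF that], of "\<beta> v" "\<beta> v"] \<beta> uv by (auto simp: image_subset_iff)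
    then show ?thesis using True ss by simp
  next
    case False
    have in_M: "\<beta> u \<in> M" "\<beta> v \<in> M" using \<beta> uv by auto
    have nn: "0 \<le> d \<sigma> x y" if "\<sigma> \<in> J" for \<sigma> x y using Metric_space.nonneg[OF M[OF that]] .
    have pos: "d \<sigma> (\<beta> u) (\<beta> v) > 0" if "\<sigma> \<in> J" for \<sigma>
      using Metric_space.zero[OF M[OF that] in_M] False nn[OF that, of "\<beta> u" "\<beta> v"] by linarith
    have "(INF \<sigma>\<in>J. d \<sigma> (\<beta> u) (\<beta> v)) \<le> d s0 (\<beta> u) (\<beta> v)"
      using nn by (intro cINF_lower s0 bdd_belowI[of _ 0]) auto
    also have "\<dots> < r"
      using \<rho>(2)[rule_format, of u v] \<rho>(2)[rule_format, of v u] uv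
        Metric_space.commute[OF M[OF s0], of "\<beta> u" "\<beta> v"]
      by (cases "u \<le> v") auto
    finally have "(INF \<sigma>\<in>J. d \<sigma> (\<beta> u) (\<beta> v)) < r" .
    then have "\<bar>ln (d s (\<beta> u) (\<beta> v) / d s' (\<beta> u) (\<beta> v))\<bar> \<le> C * \<bar>s - s'\<bar>"
      using ll ss uv False by blast
    then have "ln (d s (\<beta> u) (\<beta> v) / d s' (\<beta> u) (\<beta> v)) \<le> C * \<bar>s - s'\<bar>" by linarith
    then have "d s (\<beta> u) (\<beta> v) / d s' (\<beta> u) (\<beta> v) \<le> exp (C * \<bar>s - s'\<bar>)"
      using pos ss by (metis divide_pos_pos exp_le_cancel_iff exp_ln)
    then show ?thesis using pos[OF ss(2)] by (simp add: pos_divide_le_eq)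
  qed
  then show ?thesis unfolding comparable_along_def comparable_with_def using \<rho>(1) \<open>C > 0\<close>
    by (intro exI[of _ C] conjI exI[of _ \<rho>]) auto
qed

section \<open>Timelike and causal curves through pointwise conditions\<close>

lemma AE_lebesgue_iff_negligible:
  "(AE t\<in>S in lebesgue. P t) \<longleftrightarrow> negligible {t\<in>S. \<not> P t}"
proof
  assume "AE t\<in>S in lebesgue. P t"
  then obtain N where "N \<in> null_sets lebesgue" "{t \<in> space lebesgue. \<not> (t \<in> S \<longrightarrow> P t)} \<subseteq> N"
    by (auto simp: eventually_ae_filter)
  moreover have "{t \<in> space lebesgue. \<not> (t \<in> S \<longrightarrow> P t)} = {t\<in>S. \<not> P t}" by auto
  ultimately show "negligible {t\<in>S. \<not> P t}"
    by (metis negligible_iff_null_sets negligible_subset)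
next
  assume "negligible {t\<in>S. \<not> P t}"
  then show "AE t\<in>S in lebesgue. P t"
    by (intro AE_I'[of "{t\<in>S. \<not> P t}"]) (auto simp: negligible_iff_null_sets)
qed

lemma has_speed_unique: "has_speed d \<beta> s t v \<Longrightarrow> has_speed d \<beta> s t w \<Longrightarrow> v = w"
  unfolding has_speed_def by (rule tendsto_unique[OF trivial_limit_at])

text \<open>With \<open>R\<close> the relation \<open><\<close> or \<open>\<le>\<close> this is the infinitesimal condition for a future directed timelike
  or causal curve. It depends only on the germs of \<open>\<alpha>\<close> and \<open>\<beta>\<close> at \<open>t\<close>, in contrast to
  \<^const>\<open>gen_metric_speed\<close>, which refers to the whole parameter interval.\<close>

definition directed_at ::
  "(real \<Rightarrow> 'a \<Rightarrow> real) \<Rightarrow> (real \<Rightarrow> 'a \<Rightarrow> 'a \<Rightarrow> real) \<Rightarrow> (real \<Rightarrow> real \<Rightarrow> bool) \<Rightarrow>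
    (real \<Rightarrow> real) \<Rightarrow> (real \<Rightarrow> 'a) \<Rightarrow> real \<Rightarrow> bool" where
  "directed_at h d R \<alpha> \<beta> t \<longleftrightarrow>
     (\<exists>D v. 0 < D \<and> (\<alpha> has_real_derivative D) (at t) \<and> has_speed d \<beta> (\<alpha> t) t v \<and>
        R v (h (\<alpha> t) (\<beta> t) * D))"

lemma directed_at_shift:
  assumes "directed_at h d R \<alpha> \<beta> (t - k)"
  shows "directed_at h d R (\<lambda>t. \<alpha> (t - k)) (\<lambda>t. \<beta> (t - k)) t"
proof -
  obtain D v where D: "0 < D" "(\<alpha> has_real_derivative D) (at (t - k))"
    and v: "has_speed d \<beta> (\<alpha> (t - k)) (t - k) v" and R: "R v (h (\<alpha> (t - k)) (\<beta> (t - k)) * D)"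
    using assms unfolding directed_at_def by blast
  have "((\<lambda>t. \<alpha> (t - k)) has_real_derivative D) (at t)"
    using D(2) DERIV_shift[of \<alpha> D t "- k"] by simp
  moreover have "has_speed d (\<lambda>t. \<beta> (t - k)) (\<alpha> (t - k)) t v"
    using LIM_offset[OF v[unfolded has_speed_def], of "- k"] by (simp add: has_speed_def)
  ultimately show ?thesis using D(1) R unfolding directed_at_def by blast
qed

lemma directed_at_cong:
  assumes "directed_at h d R \<alpha> \<beta> t" and "open S" "t \<in> S"
    and eq: "\<And>u. u \<in> S \<Longrightarrow> \<alpha>' u = \<alpha> u" "\<And>u. u \<in> S \<Longrightarrow> \<beta>' u = \<beta> u"
  shows "directed_at h d R \<alpha>' \<beta>' t"
proof -
  obtain D v where D: "0 < D" "(\<alpha> has_real_derivative D) (at t)"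
    and v: "has_speed d \<beta> (\<alpha> t) t v" and R: "R v (h (\<alpha> t) (\<beta> t) * D)"
    using assms(1) unfolding directed_at_def by blast
  have "(\<alpha>' has_real_derivative D) (at t)"
    using D(2) assms(2,3) by (rule has_field_derivative_transform_within_open) (simp add: eq)
  moreover have "has_speed d \<beta>' (\<alpha> t) t v"
    unfolding has_speed_def
    by (rule Lim_transform_within_open[OF v[unfolded has_speed_def] assms(2,3)]) (use eq assms(3) in auto)
  ultimately show ?thesis using D(1) R eq[OF assms(3)] unfolding directed_at_def by metis
qed

locale generalized_product =
  fixes X :: "'a topology"
    and I :: "real set"
    and h :: "real \<Rightarrow> 'a \<Rightarrow> real"
    and d :: "real \<Rightarrow> 'a \<Rightarrow> 'a \<Rightarrow> real"
  assumes open_I: "open I" and interval_I: "is_interval I"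
    and h_continuous: "continuous_map (prod_topology (top_of_set I) X) euclideanreal (\<lambda>(s, x). h s x)"
    and h_pos: "\<And>s x. s \<in> I \<Longrightarrow> x \<in> topspace X \<Longrightarrow> h s x > 0"
    and metric: "\<And>s. s \<in> I \<Longrightarrow> Metric_space (topspace X) (d s)"
    and generates: "\<And>s. s \<in> I \<Longrightarrow> generates_topology (length_metric (topspace X) (d s)) X"
    and log_lipschitz: "\<And>J K. compact J \<Longrightarrow> J \<subseteq> I \<Longrightarrow> compactin X K \<Longrightarrow>
           \<exists>C>0. \<exists>r>0. \<forall>s\<in>J. \<forall>s'\<in>J. \<forall>x\<in>K. \<forall>y\<in>K.
             x \<noteq> y \<and> (INF \<sigma>\<in>J. d \<sigma> x y) < r \<longrightarrow> \<bar>ln (d s x y / d s' x y)\<bar> \<le> C * \<bar>s - s'\<bar>"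
    and h_lipschitz: "\<And>J K. compact J \<Longrightarrow> J \<subseteq> I \<Longrightarrow> compactin X K \<Longrightarrow>
           \<exists>C'>0. \<forall>s\<in>J. \<forall>s'\<in>J. \<forall>x\<in>K. \<bar>h s x - h s' x\<bar> \<le> C' * \<bar>s - s'\<bar>"
begin

abbreviation curve :: "real \<Rightarrow> real \<Rightarrow> (real \<Rightarrow> real) \<Rightarrow> (real \<Rightarrow> 'a) \<Rightarrow> bool" where
  "curve \<equiv> abs_continuous_in_product I X d"

abbreviation directed :: "(real \<Rightarrow> real \<Rightarrow> bool) \<Rightarrow> real \<Rightarrow> real \<Rightarrow> (real \<Rightarrow> real) \<Rightarrow> (real \<Rightarrow> 'a) \<Rightarrow> bool" where
  "directed R a b \<alpha> \<beta> \<equiv> negligible {t\<in>{a..b}. \<not> directed_at h d R \<alpha> \<beta> t}"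

lemma curveD:
  assumes "curve a b \<alpha> \<beta>"
  shows "\<And>t. t \<in> {a..b} \<Longrightarrow> \<alpha> t \<in> I" "\<And>t. t \<in> {a..b} \<Longrightarrow> \<beta> t \<in> topspace X"
    "\<beta> ` {a..b} \<subseteq> topspace X"
    "abs_continuous_curve dist a b \<alpha>" "\<And>s. s \<in> I \<Longrightarrow> abs_continuous_curve (d s) a b \<beta>"
  using assms by (auto simp: abs_continuous_in_product_def)

lemma continuous_map_space_component:
  assumes "curve a b \<alpha> \<beta>" "a \<le> b"
  shows "continuous_map (top_of_set {a..b}) X \<beta>"
proof -
  have "\<alpha> a \<in> I" using assms by (auto intro: curveD)
  then show ?thesis
    by (intro abs_continuous_continuous_map[OF metric generates] curveD[OF assms(1)])
qed

lemma compactin_space_component: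
  assumes "curve a b \<alpha> \<beta>" "a \<le> b"
  shows "compactin X (\<beta> ` {a..b})"
  using image_compactin[OF _ continuous_map_space_component[OF assms], of "{a..b}"]
  by (simp add: compactin_subtopology compactin_euclidean_iff)

lemma comparable:
  assumes "curve a b \<alpha> \<beta>" "a \<le> b" and J: "compact J" "J \<subseteq> I"
  shows "comparable_along J d a b \<beta>"
proof (cases "J = {}")
  case True
  then show ?thesis unfolding comparable_along_def comparable_with_def by (auto intro: exI[of _ 0] exI[of _ 1])
next
  case False
  obtain C r where C: "C > 0" "r > 0" "\<forall>s\<in>J. \<forall>s'\<in>J. \<forall>x\<in>\<beta> ` {a..b}. \<forall>y\<in>\<beta> ` {a..b}.
      x \<noteq> y \<and> (INF \<sigma>\<in>J. d \<sigma> x y) < r \<longrightarrow> \<bar>ln (d s x y / d s' x y)\<bar> \<le> C * \<bar>s - s'\<bar>"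
    using log_lipschitz[OF J compactin_space_component[OF assms(1,2)]] by auto
  show ?thesis
    using J(2) by (intro log_lipschitz_comparable[OF False metric curveD(3)[OF assms(1)] _ C] curveD(5)[OF assms(1)]) auto
qed

lemma has_speed_nonneg:
  assumes "s \<in> I" "has_speed d \<beta> s t v"
  shows "0 \<le> v"
  using assms(2) unfolding has_speed_def
  by (rule tendsto_lowerbound) (simp_all add: Metric_space.nonneg[OF metric[OF assms(1)]])

lemma speeds_exist:
  assumes "curve a b \<alpha> \<beta>" "a < b"
  shows "negligible {t\<in>{a..b}. \<not> (\<forall>s\<in>I. \<exists>v. has_speed d \<beta> s t v \<and> gen_metric_speed d a b \<beta> s t = ereal v)}"
  using assms by (intro gen_metric_speed_is_limit[OF assms(2) open_I metric curveD(3)[OF assms(1)] curveD(5)[OF assms(1)]] comparable) auto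

text \<open>Where the generalized speed is the limit \<open>v\<close>, it is real and nonnegative, so the squares in the
  definitions can be removed.\<close>

lemma directed_at_iff:
  assumes "curve a b \<alpha> \<beta>" "t \<in> {a..b}"
    and "\<forall>s\<in>I. \<exists>v. has_speed d \<beta> s t v \<and> gen_metric_speed d a b \<beta> s t = ereal v"
  shows "directed_at h d (<) \<alpha> \<beta> t \<longleftrightarrow> \<alpha> differentiable (at t) \<and> deriv \<alpha> t > 0 \<and>
      (gen_metric_speed d a b \<beta> (\<alpha> t) t)\<^sup>2 < ereal ((h (\<alpha> t) (\<beta> t))\<^sup>2 * (deriv \<alpha> t)\<^sup>2)"
    and "directed_at h d (\<le>) \<alpha> \<beta> t \<longleftrightarrow> \<alpha> differentiable (at t) \<and> deriv \<alpha> t > 0 \<and>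
      (gen_metric_speed d a b \<beta> (\<alpha> t) t)\<^sup>2 \<le> ereal ((h (\<alpha> t) (\<beta> t))\<^sup>2 * (deriv \<alpha> t)\<^sup>2)"
proof -
  have \<alpha>: "\<alpha> t \<in> I" and \<beta>: "\<beta> t \<in> topspace X" using curveD(1,2)[OF assms(1)] assms(2) by auto
  obtain v where v: "has_speed d \<beta> (\<alpha> t) t v" "gen_metric_speed d a b \<beta> (\<alpha> t) t = ereal v"
    using assms(3) \<alpha> by blast
  have v0: "0 \<le> v" using has_speed_nonneg[OF \<alpha> v(1)] .
  have h0: "0 < h (\<alpha> t) (\<beta> t)" using h_pos[OF \<alpha> \<beta>] .
  have diff: "\<alpha> differentiable (at t) \<longleftrightarrow> (\<alpha> has_real_derivative deriv \<alpha> t) (at t)"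
    by (metis DERIV_deriv_iff_real_differentiable)
  have d: "directed_at h d R \<alpha> \<beta> t \<longleftrightarrow>
      \<alpha> differentiable (at t) \<and> deriv \<alpha> t > 0 \<and> R v (h (\<alpha> t) (\<beta> t) * deriv \<alpha> t)" for R
    unfolding directed_at_def diff using v(1) has_speed_unique[OF v(1)] DERIV_imp_deriv by metis
  have sq: "(ereal v)\<^sup>2 = ereal (v\<^sup>2)" by simp
  have less: "v\<^sup>2 < (h (\<alpha> t) (\<beta> t))\<^sup>2 * D\<^sup>2 \<longleftrightarrow> v < h (\<alpha> t) (\<beta> t) * D" if "D > 0" for D
    using v0 h0 that unfolding power_mult_distrib[symmetric] not_le[symmetric]
    by (simp add: power_mono_iff)
  have le: "v\<^sup>2 \<le> (h (\<alpha> t) (\<beta> t))\<^sup>2 * D\<^sup>2 \<longleftrightarrow> v \<le> h (\<alpha> t) (\<beta> t) * D" if "D > 0" for D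
    using v0 h0 that unfolding power_mult_distrib[symmetric]
    by (simp add: power_mono_iff)
  show "directed_at h d (<) \<alpha> \<beta> t \<longleftrightarrow> \<alpha> differentiable (at t) \<and> deriv \<alpha> t > 0 \<and>
      (gen_metric_speed d a b \<beta> (\<alpha> t) t)\<^sup>2 < ereal ((h (\<alpha> t) (\<beta> t))\<^sup>2 * (deriv \<alpha> t)\<^sup>2)"
    unfolding d v(2) sq ereal_less_eq less_ereal.simps using less by blast
  show "directed_at h d (\<le>) \<alpha> \<beta> t \<longleftrightarrow> \<alpha> differentiable (at t) \<and> deriv \<alpha> t > 0 \<and>
      (gen_metric_speed d a b \<beta> (\<alpha> t) t)\<^sup>2 \<le> ereal ((h (\<alpha> t) (\<beta> t))\<^sup>2 * (deriv \<alpha> t)\<^sup>2)"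
    unfolding d v(2) sq ereal_less_eq using le by blast
qed

lemma AE_directed_iff:
  assumes "curve a b \<alpha> \<beta>" "a < b"
    and iff: "\<And>t. t \<in> {a..b} \<Longrightarrow>
        \<forall>s\<in>I. \<exists>v. has_speed d \<beta> s t v \<and> gen_metric_speed d a b \<beta> s t = ereal v \<Longrightarrow>
        P t \<longleftrightarrow> Q t \<and> S t"
  shows "(AE t\<in>{a..b} in lebesgue. Q t) \<and> (AE t\<in>{a..b} in lebesgue. S t) \<longleftrightarrow> negligible {t\<in>{a..b}. \<not> P t}"
proof -
  have "AE t\<in>{a..b} in lebesgue. \<forall>s\<in>I. \<exists>v. has_speed d \<beta> s t v \<and> gen_metric_speed d a b \<beta> s t = ereal v"
    using speeds_exist[OF assms(1,2)] by (simp only: AE_lebesgue_iff_negligible)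
  then have "AE t in lebesgue. (t \<in> {a..b} \<longrightarrow> P t) \<longleftrightarrow> (t \<in> {a..b} \<longrightarrow> Q t) \<and> (t \<in> {a..b} \<longrightarrow> S t)"
    by eventually_elim (use iff in blast)
  then have "(AE t\<in>{a..b} in lebesgue. P t) \<longleftrightarrow>
      (AE t in lebesgue. (t \<in> {a..b} \<longrightarrow> Q t) \<and> (t \<in> {a..b} \<longrightarrow> S t))"
    by (rule eventually_cong)
  then show ?thesis by (simp only: AE_conj_iff AE_lebesgue_iff_negligible[symmetric])
qed

lemma curve_rel_iff:
  assumes "curve a b \<alpha> \<beta>" "a < b"
  shows "future_directed I X d a b \<alpha> \<beta> \<and> timelike_curve h I X d a b \<alpha> \<beta> \<longleftrightarrow>
      directed (<) a b \<alpha> \<beta>"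
    and "future_directed I X d a b \<alpha> \<beta> \<and> causal_curve h I X d a b \<alpha> \<beta> \<longleftrightarrow>
      directed (\<le>) a b \<alpha> \<beta>"
proof -
  show "future_directed I X d a b \<alpha> \<beta> \<and> timelike_curve h I X d a b \<alpha> \<beta> \<longleftrightarrow>
      directed (<) a b \<alpha> \<beta>"
    using AE_directed_iff[OF assms, of "directed_at h d (<) \<alpha> \<beta>"
      "\<lambda>t. \<alpha> differentiable (at t) \<and> deriv \<alpha> t > 0"
      "\<lambda>t. (gen_metric_speed d a b \<beta> (\<alpha> t) t)\<^sup>2 < ereal ((h (\<alpha> t) (\<beta> t))\<^sup>2 * (deriv \<alpha> t)\<^sup>2)"]
      directed_at_iff(1)[OF assms(1)] assms(1)
    unfolding timelike_curve_def future_directed_def by blast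
  show "future_directed I X d a b \<alpha> \<beta> \<and> causal_curve h I X d a b \<alpha> \<beta> \<longleftrightarrow>
      directed (\<le>) a b \<alpha> \<beta>"
    using AE_directed_iff[OF assms, of "directed_at h d (\<le>) \<alpha> \<beta>"
      "\<lambda>t. \<alpha> differentiable (at t) \<and> deriv \<alpha> t > 0"
      "\<lambda>t. (gen_metric_speed d a b \<beta> (\<alpha> t) t)\<^sup>2 \<le> ereal ((h (\<alpha> t) (\<beta> t))\<^sup>2 * (deriv \<alpha> t)\<^sup>2)"]
      directed_at_iff(2)[OF assms(1)] assms(1)
    unfolding causal_curve_def future_directed_def by blast
qed

lemma chronological_rel_iff:
  "chronological_rel h I X d p q \<longleftrightarrow>
     (\<exists>a b \<alpha> \<beta>. a < b \<and> curve a b \<alpha> \<beta> \<and> directed (<) a b \<alpha> \<beta> \<and>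
        (\<alpha> a, \<beta> a) = p \<and> (\<alpha> b, \<beta> b) = q)"
proof -
  have "a < b \<and> future_directed I X d a b \<alpha> \<beta> \<and> timelike_curve h I X d a b \<alpha> \<beta> \<and> E \<longleftrightarrow>
      a < b \<and> curve a b \<alpha> \<beta> \<and> directed (<) a b \<alpha> \<beta> \<and> E"
    for a b \<alpha> \<beta> E
    using curve_rel_iff(1)[of a b \<alpha> \<beta>] future_directed_def[of I X d a b \<alpha> \<beta>] by blast
  then show ?thesis unfolding chronological_rel_def by (simp only:)
qed

lemma causal_rel_iff:
  "causal_rel h I X d p q \<longleftrightarrow> p = q \<or>
     (\<exists>a b \<alpha> \<beta>. a < b \<and> curve a b \<alpha> \<beta> \<and> directed (\<le>) a b \<alpha> \<beta> \<and>
        (\<alpha> a, \<beta> a) = p \<and> (\<alpha> b, \<beta> b) = q)"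
proof -
  have "a < b \<and> future_directed I X d a b \<alpha> \<beta> \<and> causal_curve h I X d a b \<alpha> \<beta> \<and> E \<longleftrightarrow>
      a < b \<and> curve a b \<alpha> \<beta> \<and> directed (\<le>) a b \<alpha> \<beta> \<and> E"
    for a b \<alpha> \<beta> E
    using curve_rel_iff(2)[of a b \<alpha> \<beta>] future_directed_def[of I X d a b \<alpha> \<beta>] by blast
  then show ?thesis unfolding causal_rel_def by (simp only:)
qed

text \<open>Only the junction \<open>b1\<close> escapes the germ conditions, and it is a null set.\<close>

lemma concatenate_curves:
  assumes "a1 < b1" "curve a1 b1 \<alpha>1 \<beta>1" and d1: "directed R1 a1 b1 \<alpha>1 \<beta>1"
    and "a2 < b2" "curve a2 b2 \<alpha>2 \<beta>2" and d2: "directed R2 a2 b2 \<alpha>2 \<beta>2"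
    and match: "\<alpha>1 b1 = \<alpha>2 a2" "\<beta>1 b1 = \<beta>2 a2"
  shows "\<exists>e \<alpha> \<beta>. b1 < e \<and> curve a1 e \<alpha> \<beta> \<and>
      directed R1 a1 b1 \<alpha> \<beta> \<and>
      directed R2 b1 e \<alpha> \<beta> \<and>
      \<alpha> a1 = \<alpha>1 a1 \<and> \<beta> a1 = \<beta>1 a1 \<and> \<alpha> e = \<alpha>2 b2 \<and> \<beta> e = \<beta>2 b2"
proof -
  define k where "k = b1 - a2"
  define e where "e = b2 + k"
  define \<alpha> where "\<alpha> t = (if t \<le> b1 then \<alpha>1 t else \<alpha>2 (t - k))" for t
  define \<beta> where "\<beta> t = (if t \<le> b1 then \<beta>1 t else \<beta>2 (t - k))" for t
  have e: "b1 < e" using assms(4) by (simp add: e_def k_def)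
  have a2k: "a2 + k = b1" by (simp add: k_def)
  have right: "\<alpha> t = \<alpha>2 (t - k)" "\<beta> t = \<beta>2 (t - k)" if "t \<ge> b1" for t
    using that match by (auto simp: \<alpha>_def \<beta>_def k_def)
  have left: "\<alpha> t = \<alpha>1 t" "\<beta> t = \<beta>1 t" if "t \<le> b1" for t
    using that by (auto simp: \<alpha>_def \<beta>_def)
  have in2: "t - k \<in> {a2..b2}" if "b1 \<le> t" "t \<le> e" for t using that by (auto simp: e_def k_def)
  have \<alpha>I: "\<alpha> t \<in> I" "\<beta> t \<in> topspace X" if "t \<in> {a1..e}" for t
    using that left[of t] right[of t] curveD(1,2)[OF assms(2), of t] curveD(1,2)[OF assms(5), of "t - k"] in2[of t]
    by (cases "t \<le> b1"; simp)+
  have join: "abs_continuous_curve \<rho> a1 e c"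
    if M: "Metric_space M \<rho>" and c: "c ` {a1..e} \<subseteq> M"
      and c1: "abs_continuous_curve \<rho> a1 b1 c1" and c2: "abs_continuous_curve \<rho> a2 b2 c2"
      and cl: "\<And>t. t \<le> b1 \<Longrightarrow> c t = c1 t" and cr: "\<And>t. t \<ge> b1 \<Longrightarrow> c t = c2 (t - k)"
    for M :: "'c set" and \<rho> c c1 c2
  proof (rule abs_continuous_curve_join[OF M c, of b1])
    show "abs_continuous_curve \<rho> a1 b1 c" by (rule abs_continuous_curve_cong[OF c1]) (simp add: cl)
    have "abs_continuous_curve \<rho> b1 e (\<lambda>t. c2 (t - k))"
      using abs_continuous_curve_shift[OF c2, of k] by (simp add: e_def k_def)
    then show "abs_continuous_curve \<rho> b1 e c" by (rule abs_continuous_curve_cong) (simp add: cr)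
  qed (use assms(1) e in auto)
  have "Metric_space (UNIV :: real set) dist"
    by unfold_locales (auto simp: dist_commute dist_triangle)
  then have "abs_continuous_curve dist a1 e \<alpha>"
    using curveD(4)[OF assms(2)] curveD(4)[OF assms(5)] left(1) right(1) by (intro join) auto
  moreover have "abs_continuous_curve (d s) a1 e \<beta>" if "s \<in> I" for s
    using curveD(5)[OF assms(2) that] curveD(5)[OF assms(5) that] left(2) right(2) \<alpha>I(2) metric[OF that]
    by (intro join[of "topspace X"]) auto
  ultimately have "curve a1 e \<alpha> \<beta>"
    using \<alpha>I by (auto simp: abs_continuous_in_product_def)
  moreover have "directed R1 a1 b1 \<alpha> \<beta>"
  proof (rule negligible_subset)
    show "negligible ({t\<in>{a1..b1}. \<not> directed_at h d R1 \<alpha>1 \<beta>1 t} \<union> {b1})" using d1 by (simp add: negligible_Un_eq)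
    show "{t\<in>{a1..b1}. \<not> directed_at h d R1 \<alpha> \<beta> t} \<subseteq> {t\<in>{a1..b1}. \<not> directed_at h d R1 \<alpha>1 \<beta>1 t} \<union> {b1}"
      using directed_at_cong[of h d R1 \<alpha>1 \<beta>1 _ "{..<b1}" \<alpha> \<beta>] left by force
  qed
  moreover have "directed R2 b1 e \<alpha> \<beta>"
  proof (rule negligible_subset)
    show "negligible ((+) k ` {t\<in>{a2..b2}. \<not> directed_at h d R2 \<alpha>2 \<beta>2 t} \<union> {b1})"
      using negligible_translation[OF d2, of k] by (simp add: negligible_Un_eq)
    show "{t\<in>{b1..e}. \<not> directed_at h d R2 \<alpha> \<beta> t} \<subseteq>
        (+) k ` {t\<in>{a2..b2}. \<not> directed_at h d R2 \<alpha>2 \<beta>2 t} \<union> {b1}"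
    proof (rule subsetI, rule ccontr)
      fix t assume t: "t \<in> {t\<in>{b1..e}. \<not> directed_at h d R2 \<alpha> \<beta> t}"
        and nt: "t \<notin> (+) k ` {t\<in>{a2..b2}. \<not> directed_at h d R2 \<alpha>2 \<beta>2 t} \<union> {b1}"
      then have "b1 < t" by auto
      have "t = k + (t - k)" by simp
      then have "t - k \<notin> {t\<in>{a2..b2}. \<not> directed_at h d R2 \<alpha>2 \<beta>2 t}" using nt by blast
      then have "directed_at h d R2 \<alpha>2 \<beta>2 (t - k)" using in2[of t] t by auto
      then have "directed_at h d R2 (\<lambda>t. \<alpha>2 (t - k)) (\<lambda>t. \<beta>2 (t - k)) t" by (rule directed_at_shift)
      then have "directed_at h d R2 \<alpha> \<beta> t"
        by (rule directed_at_cong[of _ _ _ _ _ _ "{b1<..}"]) (use \<open>b1 < t\<close> right in auto)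
      then show False using t by simp
    qed
  qed
  moreover have "\<alpha> a1 = \<alpha>1 a1" "\<beta> a1 = \<beta>1 a1" using left assms(1) by auto
  moreover have "\<alpha> e = \<alpha>2 b2" "\<beta> e = \<beta>2 b2" using right[of e] e by (auto simp: e_def)
  ultimately show ?thesis using e by blast
qed

end

section \<open>Uniform slack on a compact set of positive measure\<close>

text \<open>The sets \<open>A j\<close> on which \<open>\<Theta> n \<ge> 1 / (j + 1)\<close> for all \<open>n \<ge> N0 + j\<close> are closed by continuity and cover
  almost all of \<open>[p, q]\<close>, so one of them is not a null set. This yields a compact set directly,
  without measurability considerations for the limit.\<close>

lemma compact_set_of_lower_bound:
  fixes \<Theta> :: "nat \<Rightarrow> real \<Rightarrow> real"
  assumes "p < q" and cont: "\<And>n. N0 \<le> n \<Longrightarrow> continuous_on {p..q} (\<Theta> n)"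
    and ae: "negligible {t\<in>{p..q}. \<not> (\<exists>\<theta>>0. (\<lambda>n. \<Theta> n t) \<longlonglongrightarrow> \<theta>)}"
  shows "\<exists>K \<eta>. compact K \<and> K \<subseteq> {p..q} \<and> \<not> negligible K \<and> 0 < \<eta> \<and>
    (\<forall>t\<in>K. \<forall>\<theta>. (\<lambda>n. \<Theta> n t) \<longlonglongrightarrow> \<theta> \<longrightarrow> \<eta> \<le> \<theta>)"
proof -
  define A where "A j = {p..q} \<inter> (\<Inter>n\<in>{N0 + j..}. {t\<in>{p..q}. inverse (real (Suc j)) \<le> \<Theta> n t})" for j
  have "closed {t\<in>{p..q}. inverse (real (Suc j)) \<le> \<Theta> n t}" if "N0 + j \<le> n" for n j
    using cont[of n] that by (intro continuous_on_closed_Collect_le continuous_intros) auto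
  then have "closed (A j)" for j unfolding A_def by (intro closed_Int closed_INT) auto
  then have comp: "compact (A j)" for j
    using compact_Int_closed[of "{p..q}" "A j"] by (simp add: A_def Int_absorb1 Int_assoc[symmetric])
  have "\<exists>j. \<not> negligible (A j)"
  proof (rule ccontr)
    assume "\<nexists>j. \<not> negligible (A j)"
    then have "negligible (\<Union>j. A j)" by (intro negligible_countable_Union) auto
    then have "negligible ((\<Union>j. A j) \<union> {t\<in>{p..q}. \<not> (\<exists>\<theta>>0. (\<lambda>n. \<Theta> n t) \<longlonglongrightarrow> \<theta>)})"
      using ae by (simp add: negligible_Un_eq)
    moreover have "{p..q} \<subseteq> (\<Union>j. A j) \<union> {t\<in>{p..q}. \<not> (\<exists>\<theta>>0. (\<lambda>n. \<Theta> n t) \<longlonglongrightarrow> \<theta>)}"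
    proof (rule subsetI)
      fix t assume t: "t \<in> {p..q}"
      show "t \<in> (\<Union>j. A j) \<union> {t\<in>{p..q}. \<not> (\<exists>\<theta>>0. (\<lambda>n. \<Theta> n t) \<longlonglongrightarrow> \<theta>)}"
      proof (cases "\<exists>\<theta>>0. (\<lambda>n. \<Theta> n t) \<longlonglongrightarrow> \<theta>")
        case True
        then obtain \<theta> where \<theta>: "\<theta> > 0" "(\<lambda>n. \<Theta> n t) \<longlonglongrightarrow> \<theta>" by blast
        then have "\<forall>\<^sub>F n in sequentially. \<theta> / 2 < \<Theta> n t" by (intro order_tendstoD) auto
        then obtain N where N: "\<forall>n\<ge>N. \<theta> / 2 < \<Theta> n t" by (auto simp: eventually_sequentially)
        obtain j0 where j0: "inverse (real (Suc j0)) < \<theta> / 2" using reals_Archimedean[of "\<theta>/2"] \<theta>(1) by auto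
        define j where "j = max j0 N"
        have jle: "inverse (real (Suc j)) \<le> inverse (real (Suc j0))"
          by (intro le_imp_inverse_le) (auto simp: j_def)
        have "inverse (real (Suc j)) \<le> \<Theta> n t" if "n \<ge> N0 + j" for n
        proof -
          have "\<theta> / 2 < \<Theta> n t" using N that by (simp add: j_def)
          then show ?thesis using jle j0 by linarith
        qed
        then have "t \<in> A j" using t by (auto simp: A_def)
        then show ?thesis by blast
      qed (use t in blast)
    qed
    ultimately have "negligible {p..q}" by (rule negligible_subset)
    then show False using \<open>p < q\<close> negligible_interval(1)[of p q] by simp
  qed
  then obtain j where j: "\<not> negligible (A j)" by blast
  have "inverse (real (Suc j)) \<le> \<theta>" if "t \<in> A j" "(\<lambda>n. \<Theta> n t) \<longlonglongrightarrow> \<theta>" for t \<theta>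
    using that(2) by (rule tendsto_lowerbound) (use that(1) in \<open>auto simp: A_def eventually_sequentially\<close>)
  then show ?thesis using comp[of j] j
    by (intro exI[of _ "A j"] exI[of _ "inverse (real (Suc j))"]) (auto simp: A_def)
qed

context generalized_product
begin

text \<open>The metric and the points vary simultaneously with \<open>t\<close>. Continuity in the points is the triangle
  inequality for the fixed metric \<open>d (\<alpha> t0)\<close>; the change of the metric costs a factor that tends
  to \<open>1\<close>, because the points \<open>\<beta> (t + \<delta>)\<close> and \<open>\<beta> t\<close> are close enough to be comparable.\<close>

lemma continuous_displacement:
  assumes cv: "curve a b \<alpha> \<beta>"
    and Cmp: "comparable_with C \<rho> J d a b \<beta>"
    and J: "\<alpha> ` {a..b} \<subseteq> J" and pq: "a \<le> p" "q + \<delta> \<le> b" and \<delta>: "0 < \<delta>" "\<delta> < \<rho>"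
  shows "continuous_on {p..q} (\<lambda>t. d (\<alpha> t) (\<beta> (t + \<delta>)) (\<beta> t))"
  unfolding continuous_on_def
proof
  fix t0 assume t0: "t0 \<in> {p..q}"
  let ?F = "at t0 within {p..q}"
  define s0 where "s0 = \<alpha> t0"
  have ab: "t \<in> {a..b}" "t + \<delta> \<in> {a..b}" if "t \<in> {p..q}" for t using that pq \<delta> by auto
  have s0: "s0 \<in> I" "s0 \<in> J" using curveD(1)[OF cv ab(1)[OF t0]] J ab(1)[OF t0] by (auto simp: s0_def)
  interpret Metric_space "topspace X" "d s0" using metric[OF s0(1)] .
  have \<beta>: "\<beta> t \<in> topspace X" "\<beta> (t + \<delta>) \<in> topspace X" if "t \<in> {p..q}" for t
    using curveD(2)[OF cv] ab[OF that] by auto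
  have lim0: "((\<lambda>t. d s0 (\<beta> (t + \<delta>)) (\<beta> t)) \<longlongrightarrow> d s0 (\<beta> (t0 + \<delta>)) (\<beta> t0)) ?F"
  proof (rule tendstoI)
    fix e :: real assume "e > 0"
    then have "e / 2 > 0" by simp
    then obtain \<delta>' where "\<delta>' > 0" and \<delta>': "\<forall>x y. a \<le> x \<and> x \<le> y \<and> y \<le> b \<and> y - x < \<delta>' \<longrightarrow> d s0 (\<beta> x) (\<beta> y) < e / 2"
      using abs_continuous_curve_uniform[OF curveD(5)[OF cv s0(1)]] by blast
    have near: "d s0 (\<beta> x) (\<beta> y) < e / 2" if "x \<in> {a..b}" "y \<in> {a..b}" "\<bar>x - y\<bar> < \<delta>'" for x y
      using \<delta>'[rule_format, of x y] \<delta>'[rule_format, of y x] that commute[of "\<beta> x" "\<beta> y"]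
      by (cases "x \<le> y") auto
    have "\<forall>\<^sub>F t in ?F. t \<in> {p..q} \<and> \<bar>t - t0\<bar> < \<delta>'"
      unfolding eventually_at using \<open>\<delta>' > 0\<close> by (intro exI[of _ \<delta>']) (auto simp: dist_real_def)
    then show "\<forall>\<^sub>F t in ?F. dist (d s0 (\<beta> (t + \<delta>)) (\<beta> t)) (d s0 (\<beta> (t0 + \<delta>)) (\<beta> t0)) < e"
    proof eventually_elim
      case (elim t)
      then have t: "t \<in> {p..q}" by simp
      have n: "d s0 (\<beta> (t + \<delta>)) (\<beta> (t0 + \<delta>)) < e / 2" "d s0 (\<beta> t) (\<beta> t0) < e / 2"
        by (intro near; use elim ab[OF t] ab[OF t0] in simp)+
      have 1: "d s0 (\<beta> (t + \<delta>)) (\<beta> t) \<le> d s0 (\<beta> (t + \<delta>)) (\<beta> (t0 + \<delta>)) + d s0 (\<beta> (t0 + \<delta>)) (\<beta> t)"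
        "d s0 (\<beta> (t0 + \<delta>)) (\<beta> t) \<le> d s0 (\<beta> (t0 + \<delta>)) (\<beta> t0) + d s0 (\<beta> t0) (\<beta> t)"
        using \<beta>[OF t] \<beta>[OF t0] by (auto intro!: triangle)
      have 2: "d s0 (\<beta> (t0 + \<delta>)) (\<beta> t0) \<le> d s0 (\<beta> (t0 + \<delta>)) (\<beta> (t + \<delta>)) + d s0 (\<beta> (t + \<delta>)) (\<beta> t0)"
        "d s0 (\<beta> (t + \<delta>)) (\<beta> t0) \<le> d s0 (\<beta> (t + \<delta>)) (\<beta> t) + d s0 (\<beta> t) (\<beta> t0)"
        using \<beta>[OF t] \<beta>[OF t0] by (auto intro!: triangle)
      show ?case
        using n 1 2 commute[of "\<beta> (t + \<delta>)" "\<beta> (t0 + \<delta>)"] commute[of "\<beta> t" "\<beta> t0"]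
        unfolding dist_real_def by linarith
    qed
  qed
  have "(\<alpha> \<longlongrightarrow> s0) ?F"
  proof -
    have "continuous_on {p..q} \<alpha>"
      using abs_continuous_curve_continuous[OF curveD(4)[OF cv]] by (rule continuous_on_subset) (use ab in auto)
    then show ?thesis using t0 by (simp add: continuous_on_def s0_def)
  qed
  then have e: "((\<lambda>t. \<bar>\<alpha> t - s0\<bar>) \<longlongrightarrow> 0) ?F" by (simp add: LIM_zero tendsto_rabs_zero)
  have up: "((\<lambda>t. exp (C * \<bar>\<alpha> t - s0\<bar>) * d s0 (\<beta> (t + \<delta>)) (\<beta> t)) \<longlongrightarrow> exp (C * 0) * d s0 (\<beta> (t0 + \<delta>)) (\<beta> t0)) ?F"
    by (intro tendsto_intros e lim0)
  have lo: "((\<lambda>t. exp (- (C * \<bar>\<alpha> t - s0\<bar>)) * d s0 (\<beta> (t + \<delta>)) (\<beta> t)) \<longlongrightarrow> exp (- (C * 0)) * d s0 (\<beta> (t0 + \<delta>)) (\<beta> t0)) ?F"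
    by (intro tendsto_intros e lim0)
  have ev: "\<forall>\<^sub>F t in ?F. t \<in> {p..q}" by (simp add: eventually_at_filter)
  show "((\<lambda>t. d (\<alpha> t) (\<beta> (t + \<delta>)) (\<beta> t)) \<longlongrightarrow> d (\<alpha> t0) (\<beta> (t0 + \<delta>)) (\<beta> t0)) ?F"
  proof (rule tendsto_sandwich)
    show "\<forall>\<^sub>F t in ?F. d (\<alpha> t) (\<beta> (t + \<delta>)) (\<beta> t) \<le> exp (C * \<bar>\<alpha> t - s0\<bar>) * d s0 (\<beta> (t + \<delta>)) (\<beta> t)"
      using ev
    proof eventually_elim
      case (elim t)
      show ?case by (rule comparable_withD[OF Cmp]) (use ab[OF elim] J s0 \<delta> in auto)
    qed
    show "\<forall>\<^sub>F t in ?F. exp (- (C * \<bar>\<alpha> t - s0\<bar>)) * d s0 (\<beta> (t + \<delta>)) (\<beta> t) \<le> d (\<alpha> t) (\<beta> (t + \<delta>)) (\<beta> t)"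
      using ev
    proof eventually_elim
      case (elim t)
      have "d s0 (\<beta> (t + \<delta>)) (\<beta> t) \<le> exp (C * \<bar>s0 - \<alpha> t\<bar>) * d (\<alpha> t) (\<beta> (t + \<delta>)) (\<beta> t)"
        by (rule comparable_withD[OF Cmp]) (use ab[OF elim] J s0 \<delta> in auto)
      then show ?case by (simp add: exp_minus field_simps abs_minus_commute)
    qed
  qed (use up lo in \<open>simp_all add: s0_def\<close>)
qed

lemma continuous_h_along:
  assumes cv: "curve a b \<alpha> \<beta>" "a \<le> b" and "J \<subseteq> I"
  shows "continuous_on (J \<times> {a..b}) (\<lambda>(s, t). h s (\<beta> t))"
proof -
  have "continuous_map (prod_topology (top_of_set J) (top_of_set {a..b})) (prod_topology (top_of_set I) X)
      (\<lambda>(s, t). (s, \<beta> t))"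
    unfolding continuous_map_prod_top
    using continuous_map_space_component[OF cv] \<open>J \<subseteq> I\<close> by auto
  from continuous_map_compose[OF this h_continuous]
  have "continuous_map (top_of_set (J \<times> {a..b})) euclideanreal (\<lambda>(s, t). h s (\<beta> t))"
    by (simp add: prod_topology_subtopology_eu o_def case_prod_unfold)
  then show ?thesis by simp
qed

text \<open>The continuous difference quotients \<open>\<Theta> n\<close> converge to \<open>h (\<alpha> t) (\<beta> t) * D - v\<close>, which is positive
  where the curve is timelike.\<close>

lemma compact_set_with_slack:
  assumes cv: "curve a b \<alpha> \<beta>" and pq: "a \<le> p" "p < q" "q < b"
    and tl: "directed (<) p q \<alpha> \<beta>"
  shows "\<exists>K \<eta>. compact K \<and> K \<subseteq> {p..q} \<and> \<not> negligible K \<and> 0 < \<eta> \<and>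
    (\<forall>t\<in>K. \<forall>D v. (\<alpha> has_real_derivative D) (at t) \<longrightarrow> has_speed d \<beta> (\<alpha> t) t v \<longrightarrow>
       v + \<eta> \<le> h (\<alpha> t) (\<beta> t) * D)"
proof -
  have "a \<le> b" using pq by simp
  define J where "J = \<alpha> ` {a..b}"
  have \<alpha>_cont: "continuous_on {a..b} \<alpha>" using abs_continuous_curve_continuous[OF curveD(4)[OF cv]] .
  have J: "compact J" "J \<subseteq> I" unfolding J_def
    using compact_continuous_image[OF \<alpha>_cont] curveD(1)[OF cv] by auto
  obtain C \<rho> where "C \<ge> 0" "\<rho> > 0" and Cmp: "comparable_with C \<rho> J d a b \<beta>"
    using comparable[OF cv \<open>a \<le> b\<close> J] unfolding comparable_along_def by auto
  define \<delta> where "\<delta> n = inverse (real (Suc n))" for n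
  have \<delta>0: "0 < \<delta> n" for n by (simp add: \<delta>_def)
  have \<delta>lim: "\<delta> \<longlonglongrightarrow> 0" unfolding \<delta>_def[abs_def] by (rule LIMSEQ_inverse_real_of_nat)
  then have "\<forall>\<^sub>F n in sequentially. \<delta> n < min \<rho> (b - q)"
    using \<open>\<rho> > 0\<close> pq by (intro order_tendstoD) auto
  then obtain N0 where N0: "\<And>n. n \<ge> N0 \<Longrightarrow> \<delta> n < min \<rho> (b - q)" by (auto simp: eventually_sequentially)
  define \<Theta> where "\<Theta> n t = h (\<alpha> t) (\<beta> t) * ((\<alpha> (t + \<delta> n) - \<alpha> t) / \<delta> n) - d (\<alpha> t) (\<beta> (t + \<delta> n)) (\<beta> t) / \<delta> n" for n t
  have lim: "(\<lambda>n. \<Theta> n t) \<longlonglongrightarrow> h (\<alpha> t) (\<beta> t) * D - v"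
    if D: "(\<alpha> has_real_derivative D) (at t)" and v: "has_speed d \<beta> (\<alpha> t) t v" for t D v
  proof -
    have "filterlim \<delta> (at 0) sequentially"
      using \<delta>lim \<delta>0 by (intro filterlim_atI) (auto simp: less_imp_neq[symmetric])
    from filterlim_compose[OF D[unfolded DERIV_def] this]
    have 1: "(\<lambda>n. (\<alpha> (t + \<delta> n) - \<alpha> t) / \<delta> n) \<longlonglongrightarrow> D" .
    have "filterlim (\<lambda>n. t + \<delta> n) (at t) sequentially"
      using tendsto_add[OF tendsto_const \<delta>lim, of t] \<delta>0
      by (intro filterlim_atI) (auto simp: less_imp_neq[symmetric])
    from filterlim_compose[OF v[unfolded has_speed_def] this]
    have 2: "(\<lambda>n. d (\<alpha> t) (\<beta> (t + \<delta> n)) (\<beta> t) / \<delta> n) \<longlonglongrightarrow> v"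
      using \<delta>0 by (simp add: less_imp_le)
    show ?thesis unfolding \<Theta>_def by (intro tendsto_intros 1 2)
  qed
  have cont: "continuous_on {p..q} (\<Theta> n)" if n: "N0 \<le> n" for n
  proof -
    have "continuous_on {p..q} (\<lambda>t. h (\<alpha> t) (\<beta> t))"
    proof -
      have "continuous_on {p..q} (\<lambda>t. (\<alpha> t, t))"
        using pq by (intro continuous_intros continuous_on_subset[OF \<alpha>_cont]) auto
      then have "continuous_on {p..q} ((\<lambda>(s, t). h s (\<beta> t)) \<circ> (\<lambda>t. (\<alpha> t, t)))"
        by (rule continuous_on_compose)
          (rule continuous_on_subset[OF continuous_h_along[OF cv \<open>a \<le> b\<close> J(2)]], use pq in \<open>auto simp: J_def\<close>)
      then show ?thesis by (simp add: o_def)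
    qed
    moreover have "continuous_on {p..q} (\<lambda>t. \<alpha> (t + \<delta> n))"
      by (rule continuous_on_compose2[OF \<alpha>_cont]) (use pq N0[OF n] \<delta>0[of n] in \<open>auto intro!: continuous_intros\<close>)
    moreover have "continuous_on {p..q} \<alpha>" using pq by (intro continuous_on_subset[OF \<alpha>_cont]) auto
    moreover have "continuous_on {p..q} (\<lambda>t. d (\<alpha> t) (\<beta> (t + \<delta> n)) (\<beta> t))"
      using N0[OF n] \<delta>0[of n] pq by (intro continuous_displacement[OF cv Cmp]) (auto simp: J_def)
    ultimately show ?thesis
      unfolding \<Theta>_def using \<delta>0[of n] by (intro continuous_intros) auto
  qed
  have "negligible {t\<in>{p..q}. \<not> (\<exists>\<theta>>0. (\<lambda>n. \<Theta> n t) \<longlonglongrightarrow> \<theta>)}"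
  proof (rule negligible_subset[OF tl], rule subsetI, rule ccontr)
    fix t assume t: "t \<in> {t\<in>{p..q}. \<not> (\<exists>\<theta>>0. (\<lambda>n. \<Theta> n t) \<longlonglongrightarrow> \<theta>)}"
      and "t \<notin> {t\<in>{p..q}. \<not> directed_at h d (<) \<alpha> \<beta> t}"
    then have "directed_at h d (<) \<alpha> \<beta> t" by simp
    then obtain D v where "(\<alpha> has_real_derivative D) (at t)" "has_speed d \<beta> (\<alpha> t) t v" "v < h (\<alpha> t) (\<beta> t) * D"
      unfolding directed_at_def by blast
    then have "(\<lambda>n. \<Theta> n t) \<longlonglongrightarrow> h (\<alpha> t) (\<beta> t) * D - v" "0 < h (\<alpha> t) (\<beta> t) * D - v"
      using lim by auto
    with t show False by blast
  qed
  with pq(2) cont have "\<exists>K \<eta>. compact K \<and> K \<subseteq> {p..q} \<and> \<not> negligible K \<and> 0 < \<eta> \<and>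
      (\<forall>t\<in>K. \<forall>\<theta>. (\<lambda>n. \<Theta> n t) \<longlonglongrightarrow> \<theta> \<longrightarrow> \<eta> \<le> \<theta>)"
    by (rule compact_set_of_lower_bound)
  then obtain K \<eta> where K: "compact K" "K \<subseteq> {p..q}" "\<not> negligible K" "0 < \<eta>"
    and \<eta>: "\<forall>t\<in>K. \<forall>\<theta>. (\<lambda>n. \<Theta> n t) \<longlonglongrightarrow> \<theta> \<longrightarrow> \<eta> \<le> \<theta>" by blast
  have "v + \<eta> \<le> h (\<alpha> t) (\<beta> t) * D"
    if "t \<in> K" "(\<alpha> has_real_derivative D) (at t)" "has_speed d \<beta> (\<alpha> t) t v" for t D v
    using \<eta> that(1) lim[OF that(2,3)] by fastforce
  with K show ?thesis by blast
qed

end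

section \<open>Perturbation of the time component\<close>

lemma tanh_lipschitz: "\<bar>tanh x - tanh (y::real)\<bar> \<le> \<bar>x - y\<bar>"
proof -
  have "norm (tanh x - tanh y) \<le> 1 * norm (x - y)"
  proof (rule field_differentiable_bound[of UNIV tanh "\<lambda>z. 1 - (tanh z)\<^sup>2"])
    show "(tanh has_field_derivative 1 - (tanh z)\<^sup>2) (at z within UNIV)" for z :: real
      by (auto intro!: derivative_eq_intros)
    have "(tanh z)\<^sup>2 \<le> 1" for z :: real
      using tanh_real_lt_1[of z] tanh_real_gt_neg1[of z] by (simp add: abs_square_le_1 abs_le_iff)
    then show "norm (1 - (tanh z)\<^sup>2) \<le> 1" for z :: real by simp
  qed auto
  then show ?thesis by simp
qed

lemma exp_le_linear: "0 \<le> y \<Longrightarrow> y \<le> 1 \<Longrightarrow> exp y \<le> 1 + 2 * (y::real)"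
proof -
  assume y: "0 \<le> y" "y \<le> 1"
  have "y\<^sup>2 \<le> y" using y by (simp add: power2_eq_square mult_left_le)
  then show ?thesis using exp_bound[OF y] by simp
qed

text \<open>The function \<open>m\<close> measures the part of \<open>K\<close> that has been passed. Its derivative is the indicator of
  \<open>K\<close>, by Lebesgue differentiation.\<close>

lemma occupation_integral:
  fixes a b p q :: real
  assumes K: "compact K" "K \<subseteq> {p..q}" "\<not> negligible K" and pq: "a \<le> p" "p < q" "q \<le> b"
  defines "m \<equiv> \<lambda>t. integral {a..t} (indicator K :: real \<Rightarrow> real)"
  shows "(indicator K :: real \<Rightarrow> real) integrable_on {a..b}"
    and "\<And>s t. a \<le> s \<Longrightarrow> s \<le> t \<Longrightarrow> t \<le> b \<Longrightarrow> m s \<le> m t \<and> m t - m s \<le> t - s"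
    and "\<And>t. a \<le> t \<Longrightarrow> t < p \<Longrightarrow> m t = 0" and "m a = 0"
    and "\<And>t. q < t \<Longrightarrow> t \<le> b \<Longrightarrow> m t = m b" and "0 < m b"
proof -
  have "K \<in> lmeasurable" using K(1) by (rule lmeasurable_compact)
  have abK: "{a..b} \<inter> K = K" using K(2) pq by auto
  show int: "(indicator K :: real \<Rightarrow> real) integrable_on {a..b}"
    using \<open>K \<in> lmeasurable\<close> abK by (simp add: integrable_on_indicator Int_commute)
  have comb: "m t - m s = integral {s..t} (indicator K)" if "a \<le> s" "s \<le> t" "t \<le> b" for s t
    unfolding m_def using int that by (rule integral_subinterval_diff)
  show "m s \<le> m t \<and> m t - m s \<le> t - s" if st: "a \<le> s" "s \<le> t" "t \<le> b" for s t
  proof -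
    have i: "(indicator K :: real \<Rightarrow> real) integrable_on {s..t}"
      using st by (intro integrable_on_subinterval[OF int]) auto
    have "0 \<le> (integral {s..t} (indicator K) :: real)"
      using i by (rule integral_nonneg) simp
    moreover have "(integral {s..t} (indicator K) :: real) \<le> integral {s..t} (\<lambda>_. 1)"
      using i by (rule integral_le) (auto simp: indicator_def)
    ultimately show ?thesis using comb[OF st] st by simp
  qed
  show "m t = 0" if "a \<le> t" "t < p" for t
  proof -
    have "m t = integral {a..t} (\<lambda>_. 0 :: real)"
      unfolding m_def by (rule integral_cong) (use K(2) that in \<open>auto simp: indicator_def\<close>)
    then show ?thesis by simp
  qed
  show "m a = 0" by (simp add: m_def)
  show "m t = m b" if "q < t" "t \<le> b" for t
  proof -
    have "m b - m t = integral {t..b} (indicator K)" using that pq by (intro comb) auto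
    also have "\<dots> = integral {t..b} (\<lambda>_. 0 :: real)"
      by (rule integral_cong) (use K(2) that in \<open>auto simp: indicator_def\<close>)
    finally show ?thesis by simp
  qed
  have "m b = measure lebesgue K"
    unfolding m_def using \<open>K \<in> lmeasurable\<close> abK by (simp add: integral_indicator Int_commute)
  also have "\<dots> > 0"
    using K(3) negligible_iff_measure[of K] \<open>K \<in> lmeasurable\<close> by (simp add: zero_less_measure_iff)
  finally show "0 < m b" .
qed

text \<open>Besides a loss of \<open>\<kappa>\<close> on \<open>K\<close>, the function \<open>\<phi>\<close> grows with \<open>\<alpha>\<close> at a rate above \<open>L * \<bar>\<phi> t\<bar>\<close>.\<close>

definition bends_at ::
  "real \<Rightarrow> real \<Rightarrow> real set \<Rightarrow> (real \<Rightarrow> real) \<Rightarrow> (real \<Rightarrow> real) \<Rightarrow> real \<Rightarrow> bool" where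
  "bends_at L \<kappa> K \<alpha> \<phi> t \<longleftrightarrow>
     (\<forall>D. (\<alpha> has_real_derivative D) (at t) \<longrightarrow>
        (\<exists>g. L * \<bar>\<phi> t\<bar> < g \<and> (\<phi> has_real_derivative g * D - \<kappa> * indicator K t) (at t)))"

text \<open>The function \<open>\<phi>\<close> by which the time component will be bent. Its derivative has a positive part
  that dominates the size of \<open>\<phi>\<close>, and \<open>\<phi>\<close> returns to \<open>0\<close> only by means of the term supported in \<open>K\<close>. The
  hypothesis \<open>near\<close> makes \<open>\<alpha>\<close> vary so little around \<open>K\<close> that the domination survives the sign
  change of \<open>\<phi>\<close> there.\<close>

lemma bending_function:
  fixes \<alpha> :: "real \<Rightarrow> real"
  assumes mono: "\<And>s t. a \<le> s \<Longrightarrow> s \<le> t \<Longrightarrow> t \<le> b \<Longrightarrow> \<alpha> s \<le> \<alpha> t" and L: "L > 0"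
    and pq: "a \<le> p" "p < q" "q \<le> b"
    and K: "compact K" "K \<subseteq> {p..q}" "\<not> negligible K"
    and near: "\<And>t. t \<in> {p..q} \<Longrightarrow> \<bar>\<alpha> t - \<alpha> p\<bar> \<le> 1 / (8 * L)"
  shows "\<exists>\<phi> \<kappa> M. \<phi> a = 0 \<and> \<phi> b = 0 \<and> 0 \<le> \<kappa> \<and> 0 \<le> M \<and> (\<forall>t\<in>{a..b}. \<bar>\<phi> t\<bar> < 2) \<and>
    (\<forall>s t. a \<le> s \<longrightarrow> s \<le> t \<longrightarrow> t \<le> b \<longrightarrow> \<bar>\<phi> s - \<phi> t\<bar> \<le> M * \<bar>\<alpha> s - \<alpha> t\<bar> + M * (t - s)) \<and>
    negligible {t\<in>{a..b}. \<not> bends_at L \<kappa> K \<alpha> \<phi> t}"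
proof -
  have ab: "a \<le> b" using pq by simp
  \<comment> \<open>\<open>G\<close> solves \<open>G' = 4 * L * (1 - G) * (1 + G)\<close>, so its slope dominates both the distance to its
    lower bound \<open>- 1\<close> (where \<open>G \<le> 1 / 2\<close>) and the distance to its upper bound \<open>1\<close> (where
    \<open>G \<ge> - 1 / 2\<close>).\<close>
  define G where "G s = tanh (4 * L * (s - \<alpha> p))" for s
  have G1: "-1 < G s" "G s < 1" for s using tanh_real_lt_1 tanh_real_gt_neg1 by (auto simp: G_def)
  have Gmono: "G s \<le> G t" if "s \<le> t" for s t using that L by (simp add: G_def mult_left_mono)
  have Glip: "\<bar>G s - G t\<bar> \<le> 4 * L * \<bar>s - t\<bar>" for s t
  proof -
    have "\<bar>G s - G t\<bar> \<le> \<bar>4 * L * (s - \<alpha> p) - 4 * L * (t - \<alpha> p)\<bar>" unfolding G_def by (rule tanh_lipschitz)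
    also have "\<dots> = \<bar>(4 * L) * (s - t)\<bar>" by (simp add: algebra_simps)
    also have "\<dots> = 4 * L * \<bar>s - t\<bar>" using L by (simp add: abs_mult)
    finally show ?thesis .
  qed
  have Gder: "(G has_real_derivative 4 * L * (1 - (G s)\<^sup>2)) (at s)" for s
    unfolding G_def[abs_def] by (auto intro!: derivative_eq_intros)
  have G_half: "\<bar>G (\<alpha> t)\<bar> \<le> 1 / 2" if "t \<in> {p..q}" for t
  proof -
    have "4 * L * \<bar>\<alpha> t - \<alpha> p\<bar> \<le> 1 / 2" using near[OF that] L by (simp add: field_simps)
    moreover have "G (\<alpha> p) = 0" by (simp add: G_def)
    ultimately show ?thesis using Glip[of "\<alpha> t" "\<alpha> p"] by simp
  qed
  define m where "m t = integral {a..t} (indicator K :: real \<Rightarrow> real)" for t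
  note occ = occupation_integral[OF K pq, folded m_def]
  define \<kappa> where "\<kappa> = (G (\<alpha> b) - G (\<alpha> a)) / m b"
  have \<kappa>: "\<kappa> \<ge> 0" "\<kappa> * m b = G (\<alpha> b) - G (\<alpha> a)"
    using Gmono[OF mono[of a b]] occ(6) ab by (auto simp: \<kappa>_def)
  \<comment> \<open>\<open>\<kappa>\<close> is chosen such that \<open>\<phi>\<close> vanishes at \<open>b\<close>.\<close>
  define \<phi> where "\<phi> t = G (\<alpha> t) - G (\<alpha> a) - \<kappa> * m t" for t
  have Gab: "G (\<alpha> a) \<le> G (\<alpha> t)" "G (\<alpha> t) \<le> G (\<alpha> b)" if "t \<in> {a..b}" for t
    using that by (auto intro!: Gmono mono)
  have m_bounds: "0 \<le> \<kappa> * m t" "\<kappa> * m t \<le> \<kappa> * m b" if "t \<in> {a..b}" for t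
    using occ(2)[of a t] occ(2)[of t b] occ(4) that \<kappa>(1) by (auto intro!: mult_left_mono mult_nonneg_nonneg)
  have \<phi>2: "\<bar>\<phi> t\<bar> < 2" if "t \<in> {a..b}" for t
    using Gab[OF that] m_bounds[OF that] \<kappa>(2) G1[of "\<alpha> t"] G1[of "\<alpha> a"] G1[of "\<alpha> b"]
    unfolding \<phi>_def by linarith
  have key: "L * \<bar>\<phi> t\<bar> < 4 * L * (1 - (G (\<alpha> t))\<^sup>2)" if t: "t \<in> {a..b}" for t
  proof -
    let ?g = "G (\<alpha> t)"
    have fac: "1 - ?g\<^sup>2 = (1 - ?g) * (1 + ?g)" by (simp add: power2_eq_square algebra_simps)
    have "\<bar>\<phi> t\<bar> < 4 * (1 - ?g\<^sup>2)"
    proof -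
      \<comment> \<open>Before \<open>[p, q]\<close> nothing has been subtracted, after it everything; in between the crude
        bound \<open>2\<close> suffices as \<open>G (\<alpha> t)\<close> is small.\<close>
      consider "t < p" | "t \<in> {p..q}" | "q < t" by fastforce
      then show ?thesis
      proof cases
        case 1
        then have "\<phi> t = ?g - G (\<alpha> a)" using occ(3) t by (simp add: \<phi>_def)
        then have "\<bar>\<phi> t\<bar> < 1 + ?g" using Gab[OF t] G1[of "\<alpha> a"] by linarith
        moreover have "?g \<le> G (\<alpha> p)" using 1 t pq by (intro Gmono mono) auto
        then have "1 \<le> 4 * (1 - ?g)" using G_half[of p] pq by simp
        then have "1 * (1 + ?g) \<le> 4 * (1 - ?g) * (1 + ?g)" using G1[of "\<alpha> t"] by (intro mult_right_mono) auto
        then have "1 + ?g \<le> 4 * ((1 - ?g) * (1 + ?g))" by (simp only: mult.assoc mult_1_left)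
        ultimately show ?thesis unfolding fac by (rule less_le_trans)
      next
        case 2
        then have "?g\<^sup>2 \<le> (1 / 2)\<^sup>2" using G_half[OF 2] by (simp only: abs_le_square_iff[symmetric] abs_divide abs_one abs_numeral)
        then show ?thesis using \<phi>2[OF t] by (simp add: power2_eq_square)
      next
        case 3
        then have "\<phi> t = ?g - G (\<alpha> b)" using occ(5)[of t] t \<kappa>(2) by (simp add: \<phi>_def)
        then have "\<bar>\<phi> t\<bar> < 1 - ?g" using Gab[OF t] G1[of "\<alpha> b"] by linarith
        moreover have "G (\<alpha> q) \<le> ?g" using 3 t pq by (intro Gmono mono) auto
        then have "1 \<le> 4 * (1 + ?g)" using G_half[of q] pq by simp
        then have "1 * (1 - ?g) \<le> 4 * (1 + ?g) * (1 - ?g)" using G1[of "\<alpha> t"] by (intro mult_right_mono) auto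
        then have "1 - ?g \<le> 4 * ((1 - ?g) * (1 + ?g))"
          by (simp only: mult.assoc mult_1_left mult.commute[of "1 + ?g"])
        ultimately show ?thesis unfolding fac by (rule less_le_trans)
      qed
    qed
    then have "L * \<bar>\<phi> t\<bar> < L * (4 * (1 - ?g\<^sup>2))" using L by (intro mult_strict_left_mono)
    then show ?thesis by (simp add: mult_ac)
  qed
  have lip: "\<bar>\<phi> s - \<phi> t\<bar> \<le> (4 * L + \<kappa>) * \<bar>\<alpha> s - \<alpha> t\<bar> + (4 * L + \<kappa>) * (t - s)"
    if st: "a \<le> s" "s \<le> t" "t \<le> b" for s t
  proof -
    have "\<phi> s - \<phi> t = (G (\<alpha> s) - G (\<alpha> t)) + \<kappa> * (m t - m s)" by (simp add: \<phi>_def algebra_simps)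
    moreover have "\<bar>\<kappa> * (m t - m s)\<bar> \<le> \<kappa> * (t - s)"
      using occ(2)[OF st] \<kappa>(1) by (simp add: abs_mult mult_left_mono)
    moreover have "0 \<le> \<kappa> * \<bar>\<alpha> s - \<alpha> t\<bar>" "0 \<le> 4 * L * (t - s)" using \<kappa>(1) L st by auto
    ultimately show ?thesis using Glip[of "\<alpha> s" "\<alpha> t"] unfolding distrib_right by linarith
  qed
  have der: "negligible {t\<in>{a..b}. \<not> bends_at L \<kappa> K \<alpha> \<phi> t}"
  proof (rule negligible_subset)
    show "negligible {t\<in>{a..b}. \<not> (m has_real_derivative indicator K t) (at t)}"
      using lebesgue_differentiation[OF occ(1)] by (simp add: m_def[abs_def])
    show "{t\<in>{a..b}. \<not> bends_at L \<kappa> K \<alpha> \<phi> t} \<subseteq>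
        {t\<in>{a..b}. \<not> (m has_real_derivative indicator K t) (at t)}"
    proof (rule subsetI, rule ccontr)
      fix t assume t: "t \<in> {t\<in>{a..b}. \<not> bends_at L \<kappa> K \<alpha> \<phi> t}"
        and "t \<notin> {t\<in>{a..b}. \<not> (m has_real_derivative indicator K t) (at t)}"
      then have m': "(m has_real_derivative indicator K t) (at t)" and tab: "t \<in> {a..b}" by auto
      obtain D where D: "(\<alpha> has_real_derivative D) (at t)"
        and no: "\<nexists>g. L * \<bar>\<phi> t\<bar> < g \<and> (\<phi> has_real_derivative g * D - \<kappa> * indicator K t) (at t)"
        using t unfolding bends_at_def by blast
      have "((\<lambda>t. G (\<alpha> t)) has_real_derivative 4 * L * (1 - (G (\<alpha> t))\<^sup>2) * D) (at t)"
        using DERIV_chain2[OF Gder D] .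
      then have "(\<phi> has_real_derivative 4 * L * (1 - (G (\<alpha> t))\<^sup>2) * D - \<kappa> * indicator K t) (at t)"
        unfolding \<phi>_def[abs_def] using m' by (auto intro!: derivative_eq_intros)
      with no key[OF tab] show False by blast
    qed
  qed
  have "\<phi> a = 0" "\<phi> b = 0" using occ(4) \<kappa>(2) by (auto simp: \<phi>_def)
  then show ?thesis using \<kappa>(1) L \<phi>2 lip der
    by (intro exI[of _ \<phi>] exI[of _ \<kappa>] exI[of _ "4 * L + \<kappa>"] conjI) auto
qed

context generalized_product
begin

lemma h_bounds:
  assumes cv: "curve a b \<alpha> \<beta>" "a \<le> b" and J: "compact J" "J \<subseteq> I" "J \<noteq> {}"
  shows "\<exists>h0>0. \<exists>h1. \<forall>s\<in>J. \<forall>t\<in>{a..b}. h0 \<le> h s (\<beta> t) \<and> h s (\<beta> t) \<le> h1"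
proof -
  have comp: "compact (J \<times> {a..b})" "J \<times> {a..b} \<noteq> {}" using J cv(2) by (auto intro: compact_Times)
  note cont = continuous_h_along[OF cv J(2)]
  obtain z where z: "z \<in> J \<times> {a..b}" "\<forall>y\<in>J \<times> {a..b}. (\<lambda>(s, t). h s (\<beta> t)) z \<le> (\<lambda>(s, t). h s (\<beta> t)) y"
    using continuous_attains_inf[OF comp cont] by blast
  obtain w where w: "\<forall>y\<in>J \<times> {a..b}. (\<lambda>(s, t). h s (\<beta> t)) y \<le> (\<lambda>(s, t). h s (\<beta> t)) w"
    using continuous_attains_sup[OF comp cont] by blast
  have "0 < (\<lambda>(s, t). h s (\<beta> t)) z" using z(1) J(2) curveD(2)[OF cv(1)] h_pos by auto
  then show ?thesis using z(2) w by (intro exI conjI) auto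
qed

text \<open>The new time component is \<open>\<alpha>' t = \<alpha> t + \<epsilon> * \<phi> t\<close> with the function \<open>\<phi>\<close> of \<open>bending_function\<close> for a
  set \<open>K\<close> with slack. Passing from \<open>\<alpha> t\<close> to \<open>\<alpha>' t\<close> increases the quotient of speed and \<open>h\<close> at
  most by the factor \<open>1 + L * \<epsilon> * \<bar>\<phi> t\<bar>\<close>, and the growth of \<open>\<phi>\<close> exceeds this; on \<open>K\<close> the slack pays for
  the loss \<open>\<kappa>\<close>.\<close>

theorem timelike_perturbation:
  assumes "a < b" and cv: "curve a b \<alpha> \<beta>"
    and causal: "directed (\<le>) a b \<alpha> \<beta>"
    and pq0: "a \<le> p0" "p0 < q0" "q0 \<le> b"
    and timelike: "directed (<) p0 q0 \<alpha> \<beta>"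
  shows "chronological_rel h I X d (\<alpha> a, \<beta> a) (\<alpha> b, \<beta> b)"
proof -
  have ab: "a \<le> b" "a \<in> {a..b}" "b \<in> {a..b}" using \<open>a < b\<close> by auto
  have "{t\<in>{a..b}. \<not> (\<exists>D>0. (\<alpha> has_real_derivative D) (at t))} \<subseteq> {t\<in>{a..b}. \<not> directed_at h d (\<le>) \<alpha> \<beta> t}"
    by (auto simp: directed_at_def)
  then have pos: "negligible {t\<in>{a..b}. \<not> (\<exists>D>0. (\<alpha> has_real_derivative D) (at t))}"
    using causal negligible_subset by blast
  have mono: "\<alpha> s \<le> \<alpha> t" if "a \<le> s" "s \<le> t" "t \<le> b" for s t
    using abs_continuous_deriv_pos_mono[OF \<open>a < b\<close> curveD(4)[OF cv] pos that] .
  obtain \<tau>1 where \<tau>1: "\<tau>1 > 0" "cball (\<alpha> a) \<tau>1 \<subseteq> I"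
    using open_I curveD(1)[OF cv ab(2)] open_contains_cball by blast
  obtain \<tau>2 where \<tau>2: "\<tau>2 > 0" "cball (\<alpha> b) \<tau>2 \<subseteq> I"
    using open_I curveD(1)[OF cv ab(3)] open_contains_cball by blast
  \<comment> \<open>\<open>J\<close> leaves room of size \<open>\<tau>\<close> around the range of \<open>\<alpha>\<close> for the perturbed time component.\<close>
  define \<tau> where "\<tau> = min \<tau>1 \<tau>2"
  have \<tau>: "\<tau> > 0" using \<tau>1 \<tau>2 by (simp add: \<tau>_def)
  define J where "J = {\<alpha> a - \<tau>..\<alpha> b + \<tau>}"
  have J: "compact J" "J \<subseteq> I" "J \<noteq> {}"
  proof -
    show "compact J" by (simp add: J_def)
    show "J \<noteq> {}" using mono[of a b] \<tau> ab by (simp add: J_def)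
    show "J \<subseteq> I"
    proof
      fix s assume s: "s \<in> J"
      have lo: "\<alpha> a - \<tau> \<in> I" using \<tau>1 \<tau> by (auto simp: \<tau>_def dist_real_def subset_iff)
      have hi: "\<alpha> b + \<tau> \<in> I" using \<tau>2 \<tau> by (auto simp: \<tau>_def dist_real_def subset_iff)
      show "s \<in> I" by (rule mem_is_interval_1_I[OF interval_I lo hi]) (use s in \<open>auto simp: J_def\<close>)
    qed
  qed
  have \<alpha>J: "\<alpha> t \<in> J" if "t \<in> {a..b}" for t
    using mono[of a t] mono[of t b] that \<tau> by (auto simp: J_def)
  obtain C \<rho> where C: "C \<ge> 0" "\<rho> > 0" and Cmp: "comparable_with C \<rho> J d a b \<beta>"
    using comparable[OF cv ab(1) J(1,2)] unfolding comparable_along_def by auto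
  obtain C' where C': "C' > 0" "\<forall>s\<in>J. \<forall>s'\<in>J. \<forall>x\<in>\<beta> ` {a..b}. \<bar>h s x - h s' x\<bar> \<le> C' * \<bar>s - s'\<bar>"
    using h_lipschitz[OF J(1,2) compactin_space_component[OF cv ab(1)]] by blast
  obtain h0 h1 where h0: "h0 > 0" and hb: "\<forall>s\<in>J. \<forall>t\<in>{a..b}. h0 \<le> h s (\<beta> t) \<and> h s (\<beta> t) \<le> h1"
    using h_bounds[OF cv ab(1) J] by blast
  have h1: "h1 > 0" using hb h0 \<alpha>J ab by force
  \<comment> \<open>\<open>B\<close> is a log-Lipschitz constant of \<open>h\<close> in time, \<open>E\<close> one of the quotient of speed and \<open>h\<close>. The
    choice of \<open>L\<close> allows \<open>exp (E * x)\<close> to be replaced by \<open>1 + L * x\<close> when \<open>L * x \<le> 1\<close>.\<close>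
  define B where "B = C' / h0"
  define E where "E = B + C"
  define L where "L = 2 * E + 1"
  have BE: "B > 0" "E > 0" "L > 0" using C C' h0 by (auto simp: B_def E_def L_def add_pos_nonneg)
  define p where "p = (p0 + q0) / 2"
  have p: "p0 < p" "p < q0" using pq0 by (auto simp: p_def)
  \<comment> \<open>The interval \<open>[p, q]\<close> is so short that \<open>\<alpha>\<close> varies by at most \<open>1 / (8 * L)\<close> on it.\<close>
  have "isCont \<alpha> p"
  proof -
    have "p \<in> {a<..<b}" using p pq0 by auto
    then show ?thesis
      by (intro continuous_on_interior[OF abs_continuous_curve_continuous[OF curveD(4)[OF cv]]])
        (simp add: interior_atLeastAtMost_real)
  qed
  then have "\<forall>\<^sub>F t in at p. dist (\<alpha> t) (\<alpha> p) < 1 / (8 * L)"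
    using BE by (intro tendstoD) (auto simp: isCont_def)
  then obtain \<delta> where \<delta>: "\<delta> > 0" "\<forall>t. t \<noteq> p \<and> dist t p < \<delta> \<longrightarrow> dist (\<alpha> t) (\<alpha> p) < 1 / (8 * L)"
    unfolding eventually_at by auto
  define q where "q = min (p + \<delta> / 2) ((p + q0) / 2)"
  have q: "p < q" "q < q0" "q < p + \<delta>" using p \<delta>(1) by (auto simp: q_def min_def)
  have near: "\<bar>\<alpha> t - \<alpha> p\<bar> \<le> 1 / (8 * L)" if "t \<in> {p..q}" for t
    using \<delta>(2) that q BE by (cases "t = p") (auto simp: dist_real_def less_imp_le)
  have "{t\<in>{p..q}. \<not> directed_at h d (<) \<alpha> \<beta> t} \<subseteq> {t\<in>{p0..q0}. \<not> directed_at h d (<) \<alpha> \<beta> t}"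
    using p q by auto
  then have tl: "directed (<) p q \<alpha> \<beta>"
    using timelike negligible_subset by blast
  have apqb: "a \<le> p" "p < q" "q < b" using p q pq0 by auto
  obtain K \<eta> where K: "compact K" "K \<subseteq> {p..q}" "\<not> negligible K" and \<eta>: "0 < \<eta>"
    and slack: "\<forall>t\<in>K. \<forall>D v. (\<alpha> has_real_derivative D) (at t) \<longrightarrow> has_speed d \<beta> (\<alpha> t) t v \<longrightarrow>
       v + \<eta> \<le> h (\<alpha> t) (\<beta> t) * D"
    using compact_set_with_slack[OF cv apqb tl] by blast
  have "\<exists>\<phi> \<kappa> M. \<phi> a = 0 \<and> \<phi> b = 0 \<and> 0 \<le> \<kappa> \<and> 0 \<le> M \<and> (\<forall>t\<in>{a..b}. \<bar>\<phi> t\<bar> < 2) \<and>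
    (\<forall>s t. a \<le> s \<longrightarrow> s \<le> t \<longrightarrow> t \<le> b \<longrightarrow> \<bar>\<phi> s - \<phi> t\<bar> \<le> M * \<bar>\<alpha> s - \<alpha> t\<bar> + M * (t - s)) \<and>
    negligible {t\<in>{a..b}. \<not> bends_at L \<kappa> K \<alpha> \<phi> t}"
    by (intro bending_function[of a b \<alpha> L p q K] mono near BE K apqb(1,2) less_imp_le[OF apqb(3)])
  then obtain \<phi> \<kappa> M where \<phi>: "\<phi> a = 0" "\<phi> b = 0" and \<kappa>: "0 \<le> \<kappa>" and M: "0 \<le> M"
    and \<phi>2: "\<forall>t\<in>{a..b}. \<bar>\<phi> t\<bar> < 2"
    and \<phi>_lip: "\<forall>s t. a \<le> s \<longrightarrow> s \<le> t \<longrightarrow> t \<le> b \<longrightarrow> \<bar>\<phi> s - \<phi> t\<bar> \<le> M * \<bar>\<alpha> s - \<alpha> t\<bar> + M * (t - s)"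
    and \<phi>_der: "negligible {t\<in>{a..b}. \<not> bends_at L \<kappa> K \<alpha> \<phi> t}"
    by blast
  \<comment> \<open>\<open>\<eta>'\<close> is the slack expressed in terms of the derivative of \<open>\<alpha>\<close>. The bounds on \<open>\<epsilon>\<close> keep \<open>\<alpha>'\<close> in \<open>J\<close>,
    make the linearization of \<open>exp\<close> valid and let the slack pay for the decrease of \<open>\<phi>\<close> on \<open>K\<close>.\<close>
  define \<eta>' where "\<eta>' = \<eta> / h1"
  have \<eta>': "\<eta>' > 0" using \<eta> h1 by (simp add: \<eta>'_def)
  define \<epsilon> where "\<epsilon> = min (\<tau> / 2) (min (1 / (2 * L)) (\<eta>' / (\<kappa> + 1)))"
  have \<epsilon>: "\<epsilon> > 0" "2 * \<epsilon> \<le> \<tau>" "2 * L * \<epsilon> \<le> 1" "\<epsilon> * \<kappa> \<le> \<eta>'"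
  proof -
    show "\<epsilon> > 0" using \<tau> BE \<eta>' \<kappa> by (simp add: \<epsilon>_def add_nonneg_pos)
    show "2 * \<epsilon> \<le> \<tau>" by (simp add: \<epsilon>_def)
    have "\<epsilon> \<le> 1 / (2 * L)" by (simp add: \<epsilon>_def)
    then show "2 * L * \<epsilon> \<le> 1" using BE by (simp add: field_simps)
    have "\<epsilon> \<le> \<eta>' / (\<kappa> + 1)" by (simp add: \<epsilon>_def)
    then have "\<epsilon> * (\<kappa> + 1) \<le> \<eta>'" using \<kappa> by (simp add: pos_le_divide_eq add_nonneg_pos)
    then show "\<epsilon> * \<kappa> \<le> \<eta>'" using \<open>\<epsilon> > 0\<close> by (simp add: algebra_simps)
  qed
  define \<alpha>' where "\<alpha>' t = \<alpha> t + \<epsilon> * \<phi> t" for t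
  have ends: "\<alpha>' a = \<alpha> a" "\<alpha>' b = \<alpha> b"
    using \<phi> by (auto simp: \<alpha>'_def)
  have \<epsilon>\<phi>: "\<epsilon> * \<bar>\<phi> t\<bar> \<le> 2 * \<epsilon>" if "t \<in> {a..b}" for t
    using mult_left_mono[of "\<bar>\<phi> t\<bar>" 2 \<epsilon>] \<phi>2 that \<epsilon>(1) by (simp add: less_imp_le)
  have \<alpha>'J: "\<alpha>' t \<in> J" if "t \<in> {a..b}" for t
  proof -
    have "\<bar>\<epsilon> * \<phi> t\<bar> = \<epsilon> * \<bar>\<phi> t\<bar>" using \<epsilon>(1) by (simp add: abs_mult)
    then have "\<bar>\<epsilon> * \<phi> t\<bar> \<le> \<tau>" using \<epsilon>\<phi>[OF that] \<epsilon>(2) by linarith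
    then show ?thesis using mono[of a t] mono[of t b] that unfolding J_def \<alpha>'_def by auto
  qed
  have cv': "curve a b \<alpha>' \<beta>"
  proof -
    have "abs_continuous_curve dist a b \<alpha>'"
    proof (rule abs_continuous_curve_le[OF curveD(4)[OF cv], of "1 + \<epsilon> * M"])
      show "0 \<le> 1 + \<epsilon> * M" using \<epsilon>(1) M by simp
      fix s t assume st: "a \<le> s" "s \<le> t" "t \<le> b"
      have "\<bar>\<epsilon> * (\<phi> s - \<phi> t)\<bar> \<le> \<epsilon> * (M * \<bar>\<alpha> s - \<alpha> t\<bar> + M * (t - s))"
        using \<phi>_lip st \<epsilon>(1) by (simp add: abs_mult)
      moreover have "\<alpha>' s - \<alpha>' t = (\<alpha> s - \<alpha> t) + \<epsilon> * (\<phi> s - \<phi> t)"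
        by (simp add: \<alpha>'_def algebra_simps)
      ultimately have "\<bar>\<alpha>' s - \<alpha>' t\<bar> \<le> \<bar>\<alpha> s - \<alpha> t\<bar> + \<epsilon> * (M * \<bar>\<alpha> s - \<alpha> t\<bar> + M * (t - s))"
        by linarith
      then show "dist (\<alpha>' s) (\<alpha>' t) \<le> (1 + \<epsilon> * M) * dist (\<alpha> s) (\<alpha> t) + (1 + \<epsilon> * M) * (t - s)"
        using st by (simp add: dist_real_def algebra_simps)
    qed
    then show ?thesis
      using \<alpha>'J J(2) curveD(3,5)[OF cv] by (auto simp: abs_continuous_in_product_def)
  qed
  let ?N = "{t\<in>{a..b}. \<not> directed_at h d (\<le>) \<alpha> \<beta> t} \<union>
    {t\<in>{a..b}. \<not> (\<forall>s\<in>I. \<exists>v. has_speed d \<beta> s t v \<and> gen_metric_speed d a b \<beta> s t = ereal v)} \<union>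
    {t\<in>{a..b}. \<not> bends_at L \<kappa> K \<alpha> \<phi> t} \<union> {a, b}"
  have N: "negligible ?N"
    using causal speeds_exist[OF cv \<open>a < b\<close>] \<phi>_der by (simp only: negligible_Un_eq) simp
  have "directed_at h d (<) \<alpha>' \<beta> t" if t: "t \<in> {a..b}" and tN: "t \<notin> ?N" for t
  proof -
    have tab: "a < t" "t < b" using t tN by auto
    have "directed_at h d (\<le>) \<alpha> \<beta> t" using t tN by blast
    then obtain D v where D: "0 < D" "(\<alpha> has_real_derivative D) (at t)"
      and v: "has_speed d \<beta> (\<alpha> t) t v" and vD: "v \<le> h (\<alpha> t) (\<beta> t) * D"
      unfolding directed_at_def by blast
    have "bends_at L \<kappa> K \<alpha> \<phi> t" using t tN by blast
    then obtain g where g: "L * \<bar>\<phi> t\<bar> < g" and \<phi>': "(\<phi> has_real_derivative g * D - \<kappa> * indicator K t) (at t)"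
      using D(2) unfolding bends_at_def by blast
    have "\<alpha>' t \<in> I" using \<alpha>'J[OF t] J(2) by blast
    then obtain v' where v': "has_speed d \<beta> (\<alpha>' t) t v'" using t tN by blast
    let ?i = "indicator K t :: real"
    let ?H = "h (\<alpha> t) (\<beta> t)" and ?H' = "h (\<alpha>' t) (\<beta> t)"
    define D' where "D' = D + \<epsilon> * (g * D - \<kappa> * ?i)"
    have D': "(\<alpha>' has_real_derivative D') (at t)"
      unfolding \<alpha>'_def[abs_def] D'_def using D(2) \<phi>' by (auto intro!: derivative_eq_intros)
    define x where "x = \<epsilon> * \<bar>\<phi> t\<bar>"
    have x: "\<bar>\<alpha>' t - \<alpha> t\<bar> = x" "\<bar>\<alpha> t - \<alpha>' t\<bar> = x" "0 \<le> x" using \<epsilon>(1) by (auto simp: \<alpha>'_def x_def abs_mult)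
    have Hpos: "0 < ?H" "0 < ?H'" "h0 \<le> ?H'" "?H \<le> h1"
      using hb[rule_format, OF \<alpha>J[OF t] t] hb[rule_format, OF \<alpha>'J[OF t] t] h0 by auto
    have v0: "0 \<le> v" using curveD(1)[OF cv t] v by (rule has_speed_nonneg)
    have sl: "v \<le> ?H * (D - \<eta>' * ?i)"
    proof (cases "t \<in> K")
      case True
      have "?H * \<eta>' \<le> \<eta>" using Hpos(4) \<eta> h1 by (simp add: \<eta>'_def pos_divide_le_eq)
      moreover have "v + \<eta> \<le> ?H * D" using slack True D(2) v by blast
      ultimately show ?thesis using True by (simp add: right_diff_distrib)
    qed (use vD in simp)
    then have "0 \<le> ?H * (D - \<eta>' * ?i)" using v0 by simp
    then have slack_nonneg: "0 \<le> D - \<eta>' * ?i" using Hpos(1) by (simp add: zero_le_mult_iff)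
    have HH': "?H \<le> exp (B * x) * ?H'"
    proof -
      have "?H \<le> ?H' + C' * x" using C'(2)[rule_format, OF \<alpha>J[OF t] \<alpha>'J[OF t], of "\<beta> t"] t x by auto
      also have "C' * x = B * x * h0" using h0 by (simp add: B_def)
      also have "\<dots> \<le> B * x * ?H'" using Hpos(3) BE x(3) by (intro mult_left_mono) auto
      also have "?H' + B * x * ?H' = (1 + B * x) * ?H'" by (simp add: algebra_simps)
      also have "\<dots> \<le> exp (B * x) * ?H'" using Hpos(2) by (intro mult_right_mono exp_ge_add_one_self) auto
      finally show ?thesis by simp
    qed
    \<comment> \<open>passing from time \<open>\<alpha> t\<close> to \<open>\<alpha>' t\<close> costs \<open>exp (C * x)\<close> in the speed and \<open>exp (B * x)\<close> in \<open>h\<close>\<close>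
    have "v' \<le> exp (C * x) * v"
      using has_speed_le[where d=d and \<beta>=\<beta>, OF Cmp C(2) \<alpha>'J[OF t] \<alpha>J[OF t] tab v' v] x by simp
    also have "\<dots> \<le> exp (C * x) * (?H * (D - \<eta>' * ?i))" using sl by (intro mult_left_mono) auto
    also have "\<dots> \<le> exp (C * x) * ((exp (B * x) * ?H') * (D - \<eta>' * ?i))"
      using HH' slack_nonneg by (intro mult_left_mono mult_right_mono) auto
    also have "\<dots> = exp (E * x) * (?H' * (D - \<eta>' * ?i))"
      using exp_add[of "B * x" "C * x"] by (simp add: E_def distrib_right mult.left_commute mult.assoc)
    also have "\<dots> \<le> (1 + L * x) * (?H' * (D - \<eta>' * ?i))"
    proof (rule mult_right_mono)
      have "L * x \<le> 1"
      proof -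
        have "L * x \<le> L * (2 * \<epsilon>)" using \<epsilon>\<phi>[OF t] BE by (intro mult_left_mono) (auto simp: x_def)
        then show ?thesis using \<epsilon>(3) by (simp add: mult_ac)
      qed
      moreover have "E * x \<ge> 0" using BE x(3) by simp
      moreover have Lx: "L * x = 2 * (E * x) + x" by (simp add: L_def algebra_simps)
      ultimately have "exp (E * x) \<le> 1 + 2 * (E * x)" using x(3) by (intro exp_le_linear) auto
      then show "exp (E * x) \<le> 1 + L * x" using Lx x(3) by simp
      show "0 \<le> ?H' * (D - \<eta>' * ?i)" using Hpos(2) slack_nonneg by simp
    qed
    also have "\<dots> = ?H' * ((1 + L * x) * (D - \<eta>' * ?i))" by (simp add: mult_ac)
    finally have v'_le: "v' \<le> ?H' * ((1 + L * x) * (D - \<eta>' * ?i))" .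
    have less: "(1 + L * x) * (D - \<eta>' * ?i) < D'"
    proof -
      have "(1 + L * x) * (D - \<eta>' * ?i) = D + L * x * D - \<eta>' * ?i - L * x * (\<eta>' * ?i)" by (simp add: algebra_simps)
      moreover have "0 \<le> L * x * (\<eta>' * ?i)" using BE x(3) \<eta>' by simp
      moreover have "\<epsilon> * \<kappa> * ?i \<le> \<eta>' * ?i" using \<epsilon>(4) by (intro mult_right_mono) auto
      moreover have "L * x * D < \<epsilon> * (g * D)"
      proof -
        have "\<epsilon> * (L * \<bar>\<phi> t\<bar>) * D < \<epsilon> * g * D"
          using g \<epsilon>(1) D(1) by (intro mult_strict_right_mono mult_strict_left_mono)
        then show ?thesis by (simp add: x_def mult_ac)
      qed
      moreover have "D' = D + \<epsilon> * (g * D) - \<epsilon> * \<kappa> * ?i" by (simp add: D'_def algebra_simps)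
      ultimately show ?thesis by linarith
    qed
    have "0 \<le> (1 + L * x) * (D - \<eta>' * ?i)" using slack_nonneg BE x(3) by simp
    then have "0 < D'" using less by simp
    moreover have "v' < ?H' * D'"
      using v'_le less Hpos(2) by (meson le_less_trans mult_strict_left_mono)
    ultimately show ?thesis unfolding directed_at_def using D' v' by blast
  qed
  then have "{t\<in>{a..b}. \<not> directed_at h d (<) \<alpha>' \<beta> t} \<subseteq> ?N" by blast
  with N have "directed (<) a b \<alpha>' \<beta>" by (rule negligible_subset)
  then show ?thesis
    unfolding chronological_rel_iff using \<open>a < b\<close> cv' ends
    by (intro exI[of _ a] exI[of _ b] exI[of _ \<alpha>'] exI[of _ \<beta>]) simp
qed

lemma chronological_of_concatenation:
  assumes "a1 < b1" "curve a1 b1 \<alpha>1 \<beta>1" "directed R1 a1 b1 \<alpha>1 \<beta>1"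
    and "a2 < b2" "curve a2 b2 \<alpha>2 \<beta>2" "directed R2 a2 b2 \<alpha>2 \<beta>2"
    and match: "(\<alpha>1 b1, \<beta>1 b1) = (\<alpha>2 a2, \<beta>2 a2)"
    and R: "R1 = (<) \<and> R2 = (\<le>) \<or> R1 = (\<le>) \<and> R2 = (<)"
  shows "chronological_rel h I X d (\<alpha>1 a1, \<beta>1 a1) (\<alpha>2 b2, \<beta>2 b2)"
proof -
  have "\<alpha>1 b1 = \<alpha>2 a2" "\<beta>1 b1 = \<beta>2 a2" using match by auto
  from concatenate_curves[OF assms(1-6) this]
  obtain e \<alpha> \<beta> where c: "b1 < e" "curve a1 e \<alpha> \<beta>"
    "directed R1 a1 b1 \<alpha> \<beta>" "directed R2 b1 e \<alpha> \<beta>"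
    "\<alpha> a1 = \<alpha>1 a1" "\<beta> a1 = \<beta>1 a1" "\<alpha> e = \<alpha>2 b2" "\<beta> e = \<beta>2 b2"
    by blast
  have "directed_at h d (\<le>) \<alpha> \<beta> t" if "directed_at h d R \<alpha> \<beta> t" "R = (<) \<or> R = (\<le>)" for R t
    using that unfolding directed_at_def by (meson less_imp_le)
  then have "{t\<in>{a1..e}. \<not> directed_at h d (\<le>) \<alpha> \<beta> t} \<subseteq>
      {t\<in>{a1..b1}. \<not> directed_at h d R1 \<alpha> \<beta> t} \<union> {t\<in>{b1..e}. \<not> directed_at h d R2 \<alpha> \<beta> t}"
    using R by fastforce
  then have causal: "directed (\<le>) a1 e \<alpha> \<beta>"
    by (rule negligible_subset[rotated]) (use c(3,4) in \<open>simp add: negligible_Un_eq\<close>)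
  have "chronological_rel h I X d (\<alpha> a1, \<beta> a1) (\<alpha> e, \<beta> e)"
    using R
  proof
    assume "R1 = (<) \<and> R2 = (\<le>)"
    then show ?thesis
      using assms(1) c(1-3) causal by (intro timelike_perturbation[of a1 e _ _ a1 b1]) auto
  next
    assume "R1 = (\<le>) \<and> R2 = (<)"
    then show ?thesis
      using assms(1) c(1,2,4) causal by (intro timelike_perturbation[of a1 e _ _ b1 e]) auto
  qed
  then show ?thesis using c(5-8) by simp
qed

theorem push_up_property: "push_up h I X d"
  unfolding push_up_def
proof (intro ballI impI)
  fix x y z
  assume "(causal_rel h I X d x y \<and> chronological_rel h I X d y z) \<or>
    (chronological_rel h I X d x y \<and> causal_rel h I X d y z)"
  then show "chronological_rel h I X d x z"
  proof
    assume xyz: "causal_rel h I X d x y \<and> chronological_rel h I X d y z"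
    show ?thesis
    proof (cases "x = y")
      case False
      then obtain a1 b1 \<alpha>1 \<beta>1 where 1: "a1 < b1" "curve a1 b1 \<alpha>1 \<beta>1"
        "directed (\<le>) a1 b1 \<alpha>1 \<beta>1" "(\<alpha>1 a1, \<beta>1 a1) = x" "(\<alpha>1 b1, \<beta>1 b1) = y"
        using xyz unfolding causal_rel_iff by blast
      obtain a2 b2 \<alpha>2 \<beta>2 where 2: "a2 < b2" "curve a2 b2 \<alpha>2 \<beta>2"
        "directed (<) a2 b2 \<alpha>2 \<beta>2" "(\<alpha>2 a2, \<beta>2 a2) = y" "(\<alpha>2 b2, \<beta>2 b2) = z"
        using xyz unfolding chronological_rel_iff by blast
      have "(\<alpha>1 b1, \<beta>1 b1) = (\<alpha>2 a2, \<beta>2 a2)" using 1(5) 2(4) by simp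
      from chronological_of_concatenation[OF 1(1-3) 2(1-3) this] 1(4) 2(5) show ?thesis by simp
    qed (use xyz in simp)
  next
    assume xyz: "chronological_rel h I X d x y \<and> causal_rel h I X d y z"
    show ?thesis
    proof (cases "y = z")
      case False
      then obtain a2 b2 \<alpha>2 \<beta>2 where 2: "a2 < b2" "curve a2 b2 \<alpha>2 \<beta>2"
        "directed (\<le>) a2 b2 \<alpha>2 \<beta>2" "(\<alpha>2 a2, \<beta>2 a2) = y" "(\<alpha>2 b2, \<beta>2 b2) = z"
        using xyz unfolding causal_rel_iff by blast
      obtain a1 b1 \<alpha>1 \<beta>1 where 1: "a1 < b1" "curve a1 b1 \<alpha>1 \<beta>1"
        "directed (<) a1 b1 \<alpha>1 \<beta>1" "(\<alpha>1 a1, \<beta>1 a1) = x" "(\<alpha>1 b1, \<beta>1 b1) = y"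
        using xyz unfolding chronological_rel_iff by blast
      have "(\<alpha>1 b1, \<beta>1 b1) = (\<alpha>2 a2, \<beta>2 a2)" using 1(5) 2(4) by simp
      from chronological_of_concatenation[OF 1(1-3) 2(1-3) this] 1(4) 2(5) show ?thesis by simp
    qed (use xyz in simp)
  qed
qed

end

theorem theorem1p3:
  fixes X :: "'a topology"
    and I :: "real set"
    and h :: "real \<Rightarrow> 'a \<Rightarrow> real"
    and d :: "real \<Rightarrow> 'a \<Rightarrow> 'a \<Rightarrow> real"
  assumes "locally_compact_space X"
    and "open I" and "is_interval I"
    and "continuous_map (prod_topology (top_of_set I) X) euclideanreal (\<lambda>(s, x). h s x)"
    and "\<And>s x. s \<in> I \<Longrightarrow> x \<in> topspace X \<Longrightarrow> h s x > 0"
    and "\<And>s. s \<in> I \<Longrightarrow> Metric_space (topspace X) (d s)"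
    and "\<And>s. s \<in> I \<Longrightarrow> generates_topology (length_metric (topspace X) (d s)) X"
    and "\<And>J K. compact J \<Longrightarrow> J \<subseteq> I \<Longrightarrow> compactin X K \<Longrightarrow>
           \<exists>C>0. \<exists>r>0. \<forall>s\<in>J. \<forall>s'\<in>J. \<forall>x\<in>K. \<forall>y\<in>K.
             x \<noteq> y \<and> (INF \<sigma>\<in>J. d \<sigma> x y) < r \<longrightarrow> \<bar>ln (d s x y / d s' x y)\<bar> \<le> C * \<bar>s - s'\<bar>"
    and "\<And>J K. compact J \<Longrightarrow> J \<subseteq> I \<Longrightarrow> compactin X K \<Longrightarrow>
           \<exists>C'>0. \<forall>s\<in>J. \<forall>s'\<in>J. \<forall>x\<in>K. \<bar>h s x - h s' x\<bar> \<le> C' * \<bar>s - s'\<bar>"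
  shows "push_up h I X d"
proof -
  have "generalized_product X I h d"
    using assms(2-) by (rule generalized_product.intro)
  then show ?thesis by (rule generalized_product.push_up_property)
qed

end
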